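(* Let $m,n$ be positive integers, $u$ a multilinear commutator word, $v$ the product of $896$ $u$-words and $w=v^m$. Let $\mathcal U(m,n,u)$ be the class of all groups $G$ in which every $w$-value is $n$-Engel in $G$ and the verbal subgroup $u(G)$ has an ascending normal series each of whose quotients is either locally soluble or locally finite. Then $\mathcal U(m,n,u)$ is precisely the class of all groups $G$ in which every $w$-value is $n$-Engel in $G$ and every finitely generated subgroup of $u(G)$ has an ascending normal series each of whose quotients is either locally soluble or locally finite.
   Context: A multilinear commutator word of weight $s$ is a word having the form of a multilinear Lie monomial in exactly $s$ independent variables: a single variable is one of weight $1$, and for $s\ge 2$ it is $[\alpha,\beta]$ with $\alpha,\beta$ multilinear commutator words in disjoint sets of variables whose weights sum to $s$. Here $[x,y]=x^{-1}y^{-1}xy$. Given a positive integer $s$ and a word $u=u(x_1,\dots,x_k)$, the product of $s$ $u$-words is the word $u(x_{11},\dots,x_{1k})u(x_{21},\dots,x_{2k})\cdots u(x_{s1},\dots,x_{sk})$ in $ks$ independent variables. For a word $w$, a $w$-value in $G$ is an element obtained by substituting elements of $G$ for the variables of $w$, and $w(G)$ is the subgroup generated by all $w$-values in $G$. An element $x\in G$ is (left) $n$-Engel if $[g,_n x]=1$ for all $g\in G$, where $[g,_0x]=g$ and $[g,_ix]=[[g,_{i-1}x],x]$. A group locally has a property if all its finitely generated subgroups have it. An ascending normal series of a group $K$ is a chain $(K_\alpha)_{\alpha\le\beta}$ of normal subgroups of $K$ indexed by ordinals, with $K_0=1$, $K_\beta=K$, $K_\alpha\le K_{\alpha+1}$,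 and $K_\lambda=\bigcup_{\alpha<\lambda}K_\alpha$ for limit ordinals $\lambda\le\beta$; its quotients are the groups $K_{\alpha+1}/K_\alpha$. *)

theory Defs
  imports "HOL-Algebra.Algebra"
begin

section \<open>Group words\<close>

datatype (vars: 'v) gword =
    WVar 'v
  | WOne
  | WInv "'v gword"
  | WMul "'v gword" "'v gword"
  for map: rename_vars

definition WComm :: "'v gword \<Rightarrow> 'v gword \<Rightarrow> 'v gword" where
  "WComm a b = WMul (WMul (WMul (WInv a) (WInv b)) a) b"

inductive mlc_of_weight :: "nat \<Rightarrow> 'v gword \<Rightarrow> bool" where
  variable: "mlc_of_weight 1 (WVar x)"
| bracket: "mlc_of_weight s a \<Longrightarrow> mlc_of_weight t b \<Longrightarrow> vars a \<inter> vars b = {}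
    \<Longrightarrow> mlc_of_weight (s + t) (WComm a b)"

definition multilinear_commutator_word :: "'v gword \<Rightarrow> bool" where
  "multilinear_commutator_word u \<longleftrightarrow> (\<exists>s. mlc_of_weight s u)"

text \<open>The variable \<open>x\<close> of the \<open>j\<close>-th copy of \<open>u\<close> becomes the variable \<open>(j, x)\<close>,
  so distinct copies have disjoint sets of variables.\<close>

definition product_word :: "nat \<Rightarrow> 'v gword \<Rightarrow> (nat \<times> 'v) gword" where
  "product_word s u = foldr WMul (map (\<lambda>j. rename_vars (Pair j) u) [0..<s]) WOne"

primrec power_word :: "'v gword \<Rightarrow> nat \<Rightarrow> 'v gword" where
  "power_word w 0 = WOne"
| "power_word w (Suc m) = WMul (power_word w m) w"

primrec word_eval :: "('a, 'b) monoid_scheme \<Rightarrow> ('v \<Rightarrow> 'a) \<Rightarrow> 'v gword \<Rightarrow> 'a" where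
  "word_eval G \<theta> (WVar x) = \<theta> x"
| "word_eval G \<theta> WOne = \<one>\<^bsub>G\<^esub>"
| "word_eval G \<theta> (WInv a) = inv\<^bsub>G\<^esub> (word_eval G \<theta> a)"
| "word_eval G \<theta> (WMul a b) = word_eval G \<theta> a \<otimes>\<^bsub>G\<^esub> word_eval G \<theta> b"

definition word_values :: "('a, 'b) monoid_scheme \<Rightarrow> 'v gword \<Rightarrow> 'a set" where
  "word_values G w = {word_eval G \<theta> w | \<theta>. \<theta> \<in> UNIV \<rightarrow> carrier G}"

definition verbal_subgroup :: "('a, 'b) monoid_scheme \<Rightarrow> 'v gword \<Rightarrow> ('a, 'b) monoid_scheme" where
  "verbal_subgroup G w = subgroup_generated G (word_values G w)"

section \<open>Engel elements\<close>

definition group_commutator :: "('a, 'b) monoid_scheme \<Rightarrow> 'a \<Rightarrow> 'a \<Rightarrow> 'a" where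
  "group_commutator G x y = inv\<^bsub>G\<^esub> x \<otimes>\<^bsub>G\<^esub> inv\<^bsub>G\<^esub> y \<otimes>\<^bsub>G\<^esub> x \<otimes>\<^bsub>G\<^esub> y"

primrec iterated_commutator :: "('a, 'b) monoid_scheme \<Rightarrow> 'a \<Rightarrow> nat \<Rightarrow> 'a \<Rightarrow> 'a" where
  "iterated_commutator G g 0 x = g"
| "iterated_commutator G g (Suc i) x = group_commutator G (iterated_commutator G g i x) x"

definition left_engel :: "('a, 'b) monoid_scheme \<Rightarrow> nat \<Rightarrow> 'a \<Rightarrow> bool" where
  "left_engel G n x \<longleftrightarrow> x \<in> carrier G \<and> (\<forall>g\<in>carrier G. iterated_commutator G g n x = \<one>\<^bsub>G\<^esub>)"

section \<open>Local properties and ascending normal series\<close>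

definition group_locally ::
    "(('a, 'b) monoid_scheme \<Rightarrow> bool) \<Rightarrow> ('a, 'b) monoid_scheme \<Rightarrow> bool" where
  "group_locally P G \<longleftrightarrow> (\<forall>S. finite S \<and> S \<subseteq> carrier G \<longrightarrow> P (subgroup_generated G S))"

definition locally_soluble :: "('a, 'b) monoid_scheme \<Rightarrow> bool" where
  "locally_soluble = group_locally solvable"

definition locally_finite :: "('a, 'b) monoid_scheme \<Rightarrow> bool" where
  "locally_finite = group_locally (\<lambda>H. finite (carrier H))"

text \<open>The index set of a series is the field of a well-order \<open>r\<close> with a greatest element,
  playing the role of the ordinals up to \<open>\<beta>\<close>.\<close>

definition successor_in :: "'i rel \<Rightarrow> 'i \<Rightarrow> 'i \<Rightarrow> bool" where
  "successor_in r a b \<longleftrightarrow> a \<in> Field r \<and> b \<in> Field r \<and> underS r b = under r a"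

definition limit_in :: "'i rel \<Rightarrow> 'i \<Rightarrow> bool" where
  "limit_in r b \<longleftrightarrow> b \<in> Field r \<and> underS r b \<noteq> {} \<and> \<not> (\<exists>a. successor_in r a b)"

definition ascending_normal_series ::
    "('a, 'b) monoid_scheme \<Rightarrow> 'i rel \<Rightarrow> ('i \<Rightarrow> 'a set) \<Rightarrow> bool" where
  "ascending_normal_series K r C \<longleftrightarrow>
     Well_order r \<and>
     (\<forall>a\<in>Field r. C a \<lhd> K) \<and>
     (\<forall>a\<in>Field r. underS r a = {} \<longrightarrow> C a = {\<one>\<^bsub>K\<^esub>}) \<and>
     (\<exists>b\<in>Field r. under r b = Field r \<and> C b = carrier K) \<and>
     (\<forall>a b. successor_in r a b \<longrightarrow> C a \<subseteq> C b) \<and>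
     (\<forall>b. limit_in r b \<longrightarrow> C b = (\<Union>a\<in>underS r b. C a))"

definition ls_lf_series ::
    "('a, 'b) monoid_scheme \<Rightarrow> 'i rel \<Rightarrow> ('i \<Rightarrow> 'a set) \<Rightarrow> bool" where
  "ls_lf_series K r C \<longleftrightarrow> ascending_normal_series K r C \<and>
     (\<forall>a b. successor_in r a b \<longrightarrow>
        locally_soluble (K\<lparr>carrier := C b\<rparr> Mod C a) \<or> locally_finite (K\<lparr>carrier := C b\<rparr> Mod C a))"

text \<open>HOL cannot quantify over the index type existentially. Sets of group elements suffice as
  indices for series of any length; this is lemma \<open>has_ls_lf_seriesI\<close> below.\<close>

definition has_ls_lf_series :: "('a, 'b) monoid_scheme \<Rightarrow> bool" where
  "has_ls_lf_series K \<longleftrightarrow> (\<exists>(r :: 'a set rel) C. ls_lf_series K r C)"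

lemma ascending_normal_series_mono:
  assumes S: "ascending_normal_series K r C" and ab: "(a, b) \<in> r"
  shows "C a \<subseteq> C b"
proof -
  from S have wo: "Well_order r" by (simp add: ascending_normal_series_def)
  then interpret w: wo_rel r by (simp add: wo_rel_def)
  have "\<forall>a. (a, b) \<in> r \<longrightarrow> C a \<subseteq> C b"
  proof (induction b rule: w.well_order_induct)
    case (1 b)
    show ?case
    proof (intro allI impI)
      fix a assume ab: "(a, b) \<in> r"
      show "C a \<subseteq> C b"
      proof (cases "a = b")
        case False
        hence a: "a \<in> underS r b" using ab by (simp add: underS_def)
        have b: "b \<in> Field r" using ab by (auto simp: Field_def)
        show ?thesis
        proof (cases "\<exists>c. successor_in r c b")
          case True
          then obtain c where c: "successor_in r c b" by blast
          hence u: "underS r b = under r c" and cF: "c \<in> Field r" by (auto simp: successor_in_def)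
          have "c \<in> underS r b" using u cF w.REFL by (simp add: Refl_under_in)
          hence "C a \<subseteq> C c" using 1 a u by (auto simp: underS_def under_def)
          also have "C c \<subseteq> C b" using S c by (auto simp: ascending_normal_series_def)
          finally show ?thesis .
        next
          case False
          hence "limit_in r b" using a b by (auto simp: limit_in_def)
          hence "C b = (\<Union>a\<in>underS r b. C a)" using S by (auto simp: ascending_normal_series_def)
          thus ?thesis using a by blast
        qed
      qed simp
    qed
  qed
  thus ?thesis using ab by blast
qed

lemma has_ls_lf_seriesI:
  fixes K :: "('a, 'b) monoid_scheme" and r :: "'i rel"
  assumes S: "ls_lf_series K r C"
  shows "has_ls_lf_series K"
proof -
  have A: "ascending_normal_series K r C" using S by (simp add: ls_lf_series_def)
  hence "Well_order r" by (simp add: ascending_normal_series_def)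
  then interpret w: wo_rel r by (simp add: wo_rel_def)
  note mono = ascending_normal_series_mono[OF A]
  define T where "T = C ` Field r"
  define r' where "r' = {(M, N). M \<in> T \<and> N \<in> T \<and> M \<subseteq> N}"
  define f where "f M = w.minim {a \<in> Field r. C a = M}" for M
  have f: "f M \<in> Field r" "C (f M) = M" "\<And>a. a \<in> Field r \<Longrightarrow> C a = M \<Longrightarrow> (f M, a) \<in> r"
    if "M \<in> T" for M
  proof -
    let ?B = "{a \<in> Field r. C a = M}"
    have B: "?B \<subseteq> Field r" "?B \<noteq> {}" using that by (auto simp: T_def)
    from w.minim_in[OF B] show "f M \<in> Field r" "C (f M) = M" by (auto simp: f_def)
    show "(f M, a) \<in> r" if "a \<in> Field r" "C a = M" for a
      using w.minim_least[OF B(1), of a] that by (auto simp: f_def)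
  qed
  have F: "Field r' = T" by (auto simp: r'_def Field_def)
  have lin: "(a, b) \<in> r \<or> (b, a) \<in> r" if "a \<in> Field r" "b \<in> Field r" for a b
    using w.TOTALS that by blast
  have fmono: "(f M, f N) \<in> r" if "M \<in> T" "N \<in> T" "M \<subseteq> N" for M N
    using that f lin[of "f M" "f N"] mono[of "f N" "f M"] by (metis subset_antisym)
  have fsmono: "(f M, f N) \<in> r - Id" if "(M, N) \<in> r' - Id" for M N
  proof -
    have MN: "M \<in> T" "N \<in> T" "M \<subseteq> N" "M \<noteq> N" using that by (auto simp: r'_def)
    have "f M \<noteq> f N" using MN(4) f(2)[OF MN(1)] f(2)[OF MN(2)] by metis
    thus ?thesis using fmono[OF MN(1-3)] by blast
  qed
  have antis: "x = y" if "(x, y) \<in> r" "(y, x) \<in> r" for x y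
    using w.ANTISYM that by (rule antisymD)
  have first: "C a \<in> underS r' N" if NT: "N \<in> T" and "a \<in> underS r (f N)" for a N
  proof -
    have a: "a \<noteq> f N" "(a, f N) \<in> r" "a \<in> Field r" using that by (auto simp: underS_def Field_def)
    have "C a \<subseteq> N" using mono[OF a(2)] f(2)[OF NT] by simp
    moreover have "C a \<noteq> N" using f(3)[OF NT a(3)] a antis by blast
    ultimately show ?thesis using a(3) NT by (auto simp: underS_def r'_def T_def)
  qed
  have wo': "Well_order r'"
  proof -
    have "r' - Id \<subseteq> inv_image (r - Id) f"
    proof
      fix p assume "p \<in> r' - Id"
      thus "p \<in> inv_image (r - Id) f" using fsmono[of "fst p" "snd p"] by (cases p) simp
    qed
    hence "wf (r' - Id)" using w.WF wf_inv_image wf_subset by blast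
    moreover have "Refl r'" unfolding refl_on_def F by (simp add: r'_def)
    moreover have "trans r'" unfolding r'_def trans_def by blast
    moreover have "antisym r'" unfolding r'_def antisym_def by blast
    moreover have "Total r'"
    proof -
      have "M \<subseteq> N \<or> N \<subseteq> M" if "M \<in> T" "N \<in> T" for M N
      proof -
        have "(f M, f N) \<in> r \<or> (f N, f M) \<in> r" using that f(1) lin by blast
        thus ?thesis using mono[of "f M" "f N"] mono[of "f N" "f M"] f(2) that by metis
      qed
      thus ?thesis unfolding total_on_def F by (simp add: r'_def)
    qed
    moreover have "r' \<subseteq> Field r' \<times> Field r'" unfolding F by (auto simp: r'_def)
    ultimately show ?thesis
      by (auto simp: well_order_on_def linear_order_on_def partial_order_on_def preorder_on_def)
  qed
  have succ_lift: "\<exists>a. successor_in r a (f N) \<and> C a = M" if s: "successor_in r' M N" for M N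
  proof -
    have MT: "M \<in> T" and NT: "N \<in> T" and u: "underS r' N = under r' M"
      using s by (auto simp: successor_in_def F)
    have "M \<in> underS r' N" using u MT by (auto simp: under_def r'_def)
    hence MN: "(M, N) \<in> r' - Id" by (auto simp: underS_def)
    have below: "C a \<subseteq> M" if "a \<in> underS r (f N)" for a
      using first[OF NT that] u by (auto simp: under_def r'_def)
    have fX: "f M \<in> underS r (f N)" using fsmono[OF MN] by (auto simp: underS_def)
    have "\<not> limit_in r (f N)"
    proof
      assume "limit_in r (f N)"
      hence "C (f N) = (\<Union>a\<in>underS r (f N). C a)" using A by (auto simp: ascending_normal_series_def)
      hence "N \<subseteq> M" using below f(2)[OF NT] by auto
      thus False using MN by (auto simp: r'_def)
    qed
    then obtain a where a: "successor_in r a (f N)"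
      using fX f(1)[OF NT] by (auto simp: limit_in_def)
    hence u2: "underS r (f N) = under r a" and aF: "a \<in> Field r" by (auto simp: successor_in_def)
    have "a \<in> underS r (f N)" using u2 aF w.REFL by (simp add: Refl_under_in)
    moreover have "(f M, a) \<in> r" using fX u2 by (auto simp: under_def)
    ultimately have "C a = M" using below mono f(2)[OF MT] by blast
    thus ?thesis using a by blast
  qed
  have A': "ascending_normal_series K r' (\<lambda>M. M)"
    unfolding ascending_normal_series_def
  proof (intro conjI)
    show "Well_order r'" by (rule wo')
    show "\<forall>M\<in>Field r'. M \<lhd> K" using A by (auto simp: ascending_normal_series_def F T_def)
    show "\<forall>M\<in>Field r'. underS r' M = {} \<longrightarrow> M = {\<one>\<^bsub>K\<^esub>}"
    proof (intro ballI impI)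
      fix M assume M: "M \<in> Field r'" "underS r' M = {}"
      hence MT: "M \<in> T" by (simp add: F)
      have "underS r (f M) = {}"
      proof (rule ccontr)
        assume "underS r (f M) \<noteq> {}"
        then obtain a where "a \<in> underS r (f M)" by blast
        hence "C a \<in> underS r' M" by (rule first[OF MT])
        thus False using M by simp
      qed
      thus "M = {\<one>\<^bsub>K\<^esub>}"
        using A f(1,2)[OF MT] by (auto simp: ascending_normal_series_def)
    qed
    show "\<exists>M\<in>Field r'. under r' M = Field r' \<and> M = carrier K"
    proof -
      obtain b where b: "b \<in> Field r" "under r b = Field r" "C b = carrier K"
        using A by (auto simp: ascending_normal_series_def)
      have "N \<subseteq> C b" if "N \<in> T" for N
        using that b(2) mono by (auto simp: T_def under_def)
      hence "under r' (C b) = T" using b(1) by (auto simp: under_def r'_def T_def)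
      moreover have "C b \<in> T" using b(1) by (simp add: T_def)
      ultimately show ?thesis using b(3) unfolding F by blast
    qed
    show "\<forall>M N. successor_in r' M N \<longrightarrow> M \<subseteq> N"
    proof (intro allI impI)
      fix M N assume s: "successor_in r' M N"
      hence "M \<in> T" unfolding successor_in_def F by blast
      hence "M \<in> under r' M" by (simp add: under_def r'_def)
      hence "M \<in> underS r' N" using s by (simp add: successor_in_def)
      thus "M \<subseteq> N" by (auto simp: underS_def r'_def)
    qed
    show "\<forall>N. limit_in r' N \<longrightarrow> N = (\<Union>M\<in>underS r' N. M)"
    proof (intro allI impI)
      fix N assume l: "limit_in r' N"
      hence NT: "N \<in> T" by (simp add: limit_in_def F)
      note strict = first[OF NT]
      obtain M where "M \<in> underS r' N" using l by (auto simp: limit_in_def)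
      hence "(M, N) \<in> r' - Id" by (auto simp: underS_def)
      hence ne: "underS r (f N) \<noteq> {}" using fsmono[of M N] by (auto simp: underS_def)
      have "\<not> successor_in r a (f N)" for a
      proof
        assume s: "successor_in r a (f N)"
        hence u: "underS r (f N) = under r a" and aF: "a \<in> Field r" by (auto simp: successor_in_def)
        have "a \<in> underS r (f N)" using u aF w.REFL by (simp add: Refl_under_in)
        hence CaN: "C a \<in> underS r' N" by (rule strict)
        have "underS r' N = under r' (C a)"
        proof (intro equalityI subsetI)
          fix Z assume Z: "Z \<in> underS r' N"
          hence ZN: "(Z, N) \<in> r' - Id" and ZT: "Z \<in> T" unfolding underS_def r'_def by blast+
          have "f Z \<in> underS r (f N)" using fsmono[OF ZN] by (auto simp: underS_def)
          hence "(f Z, a) \<in> r" using u by (auto simp: under_def)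
          hence "Z \<subseteq> C a" using mono f(2)[OF ZT] by blast
          thus "Z \<in> under r' (C a)" using ZT aF by (auto simp: under_def r'_def T_def)
        next
          fix Z assume "Z \<in> under r' (C a)"
          thus "Z \<in> underS r' N" using CaN unfolding under_def underS_def r'_def by blast
        qed
        moreover have "C a \<in> T" using aF by (simp add: T_def)
        ultimately have "successor_in r' (C a) N" using NT unfolding successor_in_def F by simp
        thus False using l by (auto simp: limit_in_def)
      qed
      hence "limit_in r (f N)" using ne f(1)[OF NT] by (auto simp: limit_in_def)
      hence "C (f N) = (\<Union>a\<in>underS r (f N). C a)" using A by (auto simp: ascending_normal_series_def)
      hence "N \<subseteq> (\<Union>M\<in>underS r' N. M)" using f(2)[OF NT] strict by blast
      thus "N = (\<Union>M\<in>underS r' N. M)" unfolding underS_def r'_def by blast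
    qed
  qed
  have "ls_lf_series K r' (\<lambda>M. M)"
    unfolding ls_lf_series_def
  proof (intro conjI allI impI A')
    fix M N assume s: "successor_in r' M N"
    then obtain a where a: "successor_in r a (f N)" "C a = M" using succ_lift by blast
    have "C (f N) = N" using s f(2) by (simp add: successor_in_def F)
    moreover have "locally_soluble (K\<lparr>carrier := C (f N)\<rparr> Mod C a) \<or>
        locally_finite (K\<lparr>carrier := C (f N)\<rparr> Mod C a)"
      using S a(1) unfolding ls_lf_series_def by blast
    ultimately show "locally_soluble (K\<lparr>carrier := N\<rparr> Mod M) \<or> locally_finite (K\<lparr>carrier := N\<rparr> Mod M)"
      using a(2) by simp
  qed
  thus ?thesis unfolding has_ls_lf_series_def by blast
qed

definition class_U :: "nat \<Rightarrow> nat \<Rightarrow> 'v gword \<Rightarrow> 'a monoid set" where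
  "class_U m n u = {G. group G \<and>
     (\<forall>x\<in>word_values G (power_word (product_word 896 u) m). left_engel G n x) \<and>
     has_ls_lf_series (verbal_subgroup G u)}"

end

theory Submission
  imports Defs
begin

text \<open>Let \<open>N = u(G)\<close>. Substituting \<open>1\<close> into all but one of the copies of \<open>u\<close> shows that
  \<open>x\<^sup>m\<close> is \<open>n\<close>-Engel for every \<open>u\<close>-value \<open>x\<close>. Let \<open>W\<close> be generated by these powers, and let \<open>V\<close> be the set of
  values in \<open>N\<close> of the \<open>k\<close>-th derived word, which consists of \<open>u\<close>-values once \<open>k\<close> is large. Then
  \<open>1 \<le> W \<le> W\<langle>V\<rangle> \<le> N\<close> has the required factors.

  The top factor is soluble. A finitely generated group with a series that is generated by \<open>n\<close>-Engel
  elements is nilpotent, so \<open>W\<close> is locally soluble. A finitely generated group with a series that is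
  generated by elements \<open>y\<close> with \<open>y\<^sup>m = 1\<close> and \<open>[a, y, \<dots>, y]\<^sup>m = 1\<close> for all \<open>a\<close> is finite, so
  the middle factor is locally finite. Both facts are proved by descent along the series: take the
  first member whose quotient is nilpotent (respectively finite); it is finitely generated, so its
  index is not a limit, and the preceding member already has a nilpotent (finite) quotient.\<close>

section \<open>Relative upper central series\<close>

text \<open>One inclusion only intersects a series with a subgroup; the work lies in passing from
  the finitely generated subgroups of \<open>N\<close> to \<open>N\<close>. The middle factor rests
  on a closure property of derived words: if \<open>y\<close> is a value of level \<open>k\<close>
  and \<open>a\<close> is arbitrary, then [a, y, ..., y] with \<open>k\<close> entries
  \<open>y\<close> is again a value of level \<open>k\<close>, so its \<open>m\<close>-th power lies
  in \<open>W\<close>. The descent asks three things of a good quotient: its kernel is finitely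
  generated, and goodness survives a finite and an abelian factor. A nilpotent quotient of a
  finitely generated group has in general a kernel finitely generated only as a normal subgroup; the
  Engel generators repair this. Across an abelian factor, nilpotent actions of several normal
  subgroups are combined; across a finite one, its centralizer and Baer's theorem are used. For
  finite quotients these roles fall to Schreier generators, the transfer and transitivity of finite
  index. Nilpotency of a quotient is expressed by \<open>rel_center\<close> inside one ambient
  group, since the inductions keep changing both the subgroup and its kernel.\<close>

definition fin_gen :: "('a, 'b) monoid_scheme \<Rightarrow> 'a set \<Rightarrow> bool" where
  "fin_gen G H \<longleftrightarrow> (\<exists>F. finite F \<and> F \<subseteq> carrier G \<and> H = generate G F)"

text \<open>An iterated centre modulo \<open>D\<close>: if \<open>D\<close> is normal in a subgroup
  \<open>S\<close>, the intersection with \<open>S\<close> is the preimage of the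
  \<open>q\<close>-th upper central subgroup of \<open>S/D\<close>, and nilpotency of
  \<open>H/D\<close> reads \<open>H \<subseteq> rel_center G D H c\<close>. Elements
  \<open>x\<close> range over the whole carrier, hence the later intersections with
  \<open>H\<close>. The set \<open>S\<close> is arbitrary; a singleton expresses an Engel
  condition.\<close>

primrec rel_center :: "('a, 'b) monoid_scheme \<Rightarrow> 'a set \<Rightarrow> 'a set \<Rightarrow> nat \<Rightarrow> 'a set" where
  "rel_center G D S 0 = D"
| "rel_center G D S (Suc q) = {x \<in> carrier G. \<forall>g\<in>S. group_commutator G x g \<in> rel_center G D S q}"

text \<open>Both subgroups live in the ambient \<open>G\<close>, so an induction may change
  \<open>H\<close> and \<open>D\<close> without changing the carrier.\<close>

definition normal_in :: "('a, 'b) monoid_scheme \<Rightarrow> 'a set \<Rightarrow> 'a set \<Rightarrow> bool" where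
  "normal_in G D H \<longleftrightarrow> subgroup D G \<and> subgroup H G \<and> D \<subseteq> H \<and>
     (\<forall>h\<in>H. \<forall>d\<in>D. inv\<^bsub>G\<^esub> h \<otimes>\<^bsub>G\<^esub> d \<otimes>\<^bsub>G\<^esub> h \<in> D)"

lemma rel_center_mono: "D \<subseteq> D' \<Longrightarrow> S' \<subseteq> S \<Longrightarrow> rel_center G D S q \<subseteq> rel_center G D' S' q"
  by (induction q) auto

text \<open>Central series stack and their lengths add; this turns a hypercentral subgroup with
  nilpotent quotient into a nilpotent group.\<close>

lemma rel_center_add: "rel_center G D S (p + q) = rel_center G (rel_center G D S q) S p"
  by (induction p) auto

context group
begin

section \<open>Commutator calculus and relative normality\<close>

abbreviation comm :: "'a \<Rightarrow> 'a \<Rightarrow> 'a" where "comm \<equiv> group_commutator G"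

lemma inv_mult_cancel [simp]: "x \<in> carrier G \<Longrightarrow> y \<in> carrier G \<Longrightarrow> inv x \<otimes> (x \<otimes> y) = y"
  by (simp add: m_assoc[symmetric])

lemma mult_inv_cancel [simp]: "x \<in> carrier G \<Longrightarrow> y \<in> carrier G \<Longrightarrow> x \<otimes> (inv x \<otimes> y) = y"
  by (simp add: m_assoc[symmetric])

lemmas word_simps = m_assoc inv_mult_group group_commutator_def

lemma comm_closed [simp]: "x \<in> carrier G \<Longrightarrow> y \<in> carrier G \<Longrightarrow> comm x y \<in> carrier G"
  by (simp add: group_commutator_def)

lemma comm_mult_left:
  assumes "x \<in> carrier G" "y \<in> carrier G" "z \<in> carrier G"
  shows "comm (x \<otimes> y) z = (inv y \<otimes> comm x z \<otimes> y) \<otimes> comm y z"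
  using assms by (simp add: word_simps)

lemma comm_mult_right:
  assumes "x \<in> carrier G" "y \<in> carrier G" "z \<in> carrier G"
  shows "comm x (y \<otimes> z) = comm x z \<otimes> (inv z \<otimes> comm x y \<otimes> z)"
  using assms by (simp add: word_simps)

lemma comm_inv_right:
  assumes "x \<in> carrier G" "y \<in> carrier G"
  shows "comm x (inv y) = inv (inv y) \<otimes> inv (comm x y) \<otimes> inv y"
  using assms by (simp add: word_simps)

lemma inv_comm:
  assumes "x \<in> carrier G" "y \<in> carrier G"
  shows "inv (comm x y) = comm y x"
  using assms by (simp add: word_simps)

lemma conj_comm:
  assumes "x \<in> carrier G" "y \<in> carrier G" "g \<in> carrier G"
  shows "inv g \<otimes> comm x y \<otimes> g = comm (inv g \<otimes> x \<otimes> g) (inv g \<otimes> y \<otimes> g)"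
  using assms by (simp add: word_simps)

lemma comm_eq_one_iff:
  assumes "x \<in> carrier G" "y \<in> carrier G"
  shows "comm x y = \<one> \<longleftrightarrow> x \<otimes> y = y \<otimes> x"
proof -
  have "comm x y = inv (y \<otimes> x) \<otimes> (x \<otimes> y)" using assms by (simp add: word_simps)
  moreover have "inv (y \<otimes> x) \<otimes> (x \<otimes> y) = \<one> \<longleftrightarrow> x \<otimes> y = y \<otimes> x"
    using assms inv_solve_left[of "\<one>" "y \<otimes> x" "x \<otimes> y"] by auto
  ultimately show ?thesis by simp
qed

lemma normal_inD:
  assumes "normal_in G D H"
  shows "subgroup D G" "subgroup H G" "D \<subseteq> H" "D \<subseteq> carrier G" "H \<subseteq> carrier G"
    "\<And>d h. d \<in> D \<Longrightarrow> h \<in> H \<Longrightarrow> inv h \<otimes> d \<otimes> h \<in> D"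
    "\<And>d h. d \<in> D \<Longrightarrow> h \<in> H \<Longrightarrow> h \<otimes> d \<otimes> inv h \<in> D"
proof -
  show D: "subgroup D G" and H: "subgroup H G" "D \<subseteq> H"
    and c: "\<And>d h. d \<in> D \<Longrightarrow> h \<in> H \<Longrightarrow> inv h \<otimes> d \<otimes> h \<in> D"
    using assms by (auto simp: normal_in_def)
  show "D \<subseteq> carrier G" "H \<subseteq> carrier G" using D H subgroup.subset by auto
  show "\<And>d h. d \<in> D \<Longrightarrow> h \<in> H \<Longrightarrow> h \<otimes> d \<otimes> inv h \<in> D"
    using c H by (metis inv_inv subgroup.m_inv_closed subgroup.mem_carrier)
qed

lemma normal_inI:
  assumes "subgroup D G" "subgroup H G" "D \<subseteq> H"
    "\<And>d h. d \<in> D \<Longrightarrow> h \<in> H \<Longrightarrow> inv h \<otimes> d \<otimes> h \<in> D"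
  shows "normal_in G D H"
  using assms by (auto simp: normal_in_def)

lemma normal_iff_normal_in: "D \<lhd> G \<longleftrightarrow> normal_in G D (carrier G)"
proof
  assume "D \<lhd> G"
  thus "normal_in G D (carrier G)"
    by (intro normal_inI) (auto simp: normal_imp_subgroup subgroup_self normal_imp_subgroup[THEN subgroup.mem_carrier]
      normal.inv_op_closed1 normal.inv_op_closed2)
next
  assume "normal_in G D (carrier G)"
  thus "D \<lhd> G" using normal_inD by (auto intro!: normal_invI)
qed

lemma normal_in_mono: "normal_in G D H \<Longrightarrow> subgroup H' G \<Longrightarrow> D \<subseteq> H' \<Longrightarrow> H' \<subseteq> H \<Longrightarrow> normal_in G D H'"
  by (auto simp: normal_in_def)

lemma normal_in_comm:
  assumes "normal_in G D H" "d \<in> D" "h \<in> H"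
  shows "comm d h \<in> D" "comm h d \<in> D"
proof -
  note D = normal_inD[OF assms(1)]
  have c: "d \<in> carrier G" "h \<in> carrier G" using D assms by auto
  have "comm d h = inv d \<otimes> (inv h \<otimes> d \<otimes> h)" using c by (simp add: word_simps)
  thus 1: "comm d h \<in> D" using D(1,6) assms by (simp add: subgroup.m_closed subgroup.m_inv_closed)
  have "comm h d = inv (comm d h)" using c by (simp add: inv_comm)
  thus "comm h d \<in> D" using 1 D(1) by (simp add: subgroup.m_inv_closed)
qed

lemma subgroup_comm: "subgroup H G \<Longrightarrow> x \<in> H \<Longrightarrow> y \<in> H \<Longrightarrow> comm x y \<in> H"
  by (simp add: group_commutator_def subgroup.m_closed subgroup.m_inv_closed)

lemma subgroup_conj: "subgroup H G \<Longrightarrow> x \<in> H \<Longrightarrow> y \<in> H \<Longrightarrow> inv y \<otimes> x \<otimes> y \<in> H"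
  by (simp add: subgroup.m_closed subgroup.m_inv_closed)

text \<open>The centralizer of \<open>x\<close> modulo \<open>D\<close> is closed under products
  because [x, yz] = [x, z] [x, y]^z and \<open>D\<close> is normal.\<close>

lemma subgroup_comm_right:
  assumes D: "normal_in G D H" and x: "x \<in> H"
  shows "subgroup {g \<in> H. comm x g \<in> D} G"
proof -
  note n = normal_inD[OF D]
  have xc: "x \<in> carrier G" using n x by auto
  show ?thesis
  proof (rule subgroupI)
    show "{g \<in> H. comm x g \<in> D} \<subseteq> carrier G" using n by auto
    have "comm x \<one> = \<one>" using xc by (simp add: word_simps)
    thus "{g \<in> H. comm x g \<in> D} \<noteq> {}" using n(1,2) subgroup.one_closed by fastforce
    fix a assume a: "a \<in> {g \<in> H. comm x g \<in> D}"
    hence ac: "a \<in> carrier G" using n by auto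
    show "inv a \<in> {g \<in> H. comm x g \<in> D}"
      using a ac xc n(6)[of "inv (comm x a)" "inv a"] n(1,2)
      by (auto simp: comm_inv_right subgroup.m_inv_closed)
    fix b assume b: "b \<in> {g \<in> H. comm x g \<in> D}"
    hence bc: "b \<in> carrier G" using n by auto
    show "a \<otimes> b \<in> {g \<in> H. comm x g \<in> D}"
      using a b ac bc xc n(6)[of "comm x a" b] n(1,2)
      by (auto simp: comm_mult_right subgroup.m_closed)
  qed
qed

lemma subgroup_comm_left:
  assumes D: "normal_in G D H" and x: "x \<in> H"
  shows "subgroup {g \<in> H. comm g x \<in> D} G"
proof -
  note n = normal_inD[OF D]
  have "comm g x \<in> D \<longleftrightarrow> comm x g \<in> D" if "g \<in> H" for g
    using that x n inv_comm[of g x] inv_comm[of x g] subgroup.m_inv_closed[OF n(1)]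
    by (metis (no_types, lifting) in_mono)
  hence "{g \<in> H. comm g x \<in> D} = {g \<in> H. comm x g \<in> D}" by blast
  thus ?thesis using subgroup_comm_right[OF D x] by simp
qed

lemma comm_generate_right:
  assumes D: "normal_in G D H" and x: "x \<in> H" and S: "S \<subseteq> H" "\<And>s. s \<in> S \<Longrightarrow> comm x s \<in> D"
    and g: "g \<in> generate G S"
  shows "comm x g \<in> D"
  using generate_subgroup_incl[OF _ subgroup_comm_right[OF D x], of S] S g by blast

lemma comm_generate_left:
  assumes D: "normal_in G D H" and x: "x \<in> H" and S: "S \<subseteq> H" "\<And>s. s \<in> S \<Longrightarrow> comm s x \<in> D"
    and g: "g \<in> generate G S"
  shows "comm g x \<in> D"
  using generate_subgroup_incl[OF _ subgroup_comm_left[OF D x], of S] S g by blast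

text \<open>Centralizers modulo \<open>D\<close> are subgroups on either side, so an inclusion of
  commutators in \<open>D\<close> need only be checked on generators.\<close>

lemma comm_generate:
  assumes D: "normal_in G D H" and S: "S \<subseteq> H" "T \<subseteq> H" "\<And>s t. s \<in> S \<Longrightarrow> t \<in> T \<Longrightarrow> comm s t \<in> D"
    and g: "g \<in> generate G S" "h \<in> generate G T"
  shows "comm g h \<in> D"
proof -
  have "g \<in> H" using generate_subgroup_incl[OF S(1)] normal_inD(2)[OF D] g by blast
  thus ?thesis
    using comm_generate_right[OF D _ S(2) _ g(2)] comm_generate_left[OF D _ S(1) _ g(1)] S by blast
qed

lemma subset_generate: "A \<subseteq> S \<Longrightarrow> A \<subseteq> generate G S"
  by (auto intro: generate.incl)

lemma normal_in_generate:
  assumes H: "subgroup H G" and S: "S \<subseteq> H" "\<And>s h. s \<in> S \<Longrightarrow> h \<in> H \<Longrightarrow> inv h \<otimes> s \<otimes> h \<in> generate G S"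
  shows "normal_in G (generate G S) H"
proof -
  have Hc: "H \<subseteq> carrier G" using H by (rule subgroup.subset)
  hence Sc: "S \<subseteq> carrier G" using S by auto
  note g = generate_is_subgroup[OF Sc]
  show ?thesis
  proof (rule normal_inI[OF g H])
    show "generate G S \<subseteq> H" using S H by (intro generate_subgroup_incl)
    fix d h assume d: "d \<in> generate G S" and h: "h \<in> H"
    have hc: "h \<in> carrier G" using h Hc by auto
    show "inv h \<otimes> d \<otimes> h \<in> generate G S" using d
    proof (induction d)
      case one thus ?case using hc by (simp add: generate.one)
    next
      case (incl s) thus ?case using S h by blast
    next
      case (inv s)
      hence sc: "s \<in> carrier G" using Sc by auto
      have "inv h \<otimes> inv s \<otimes> h = inv (inv h \<otimes> s \<otimes> h)" using hc sc by (simp add: word_simps)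
      thus ?case using S(2)[OF inv h] subgroup.m_inv_closed[OF g] by simp
    next
      case (eng a b)
      have c: "a \<in> carrier G" "b \<in> carrier G" using eng generate_in_carrier[OF Sc] by auto
      have "inv h \<otimes> (a \<otimes> b) \<otimes> h = (inv h \<otimes> a \<otimes> h) \<otimes> (inv h \<otimes> b \<otimes> h)"
        using hc c by (simp add: word_simps)
      thus ?case using eng by (simp add: generate.eng)
    qed
  qed
qed

text \<open>Each new term is an intersection of centralizers modulo the previous one, hence a
  subgroup; it is invariant because [d^h, g] is the conjugate by \<open>h\<close> of
  [d, h g h^-1].\<close>

lemma rel_center_normal:
  assumes D: "normal_in G D H"
  shows "normal_in G (rel_center G D H q \<inter> H) H"
proof (induction q)
  case 0 thus ?case using D normal_inD(3)[OF D] by (simp add: Int_absorb2)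
next
  case (Suc q)
  let ?Z = "rel_center G D H q \<inter> H"
  note n = normal_inD[OF Suc]
  have eq: "rel_center G D H (Suc q) \<inter> H = {x \<in> H. \<forall>g\<in>H. comm x g \<in> ?Z}"
    using n(2,5) subgroup_comm by auto
  note left = subgroup_comm_left[OF Suc]
  have sub: "subgroup (rel_center G D H (Suc q) \<inter> H) G"
  proof (rule subgroupI)
    show "rel_center G D H (Suc q) \<inter> H \<subseteq> carrier G" using n by auto
    have "\<one> \<in> {x \<in> H. comm x g \<in> ?Z}" if "g \<in> H" for g
      using left[OF that] by (rule subgroup.one_closed)
    moreover have "\<one> \<in> H" using n(2) by (rule subgroup.one_closed)
    ultimately show "rel_center G D H (Suc q) \<inter> H \<noteq> {}" unfolding eq by blast
    fix a assume a: "a \<in> rel_center G D H (Suc q) \<inter> H"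
    have aH: "a \<in> H" and ag: "a \<in> {x \<in> H. comm x g \<in> ?Z}" if "g \<in> H" for g
      using a that unfolding eq by simp_all
    have "inv a \<in> {x \<in> H. comm x g \<in> ?Z}" if "g \<in> H" for g
      using subgroup.m_inv_closed[OF left[OF that] ag[OF that]] .
    thus "inv a \<in> rel_center G D H (Suc q) \<inter> H"
      using subgroup.m_inv_closed[OF n(2)] a unfolding eq by simp
    fix b assume b: "b \<in> rel_center G D H (Suc q) \<inter> H"
    have bg: "b \<in> {x \<in> H. comm x g \<in> ?Z}" if "g \<in> H" for g
      using b that unfolding eq by simp
    have "a \<otimes> b \<in> {x \<in> H. comm x g \<in> ?Z}" if "g \<in> H" for g
      using subgroup.m_closed[OF left[OF that] ag[OF that] bg[OF that]] .
    thus "a \<otimes> b \<in> rel_center G D H (Suc q) \<inter> H"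
      using subgroup.m_closed[OF n(2)] a b unfolding eq by simp
  qed
  show ?case
  proof (rule normal_inI[OF sub n(2)])
    fix d h assume d: "d \<in> rel_center G D H (Suc q) \<inter> H" and h: "h \<in> H"
    have "comm (inv h \<otimes> d \<otimes> h) g \<in> ?Z" if g: "g \<in> H" for g
    proof -
      have c: "d \<in> carrier G" "h \<in> carrier G" "g \<in> carrier G" using d h g n by auto
      have "comm (inv h \<otimes> d \<otimes> h) g = inv h \<otimes> comm d (h \<otimes> g \<otimes> inv h) \<otimes> h"
        using c by (simp add: word_simps)
      moreover have "h \<otimes> g \<otimes> inv h \<in> H" using g h n(2) by (simp add: subgroup.m_closed subgroup.m_inv_closed)
      ultimately show ?thesis using d h n(6) unfolding eq by simp
    qed
    moreover have "inv h \<otimes> d \<otimes> h \<in> H" using d h n(2) by (intro subgroup_conj) auto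
    ultimately show "inv h \<otimes> d \<otimes> h \<in> rel_center G D H (Suc q) \<inter> H"
      unfolding eq by blast
  qed auto
qed

lemma rel_center_Suc_mono:
  assumes D: "normal_in G D H"
  shows "rel_center G D H q \<inter> H \<subseteq> rel_center G D H (Suc q)"
proof
  fix x assume x: "x \<in> rel_center G D H q \<inter> H"
  note n = rel_center_normal[OF D, of q]
  show "x \<in> rel_center G D H (Suc q)" using x normal_in_comm(1)[OF n] normal_inD(5)[OF n] by auto
qed

lemma rel_center_le_mono:
  assumes D: "normal_in G D H" and "p \<le> q"
  shows "rel_center G D H p \<inter> H \<subseteq> rel_center G D H q"
  using assms(2)
proof (induction rule: dec_induct)
  case (step q) thus ?case using rel_center_Suc_mono[OF D, of q] by auto
qed auto

section \<open>Finite supports of generated elements\<close>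

lemma generate_finite_support:
  assumes "x \<in> generate G A"
  shows "\<exists>A0. finite A0 \<and> A0 \<subseteq> A \<and> x \<in> generate G A0"
  using assms
proof induction
  case one thus ?case by (intro exI[of _ "{}"]) (simp add: generate.one)
next
  case (incl h) thus ?case by (intro exI[of _ "{h}"]) (simp add: generate.incl)
next
  case (inv h) thus ?case by (intro exI[of _ "{h}"]) (simp add: generate.inv)
next
  case (eng a b)
  then obtain A0 B0 where "finite A0" "A0 \<subseteq> A" "a \<in> generate G A0" "finite B0" "B0 \<subseteq> A" "b \<in> generate G B0"
    by blast
  thus ?case using mono_generate[of A0 "A0 \<union> B0"] mono_generate[of B0 "A0 \<union> B0"]
    by (intro exI[of _ "A0 \<union> B0"]) (auto intro!: generate.eng)
qed

lemma finite_support: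
  assumes "finite F" "F \<subseteq> generate G A"
  shows "\<exists>A0. finite A0 \<and> A0 \<subseteq> A \<and> F \<subseteq> generate G A0"
  using assms
proof (induction F)
  case (insert x F)
  then obtain A0 B0 where "finite A0" "A0 \<subseteq> A" "F \<subseteq> generate G A0" "finite B0" "B0 \<subseteq> A" "x \<in> generate G B0"
    using generate_finite_support[of x A] by auto
  thus ?case using mono_generate[of A0 "A0 \<union> B0"] mono_generate[of B0 "A0 \<union> B0"]
    by (intro exI[of _ "A0 \<union> B0"]) auto
qed auto

text \<open>The finitely many generators of \<open>H\<close> are words that use only finitely many
  elements of \<open>S\<close>. This later replaces an infinite conjugacy class by a finite part of
  it.\<close>

lemma fin_gen_support:
  assumes H: "fin_gen G H" and gen: "H = generate G (K \<union> S)" and c: "K \<union> S \<subseteq> carrier G"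
  shows "\<exists>S0. finite S0 \<and> S0 \<subseteq> S \<and> H = generate G (K \<union> S0)"
proof -
  obtain F where F: "finite F" "H = generate G F" using H by (auto simp: fin_gen_def)
  hence "F \<subseteq> generate G (K \<union> S)" using gen subset_generate[OF order_refl] by auto
  from finite_support[OF F(1) this] obtain A where A: "finite A" "A \<subseteq> K \<union> S" "F \<subseteq> generate G A" by blast
  let ?T = "A \<inter> S"
  have "F \<subseteq> generate G (K \<union> ?T)" using A mono_generate[of A "K \<union> ?T"] by auto
  hence "H \<subseteq> generate G (K \<union> ?T)"
    unfolding F(2) using c by (intro generate_subgroup_incl generate_is_subgroup) auto
  moreover have "generate G (K \<union> ?T) \<subseteq> H" unfolding gen by (intro mono_generate) auto
  ultimately show ?thesis using A(1) by (intro exI[of _ ?T]) auto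
qed

section \<open>Iterated commutators and Engel elements\<close>

lemma iterated_commutator_closed [simp]:
  "x \<in> carrier G \<Longrightarrow> y \<in> carrier G \<Longrightarrow> iterated_commutator G x n y \<in> carrier G"
  by (induction n) auto

lemma iterated_commutator_Suc_left:
  "iterated_commutator G x (Suc n) y = iterated_commutator G (comm x y) n y"
  by (induction n) auto

lemma iterated_commutator_conj:
  assumes "x \<in> carrier G" "y \<in> carrier G" "g \<in> carrier G"
  shows "inv g \<otimes> iterated_commutator G x n y \<otimes> g = iterated_commutator G (inv g \<otimes> x \<otimes> g) n (inv g \<otimes> y \<otimes> g)"
  using assms by (induction n) (auto simp: conj_comm)

lemma left_engel_conj:
  assumes "left_engel G n y" "g \<in> carrier G"
  shows "left_engel G n (inv g \<otimes> y \<otimes> g)"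
proof -
  have y: "y \<in> carrier G" using assms by (simp add: left_engel_def)
  have "iterated_commutator G x n (inv g \<otimes> y \<otimes> g) = \<one>" if x: "x \<in> carrier G" for x
  proof -
    have "iterated_commutator G x n (inv g \<otimes> y \<otimes> g) = inv g \<otimes> iterated_commutator G (g \<otimes> x \<otimes> inv g) n y \<otimes> g"
      using x y assms(2) by (subst iterated_commutator_conj) (auto simp: word_simps)
    thus ?thesis using assms x by (auto simp: left_engel_def)
  qed
  thus ?thesis using y assms(2) by (auto simp: left_engel_def)
qed

text \<open>Translates the Engel condition into the language of \<open>rel_center\<close>: the
  commutator nearest to \<open>x\<close> is peeled off first.\<close>

lemma rel_center_singleton:
  assumes "v \<in> carrier G" "x \<in> carrier G"
  shows "x \<in> rel_center G D {v} q \<longleftrightarrow> iterated_commutator G x q v \<in> D"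
  using assms(2)
proof (induction q arbitrary: x)
  case (Suc q)
  have "x \<in> rel_center G D {v} (Suc q) \<longleftrightarrow> comm x v \<in> rel_center G D {v} q" using Suc by simp
  also have "\<dots> \<longleftrightarrow> iterated_commutator G (comm x v) q v \<in> D" using Suc assms by simp
  finally show ?case by (simp only: iterated_commutator_Suc_left)
qed auto

end

section \<open>Kernels of nilpotent quotients generated by Engel elements\<close>

text \<open>Division with remainder by the least positive member. The set in question will be that
  of the exponents \<open>i\<close> for which a power of a fixed element lies in a subgroup.\<close>

lemma int_subgroup_principal:
  fixes I :: "int set"
  assumes z: "0 \<in> I" and d: "\<And>i j. i \<in> I \<Longrightarrow> j \<in> I \<Longrightarrow> i - j \<in> I"
  shows "\<exists>d\<in>I. \<forall>i\<in>I. d dvd i"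
proof (cases "I \<subseteq> {0}")
  case True thus ?thesis using z by (intro bexI[of _ 0]) auto
next
  case False
  then obtain i where i: "i \<in> I" "i \<noteq> 0" by blast
  have neg: "- j \<in> I" if "j \<in> I" for j using d[OF z that] by simp
  hence "\<exists>k::nat. 0 < k \<and> int k \<in> I"
    using i neg[OF i(1)] by (intro exI[of _ "nat \<bar>i\<bar>"]) (auto simp: abs_if)
  define k where "k = (LEAST k::nat. 0 < k \<and> int k \<in> I)"
  have k: "0 < k" "int k \<in> I" using LeastI_ex[OF \<open>\<exists>k::nat. 0 < k \<and> int k \<in> I\<close>] by (auto simp: k_def)
  have mult: "int k * int l \<in> I" for l
  proof (induction l)
    case (Suc l)
    show ?case using d[OF Suc neg[OF k(2)]] by (simp add: algebra_simps)
  qed (simp add: z)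
  have multi: "int k * l \<in> I" for l
    using mult[of "nat l"] neg[OF mult[of "nat (- l)"]] by (cases "0 \<le> l") auto
  have "int k dvd j" if j: "j \<in> I" for j
  proof (rule ccontr)
    assume "\<not> int k dvd j"
    hence nz: "j mod int k \<noteq> 0" by auto
    have "j mod int k = j - int k * (j div int k)" by (simp add: minus_mult_div_eq_mod)
    hence "j mod int k \<in> I" using d[OF j multi] by simp
    moreover have "0 < j mod int k" using nz k(1) by (simp add: order.not_eq_order_implies_strict)
    ultimately have "k \<le> nat (j mod int k)" unfolding k_def by (intro Least_le) auto
    moreover have "j mod int k < int k" using k(1) by simp
    ultimately show False using k(1) by linarith
  qed
  thus ?thesis using k(2) by blast
qed

context group
begin

lemma generate_conj:
  assumes S: "S \<subseteq> carrier G" and h: "h \<in> carrier G" and x: "x \<in> generate G S"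
    and c: "\<And>s. s \<in> S \<Longrightarrow> inv h \<otimes> s \<otimes> h \<in> generate G S"
  shows "inv h \<otimes> x \<otimes> h \<in> generate G S"
  using x
proof (induction x)
  case one thus ?case using h by (simp add: generate.one)
next
  case (incl s) thus ?case using c by blast
next
  case (inv s)
  have "inv h \<otimes> inv s \<otimes> h = inv (inv h \<otimes> s \<otimes> h)" using h inv S by (auto simp: word_simps)
  thus ?case using c[OF inv] generate_m_inv_closed[OF S] by simp
next
  case (eng a b)
  have "a \<in> carrier G" "b \<in> carrier G" using eng generate_in_carrier[OF S] by auto
  hence "inv h \<otimes> (a \<otimes> b) \<otimes> h = (inv h \<otimes> a \<otimes> h) \<otimes> (inv h \<otimes> b \<otimes> h)"
    using h by (simp add: word_simps)
  thus ?case using eng by (simp add: generate.eng)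
qed

text \<open>Both conjugations are demanded of each \<open>s\<close>, since invariance of
  \<open>P\<close> under conjugation by \<open>s\<close> alone does not give invariance under its
  inverse.\<close>

lemma conj_closed_generate:
  assumes P: "P \<subseteq> carrier G" and S: "S \<subseteq> carrier G" and h: "h \<in> generate G S"
    and c: "\<And>s p. s \<in> S \<Longrightarrow> p \<in> P \<Longrightarrow> inv s \<otimes> p \<otimes> s \<in> P \<and> s \<otimes> p \<otimes> inv s \<in> P"
  shows "\<forall>p\<in>P. inv h \<otimes> p \<otimes> h \<in> P \<and> h \<otimes> p \<otimes> inv h \<in> P"
  using h
proof (induction h)
  case one thus ?case using P by auto
next
  case (incl s) thus ?case using c by blast
next
  case (inv s) 
  hence "s \<in> carrier G" using S by auto
  thus ?case using c[OF inv] by simp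
next
  case (eng a b)
  have "a \<in> carrier G" "b \<in> carrier G" using eng generate_in_carrier[OF S] by auto
  hence *: "inv (a \<otimes> b) \<otimes> p \<otimes> (a \<otimes> b) = inv b \<otimes> (inv a \<otimes> p \<otimes> a) \<otimes> b"
     "(a \<otimes> b) \<otimes> p \<otimes> inv (a \<otimes> b) = a \<otimes> (b \<otimes> p \<otimes> inv b) \<otimes> inv a" if "p \<in> P" for p
    using that P by (auto simp: word_simps)
  show ?case using eng by (simp add: *)
qed

text \<open>\<open>H\<close> is generated by \<open>a\<close> and a finite \<open>F\<close> in
  \<open>K\<close>. The finitely many commutators [f, a, ..., a] with at most \<open>n\<close>
  entries \<open>a\<close> generate a subgroup \<open>P\<close> containing \<open>F\<close> and
  normalized by \<open>a\<close>, so \<open>H\<close> is the product of \<open>P\<close> and the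
  powers of \<open>a\<close>. As \<open>P\<close> lies in \<open>K\<close>, one power of
  \<open>a\<close> together with \<open>P\<close> generates \<open>K\<close>.\<close>

lemma fin_gen_kernel_cyclic:
  assumes H: "fin_gen G H" and K: "normal_in G K H" and a: "a \<in> H"
    and gen: "H = generate G (K \<union> {a})"
    and eng: "\<And>x. x \<in> K \<Longrightarrow> iterated_commutator G x n a = \<one>"
  shows "fin_gen G K"
proof -
  note nK = normal_inD[OF K]
  have ac: "a \<in> carrier G" using a nK by auto
  have "H = generate G ({a} \<union> K)" using gen by (simp add: Un_commute)
  from fin_gen_support[OF H this] obtain F where F: "finite F" "F \<subseteq> K" "H = generate G ({a} \<union> F)"
    using nK ac by auto
  have Fc: "F \<subseteq> carrier G" using F nK by auto
  define C where "C = (\<lambda>(f, i). iterated_commutator G f i a) ` (F \<times> {..n})"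
  have finC: "finite C" unfolding C_def using F(1) by simp
  have itK: "iterated_commutator G f i a \<in> K" if "f \<in> F" for f i
  proof (induction i)
    case 0 thus ?case using F that by auto
  next
    case (Suc i) thus ?case using normal_in_comm(1)[OF K Suc a] by simp
  qed
  hence CK: "C \<subseteq> K" unfolding C_def by auto
  hence Cc: "C \<subseteq> carrier G" using nK by auto
  define P where "P = generate G C"
  have sP: "subgroup P G" unfolding P_def using Cc by (rule generate_is_subgroup)
  have Pc: "P \<subseteq> carrier G" using sP by (rule subgroup.subset)
  have PK: "P \<subseteq> K" unfolding P_def using CK nK(1) by (rule generate_subgroup_incl)
  have itP: "iterated_commutator G f i a \<in> P" if "f \<in> F" "i \<le> n" for f i
    unfolding P_def C_def using that by (intro generate.incl) auto
  have itn: "iterated_commutator G f n a = \<one>" if "f \<in> F" for f using eng F that by auto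
  have down: "inv a \<otimes> iterated_commutator G f i a \<otimes> a \<in> P" if f: "f \<in> F" and i: "i \<le> n" for f i
  proof (cases "i = n")
    case True thus ?thesis using itn[OF f] ac subgroup.one_closed[OF sP] by simp
  next
    case False
    have "inv a \<otimes> iterated_commutator G f i a \<otimes> a = iterated_commutator G f i a \<otimes> iterated_commutator G f (Suc i) a"
      using ac f Fc by (auto simp: word_simps)
    moreover have "iterated_commutator G f (Suc i) a \<in> P" using False i by (intro itP f) simp
    ultimately show ?thesis using subgroup.m_closed[OF sP itP[OF f i]] by metis
  qed
  \<comment> \<open>Conjugation by \<open>inv a\<close> is treated from the top index
    \<open>n\<close>, where the commutator is trivial, downwards: writing c_i for the
    \<open>i\<close>-th commutator, a c_i a^-1 = c_i (a c_{i+1} a^-1)^-1.\<close>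
  have up: "a \<otimes> iterated_commutator G f i a \<otimes> inv a \<in> P" if f: "f \<in> F" and i: "i \<le> n" for f i
    using i
  proof (induction i rule: inc_induct)
    case base thus ?case using itn[OF f] ac subgroup.one_closed[OF sP] by simp
  next
    case (step i)
    let ?c = "iterated_commutator G f i a" and ?d = "iterated_commutator G f (Suc i) a"
    have cc: "?c \<in> carrier G" using f Fc ac by auto
    have "a \<otimes> ?c \<otimes> inv a = ?c \<otimes> inv (a \<otimes> ?d \<otimes> inv a)"
      using ac cc by (simp add: word_simps)
    moreover have "?c \<in> P" using step by (intro itP f) simp
    ultimately show ?case using step(3) subgroup.m_closed[OF sP] subgroup.m_inv_closed[OF sP] by metis
  qed
  have "inv s \<otimes> p \<otimes> s \<in> P \<and> s \<otimes> p \<otimes> inv s \<in> P" if s: "s \<in> {a} \<union> F" and p: "p \<in> P" for s p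
  proof (cases "s = a")
    case True
    have "inv a \<otimes> c \<otimes> a \<in> generate G C" if "c \<in> C" for c
      using that down by (auto simp: C_def P_def)
    hence 1: "inv a \<otimes> p \<otimes> a \<in> P"
      using generate_conj[OF Cc ac] p unfolding P_def by blast
    have "inv (inv a) \<otimes> c \<otimes> inv a \<in> generate G C" if "c \<in> C" for c
      using that up ac by (auto simp: C_def P_def)
    hence "inv (inv a) \<otimes> p \<otimes> inv a \<in> P"
      using generate_conj[OF Cc inv_closed[OF ac]] p unfolding P_def by blast
    thus ?thesis using 1 True ac by simp
  next
    case False
    hence "s \<in> P" using s itP[of s 0] by auto
    thus ?thesis using p sP by (simp add: subgroup.m_closed subgroup.m_inv_closed)
  qed
  hence conj: "h \<otimes> p \<otimes> inv h \<in> P" if "h \<in> H" "p \<in> P" for h p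
    using conj_closed_generate[OF Pc, of "{a} \<union> F" h] that ac Fc unfolding F(3) by auto
  have powH: "a [^] (i::int) \<in> H" for i using subgroup_int_pow_closed[OF nK(2) a] .
  have pow1: "\<exists>p\<in>P. \<exists>i::int. x = p \<otimes> a [^] i" if "x \<in> generate G ({a} \<union> F)" for x
    using that
  proof induction
    case one thus ?case using subgroup.one_closed[OF sP] by (intro bexI[of _ \<one>] exI[of _ 0]) auto
  next
    case (incl h)
    show ?case
    proof (cases "h = a")
      case True thus ?thesis using subgroup.one_closed[OF sP] ac
        by (intro bexI[of _ \<one>] exI[of _ 1]) (auto simp: int_pow_1)
    next
      case False 
      hence "h \<in> P" using incl itP[of h 0] by auto
      thus ?thesis using Pc by (intro bexI[of _ h] exI[of _ 0]) auto
    qed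
  next
    case (inv h)
    show ?case
    proof (cases "h = a")
      case True thus ?thesis using subgroup.one_closed[OF sP] ac
        by (intro bexI[of _ \<one>] exI[of _ "-1"]) (auto simp: int_pow_neg int_pow_1)
    next
      case False 
      hence "h \<in> P" using inv itP[of h 0] by auto
      hence "inv h \<in> P" using sP by (simp add: subgroup.m_inv_closed)
      thus ?thesis using Pc by (intro bexI[of _ "inv h"] exI[of _ 0]) auto
    qed
  next
    case (eng x y)
    then obtain p q and i j :: int where pq: "p \<in> P" "q \<in> P" "x = p \<otimes> a [^] i" "y = q \<otimes> a [^] j" by blast
    have c: "p \<in> carrier G" "q \<in> carrier G" using pq Pc by auto
    have "x \<otimes> y = (p \<otimes> (a [^] i \<otimes> q \<otimes> inv (a [^] i))) \<otimes> a [^] (i + j)"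
      using c ac pq by (simp add: word_simps int_pow_mult)
    moreover have "p \<otimes> (a [^] i \<otimes> q \<otimes> inv (a [^] i)) \<in> P"
      using conj[OF powH pq(2)] pq(1) sP by (simp add: subgroup.m_closed)
    ultimately show ?case by blast
  qed
  have pow: "\<exists>p\<in>P. \<exists>i::int. x = p \<otimes> a [^] i" if "x \<in> H" for x
    using that pow1 F(3) by auto
  \<comment> \<open>The powers of \<open>a\<close> in \<open>K\<close> are those of a single one;
    with \<open>P\<close> inside \<open>K\<close>, the modular law then describes all of
    \<open>K\<close>.\<close>
  obtain d where d: "a [^] d \<in> K" "\<And>i::int. a [^] i \<in> K \<Longrightarrow> d dvd i"
  proof -
    have "\<exists>d\<in>{i::int. a [^] i \<in> K}. \<forall>i\<in>{i::int. a [^] i \<in> K}. d dvd i"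
    proof (rule int_subgroup_principal)
      show "0 \<in> {i::int. a [^] i \<in> K}" using nK(1) by (simp add: subgroup.one_closed)
      show "i - j \<in> {i::int. a [^] i \<in> K}" if "i \<in> {i::int. a [^] i \<in> K}" "j \<in> {i::int. a [^] i \<in> K}" for i j
        using that nK(1) ac by (simp add: int_pow_diff subgroup.m_closed subgroup.m_inv_closed)
    qed
    thus ?thesis using that by blast
  qed
  let ?F = "C \<union> {a [^] d}"
  have Fc: "?F \<subseteq> carrier G" using Cc ac by auto
  note g = generate_is_subgroup[OF Fc]
  have "K = generate G ?F"
  proof
    show "generate G ?F \<subseteq> K" using CK d(1) nK(1) by (intro generate_subgroup_incl) auto
    show "K \<subseteq> generate G ?F"
    proof
      fix x assume x: "x \<in> K"
      then obtain p and i :: int where p: "p \<in> P" "x = p \<otimes> a [^] i" using pow nK(3) by blast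
      have pc: "p \<in> carrier G" using p Pc by auto
      have "a [^] i = inv p \<otimes> x" using p pc ac by simp
      hence "a [^] i \<in> K" using x p(1) PK nK(1) by (auto simp: subgroup.m_closed subgroup.m_inv_closed)
      then obtain e where e: "i = d * e" using d(2) by blast
      have "a [^] i = (a [^] d) [^] e" using ac by (simp add: e int_pow_pow)
      moreover have "a [^] d \<in> generate G ?F" by (intro generate.incl) auto
      ultimately have "a [^] i \<in> generate G ?F" using subgroup_int_pow_closed[OF g] by simp
      moreover have "p \<in> generate G ?F" using p(1) mono_generate[of C ?F] by (auto simp: P_def)
      ultimately show "x \<in> generate G ?F" using p(2) by (simp add: generate.eng)
    qed
  qed
  thus ?thesis unfolding fin_gen_def using Fc finC by (intro exI[of _ ?F]) auto
qed

definition conjugates :: "'a \<Rightarrow> 'a set \<Rightarrow> 'a set" where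
  "conjugates a H = (\<lambda>h. inv h \<otimes> a \<otimes> h) ` H"

lemma conj_eq_mult_comm:
  "a \<in> carrier G \<Longrightarrow> h \<in> carrier G \<Longrightarrow> inv h \<otimes> a \<otimes> h = a \<otimes> comm a h"
  by (simp add: word_simps)

lemma conjugates_subset: "subgroup H G \<Longrightarrow> a \<in> H \<Longrightarrow> conjugates a H \<subseteq> H"
  by (auto simp: conjugates_def subgroup.m_closed subgroup.m_inv_closed)

lemma mem_conjugates: "subgroup H G \<Longrightarrow> a \<in> H \<Longrightarrow> a \<in> conjugates a H"
  using subgroup.one_closed[of H] subgroup.mem_carrier[of H] by (force simp: conjugates_def image_iff)

text \<open>Modulo \<open>K\<close>, let \<open>D\<close> and \<open>D'\<close> be the terms
  \<open>Suc c\<close> and \<open>c\<close> of the upper central series of \<open>H\<close>. Every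
  [a, h] lies in \<open>D\<close>, so \<open>H1\<close> is contained in the group generated by
  \<open>D\<close> and \<open>a\<close>. Its commutators fall into \<open>D'\<close>, one level
  lower than those of \<open>H\<close> itself, which lowers the class by one.\<close>

lemma rel_center_normal_closure:
  assumes K: "normal_in G K H" and nil: "H \<subseteq> rel_center G K H (Suc (Suc c))" and a: "a \<in> H"
    and H1: "H1 = generate G (K \<union> conjugates a H)"
  shows "H1 \<subseteq> rel_center G K H1 (Suc c)"
proof -
  note nK = normal_inD[OF K]
  have ac: "a \<in> carrier G" using a nK by auto
  define D where "D = rel_center G K H (Suc c) \<inter> H"
  define D' where "D' = rel_center G K H c \<inter> H"
  have nD: "normal_in G D H" and nD': "normal_in G D' H"
    unfolding D_def D'_def using rel_center_normal[OF K] by blast+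
  have KD: "K \<subseteq> D" using rel_center_le_mono[OF K, of 0 "Suc c"] nK(3) by (auto simp: D_def)
  have DD': "comm x g \<in> D'" if "x \<in> D" "g \<in> H" for x g
    using that nK subgroup_comm by (auto simp: D_def D'_def)
  have aD: "comm a h \<in> D" if "h \<in> H" for h
    using that nil a nK subgroup_comm unfolding D_def by auto
  have DH: "D \<union> {a} \<subseteq> H" using normal_inD(3)[OF nD] a by auto
  have Dc: "D \<union> {a} \<subseteq> carrier G" using DH nK by auto
  have conj: "inv h \<otimes> a \<otimes> h \<in> generate G (D \<union> {a})" if h: "h \<in> H" for h
  proof -
    have "inv h \<otimes> a \<otimes> h = a \<otimes> comm a h" using ac h nK by (intro conj_eq_mult_comm) auto
    thus ?thesis using aD[OF h] by (auto intro!: generate.eng intro: generate.incl)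
  qed
  have sub: "H1 \<subseteq> generate G (D \<union> {a})"
    unfolding H1 using KD conj
    by (intro generate_subgroup_incl[OF _ generate_is_subgroup[OF Dc]])
      (auto simp: conjugates_def intro: generate.incl)
  have H1H: "H1 \<subseteq> H" unfolding H1
    using nK a conjugates_subset by (intro generate_subgroup_incl) auto
  \<comment> \<open>The only pair of generators not covered by the commutation of \<open>D\<close>
    with \<open>H\<close> is \<open>(a, a)\<close>, whose commutator is trivial; hence a single
    conjugacy class is adjoined at a time.\<close>
  have cc: "comm s t \<in> D'" if s: "s \<in> D \<union> {a}" and t: "t \<in> D \<union> {a}" for s t
  proof (cases "s \<in> D")
    case True thus ?thesis using DD' t DH by auto
  next
    case False
    hence [simp]: "s = a" using s by auto
    show ?thesis
    proof (cases "t \<in> D")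
      case True
      have "inv (comm t a) \<in> D'" using DD'[OF True a] normal_inD(1)[OF nD'] by (simp add: subgroup.m_inv_closed)
      thus ?thesis using True Dc ac by (auto simp: inv_comm)
    next
      case False
      hence [simp]: "t = a" using t by auto
      have "comm a a = \<one>" using ac by (simp add: word_simps)
      thus ?thesis using normal_inD(1)[OF nD'] by (simp add: subgroup.one_closed)
    qed
  qed
  show ?thesis
  proof
    fix x assume x: "x \<in> H1"
    have "comm x g \<in> rel_center G K H1 c" if g: "g \<in> H1" for g
    proof -
      have "comm x g \<in> D'" using comm_generate[OF nD' DH DH cc] x g sub by blast
      thus ?thesis using rel_center_mono[OF order_refl H1H] by (auto simp: D'_def)
    qed
    thus "x \<in> rel_center G K H1 (Suc c)" using x H1H nK by auto
  qed
qed

lemma normal_in_conjugates: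
  assumes K: "normal_in G K H" and E: "E \<subseteq> H"
  shows "normal_in G (generate G (K \<union> (\<Union>e\<in>E. conjugates e H))) H"
proof -
  note nK = normal_inD[OF K]
  let ?S = "K \<union> (\<Union>e\<in>E. conjugates e H)"
  show ?thesis
  proof (rule normal_in_generate[OF nK(2)])
    show "?S \<subseteq> H" using nK(3) conjugates_subset[OF nK(2)] E by blast
    fix s g assume s: "s \<in> ?S" and g: "g \<in> H"
    show "inv g \<otimes> s \<otimes> g \<in> generate G ?S"
    proof (cases "s \<in> K")
      case True thus ?thesis using nK(6)[OF True g] by (auto intro: generate.incl)
    next
      case False
      then obtain e h where e: "e \<in> E" "h \<in> H" "s = inv h \<otimes> e \<otimes> h" using s by (auto simp: conjugates_def)
      have "inv g \<otimes> s \<otimes> g = inv (h \<otimes> g) \<otimes> e \<otimes> (h \<otimes> g)"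
        using e E g nK by (auto simp: word_simps subset_iff)
      moreover have "h \<otimes> g \<in> H" using e g nK(2) by (simp add: subgroup.m_closed)
      ultimately have "inv g \<otimes> s \<otimes> g \<in> ?S" using e(1) unfolding conjugates_def by blast
      thus ?thesis by (rule generate.incl)
    qed
  qed
qed

text \<open>Removing one Engel generator at a time, together with its conjugates, lowers the class of
  the quotient, which reduces everything to a cyclic quotient.\<close>

lemma fin_gen_kernel_nilpotent:
  assumes "fin_gen G H" "normal_in G K H" "finite E" "E \<subseteq> H" "\<And>e. e \<in> E \<Longrightarrow> left_engel G n e"
    "H = generate G (K \<union> E)" "H \<subseteq> rel_center G K H c"
  shows "fin_gen G K"
  using assms
proof (induction c arbitrary: H K E)
  case 0
  have "K = H" using normal_inD(3)[OF 0(2)] 0(7) by (intro equalityI) simp_all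
  thus ?case using 0(1) by simp
next
  case (Suc c)
  note K = Suc.prems(2) and E = Suc.prems(3-5)
  note nK = normal_inD[OF K]
  define L where "L E1 = generate G (K \<union> (\<Union>e\<in>E1. conjugates e H))" for E1
  have nL: "normal_in G (L E1) H" if "E1 \<subseteq> E" for E1
    unfolding L_def using that E by (intro normal_in_conjugates[OF K]) auto
  have sub: "K \<union> (\<Union>e\<in>E1. conjugates e H) \<subseteq> H" if "E1 \<subseteq> E" for E1
    using nK(3) conjugates_subset[OF nK(2)] E(2) that by blast
  \<comment> \<open>\<open>D\<close> collects the generators already removed. The chain starts at
    \<open>L E = H\<close> and ends at \<open>L {} = K\<close>.\<close>
  have "fin_gen G (L (E - D))" if "finite D" "D \<subseteq> E" for D
    using that
  proof (induction D)
    case empty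
    have "L E = H"
    proof
      show "L E \<subseteq> H" using normal_inD(3)[OF nL] by simp
      have "H = generate G (K \<union> E)" by fact
      also have "\<dots> \<subseteq> L E" unfolding L_def
        using mem_conjugates[OF nK(2)] E(2) by (intro mono_generate) blast
      finally show "H \<subseteq> L E" .
    qed
    thus ?case using Suc.prems(1) by simp
  next
    case (insert a D)
    define E1 where "E1 = E - insert a D"
    have E1: "E - D = insert a E1" "E1 \<subseteq> E" "insert a E1 \<subseteq> E" "a \<in> E"
      using insert by (auto simp: E1_def)
    define K1 where "K1 = L E1"
    define H1 where "H1 = L (insert a E1)"
    have fg: "fin_gen G H1" using insert E1 by (simp add: H1_def)
    have a: "a \<in> H" using E1 E by auto
    have nK1H: "normal_in G K1 H" and nH1: "normal_in G H1 H" unfolding K1_def H1_def using nL E1 by auto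
    have K1H1: "K1 \<subseteq> H1" unfolding K1_def H1_def L_def by (intro mono_generate) auto
    have nK1: "normal_in G K1 H1"
      using normal_in_mono[OF nK1H normal_inD(1)[OF nH1] K1H1 normal_inD(3)[OF nH1]] .
    have KK1: "K \<subseteq> K1" unfolding K1_def L_def by (intro subset_generate) blast
    have genH1: "H1 = generate G (K1 \<union> conjugates a H)"
    proof
      show "H1 \<subseteq> generate G (K1 \<union> conjugates a H)"
        unfolding H1_def L_def
      proof (rule generate_subgroup_incl)
        have "K \<union> (\<Union>e\<in>E1. conjugates e H) \<subseteq> K1"
          unfolding K1_def L_def by (intro subset_generate order_refl)
        hence 1: "K \<union> (\<Union>e\<in>E1. conjugates e H) \<subseteq> generate G (K1 \<union> conjugates a H)"
          using subset_generate[OF order_refl, of "K1 \<union> conjugates a H"] by (meson le_sup_iff order_trans)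
        have 2: "conjugates a H \<subseteq> generate G (K1 \<union> conjugates a H)"
          using subset_generate[OF order_refl, of "K1 \<union> conjugates a H"] by (meson le_sup_iff)
        show "K \<union> (\<Union>e\<in>insert a E1. conjugates e H) \<subseteq> generate G (K1 \<union> conjugates a H)"
          using 1 2 by (simp only: UN_insert Un_subset_iff simp_thms)
        show "subgroup (generate G (K1 \<union> conjugates a H)) G"
          using normal_inD(4)[OF nK1] subset_trans[OF conjugates_subset[OF nK(2) a] nK(5)]
          by (intro generate_is_subgroup Un_least)
      qed
      have "conjugates a H \<subseteq> H1" unfolding H1_def L_def by (intro subset_generate) blast
      thus "generate G (K1 \<union> conjugates a H) \<subseteq> H1"
        by (rule generate_subgroup_incl[OF Un_least[OF K1H1] normal_inD(1)[OF nH1]])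
    qed
    have nilK1: "H \<subseteq> rel_center G K1 H (Suc c)"
      using Suc.prems(7) rel_center_mono[OF KK1 order_refl] by blast
    \<comment> \<open>If \<open>c\<close> is \<open>0\<close>, all conjugates of \<open>a\<close>
      agree modulo \<open>K1\<close> and \<open>H1/K1\<close> is cyclic. Otherwise
      \<open>H1/K1\<close> has smaller class, and finitely many conjugates of \<open>a\<close>,
      again Engel, generate \<open>H1\<close> over \<open>K1\<close>, so the outer induction
      applies.\<close>
    have "fin_gen G K1"
    proof (cases c)
      case 0
      have "inv h \<otimes> a \<otimes> h \<in> generate G (K1 \<union> {a})" if h: "h \<in> H" for h
      proof -
        have "comm a h \<in> K1" using nilK1 a h 0 by auto
        moreover have "inv h \<otimes> a \<otimes> h = a \<otimes> comm a h" using a h nK by (intro conj_eq_mult_comm) auto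
        ultimately show ?thesis by (auto intro!: generate.eng intro: generate.incl)
      qed
      moreover have "K1 \<union> {a} \<subseteq> H1" using genH1 mem_conjugates[OF nK(2) a] subset_generate[OF order_refl, of "K1 \<union> conjugates a H"] by blast
      moreover have "H1 \<subseteq> carrier G" using nK1 by (rule normal_inD)
      moreover have "conjugates a H \<subseteq> generate G (K1 \<union> {a})" using calculation(1) by (auto simp: conjugates_def)
      ultimately have "H1 = generate G (K1 \<union> {a})"
        using generate_subgroup_incl[OF _ generate_is_subgroup, of "K1 \<union> conjugates a H" "K1 \<union> {a}"]
          generate_subgroup_incl[OF _ normal_inD(1)[OF nH1], of "K1 \<union> {a}"] subset_generate[OF order_refl, of "K1 \<union> {a}"]
        unfolding genH1[symmetric] by blast
      moreover have "a \<in> H1" using \<open>K1 \<union> {a} \<subseteq> H1\<close> by auto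
      moreover have "iterated_commutator G x n a = \<one>" if "x \<in> K1" for x
        using E(3)[of a] E1 that normal_inD(4)[OF nK1] by (auto simp: left_engel_def)
      ultimately show ?thesis using fin_gen_kernel_cyclic[OF fg nK1] by blast
    next
      case (Suc c')
      have "\<exists>S0. finite S0 \<and> S0 \<subseteq> conjugates a H \<and> H1 = generate G (K1 \<union> S0)"
        using normal_inD(4)[OF nK1] subset_trans[OF conjugates_subset[OF nK(2) a] nK(5)]
        by (intro fin_gen_support[OF fg genH1] Un_least)
      then obtain S0 where S0: "finite S0" "S0 \<subseteq> conjugates a H" "H1 = generate G (K1 \<union> S0)" by blast
      show ?thesis
      proof (rule Suc.IH[OF fg nK1 S0(1) _ _ S0(3)])
        show "S0 \<subseteq> H1" using S0(3) by (auto intro: generate.incl)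
        show "left_engel G n e" if "e \<in> S0" for e
          using that S0(2) left_engel_conj[OF E(3)[OF E1(4)]] nK(5) by (auto simp: conjugates_def)
        show "H1 \<subseteq> rel_center G K1 H1 c"
          using rel_center_normal_closure[OF nK1H _ a genH1] nilK1 Suc by simp
      qed
    qed
    thus ?case by (simp add: K1_def E1_def)
  qed
  from this[of E] E have "fin_gen G (L {})" by simp
  moreover have "L {} = K" unfolding L_def using generateI[OF nK(1)] by auto
  ultimately show ?case by simp
qed

end

section \<open>Abelian-by-nilpotent groups generated by Engel elements\<close>

context group
begin

lemma one_normal_in: "subgroup H G \<Longrightarrow> normal_in G {\<one>} H"
  using triv_subgroup by (intro normal_inI) (auto simp: subgroup.one_closed subgroup.mem_carrier)

text \<open>Conjugation by \<open>s\<close> is an automorphism; [x^s, g] is the conjugate of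
  [x, s g s^-1], and the second entry stays in \<open>M\<close>.\<close>

lemma rel_center_conj:
  assumes M: "M \<subseteq> carrier G" and s: "s \<in> carrier G" "\<And>x. x \<in> M \<Longrightarrow> s \<otimes> x \<otimes> inv s \<in> M"
    and x: "x \<in> rel_center G {\<one>} M q"
  shows "inv s \<otimes> x \<otimes> s \<in> rel_center G {\<one>} M q"
  using x
proof (induction q arbitrary: x)
  case 0 thus ?case using s by simp
next
  case (Suc q)
  hence xc: "x \<in> carrier G" by simp
  have "comm (inv s \<otimes> x \<otimes> s) g \<in> rel_center G {\<one>} M q" if g: "g \<in> M" for g
  proof -
    have gc: "g \<in> carrier G" using g M by auto
    have "comm (inv s \<otimes> x \<otimes> s) g = inv s \<otimes> comm x (s \<otimes> g \<otimes> inv s) \<otimes> s"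
      using xc gc s(1) by (simp add: word_simps)
    thus ?thesis using Suc s(2)[OF g] by auto
  qed
  thus ?case using xc s(1) by simp
qed

text \<open>If both \<open>M\<close> and \<open>S\<close> act nilpotently on \<open>B\<close>, refine the central
  series of \<open>M\<close> in \<open>B\<close> by the action of \<open>S\<close> on its factors.\<close>

lemma rel_center_generate:
  assumes M: "subgroup M G" and BM: "B \<subseteq> M" and S: "S \<subseteq> carrier G"
    and norm: "\<And>s x. s \<in> S \<Longrightarrow> x \<in> M \<Longrightarrow> s \<otimes> x \<otimes> inv s \<in> M \<and> inv s \<otimes> x \<otimes> s \<in> M"
    and B: "\<And>x g. x \<in> B \<Longrightarrow> g \<in> M \<union> S \<Longrightarrow> comm x g \<in> B"
    and p: "B \<subseteq> rel_center G {\<one>} M p" and q: "B \<subseteq> rel_center G {\<one>} S q"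
  shows "B \<subseteq> rel_center G {\<one>} (generate G (M \<union> S)) (p * q)"
proof -
  let ?J = "generate G (M \<union> S)"
  let ?Z = "rel_center G {\<one>}"
  have Mc: "M \<subseteq> carrier G" using M by (rule subgroup.subset)
  have MS: "M \<union> S \<subseteq> carrier G" using Mc S by auto
  have sJ: "subgroup ?J G" using MS by (rule generate_is_subgroup)
  have Jc: "?J \<subseteq> carrier G" using sJ by (rule subgroup.subset)
  have BJ: "B \<subseteq> ?J" using BM by (intro subset_generate) auto
  note nJ = one_normal_in[OF sJ]
  \<comment> \<open>Each level of the central series for \<open>M\<close> costs \<open>q\<close>
    levels of the new one; \<open>r\<close> measures the progress of the action of \<open>S\<close>
    within the current level.\<close>
  have inner: "B \<inter> ?Z M (Suc p) \<inter> ?Z S r \<subseteq> ?Z ?J (p * q + r)" 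
    if IH: "B \<inter> ?Z M p \<subseteq> ?Z ?J (p * q)" for p r
  proof (induction r)
    case 0
    have "\<one> \<in> ?Z ?J (p * q) \<inter> ?J" using rel_center_normal[OF nJ] normal_inD(1) subgroup.one_closed by blast
    thus ?case by auto
  next
    case (Suc r)
    show ?case
    proof
      fix x assume x: "x \<in> B \<inter> ?Z M (Suc p) \<inter> ?Z S (Suc r)"
      have xJ: "x \<in> ?J" using x BJ by auto
      have xc: "x \<in> carrier G" using xJ Jc by auto
      have "comm x s \<in> ?Z ?J (p * q + r) \<inter> ?J" if s: "s \<in> M \<union> S" for s
      proof -
        have sc: "s \<in> carrier G" using s MS by auto
        have cB: "comm x s \<in> B" using x s B by auto
        have "comm x s \<in> ?Z ?J (p * q + r)"
        proof (cases "s \<in> M")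
          case True
          hence "comm x s \<in> B \<inter> ?Z M p" using x cB by auto
          hence "comm x s \<in> ?Z ?J (p * q)" using IH by auto
          moreover have "?Z ?J (p * q) \<inter> ?J \<subseteq> ?Z ?J (p * q + r)" by (rule rel_center_le_mono[OF nJ]) simp
          ultimately show ?thesis using cB BJ by auto
        next
          case False
          hence sS: "s \<in> S" using s by auto
          let ?Y = "?Z M (Suc p) \<inter> M"
          have Y: "subgroup ?Y G" using rel_center_normal[OF one_normal_in[OF M]] by (rule normal_inD)
          have xY: "x \<in> ?Y" using x BM by auto
          \<comment> \<open>A commutator with \<open>s\<close> need not drop in the series for
            \<open>M\<close>. It stays in the same term because \<open>S\<close> normalizes
            \<open>M\<close>, and its height with respect to \<open>S\<close> drops instead.\<close>
          have "inv s \<otimes> x \<otimes> s \<in> ?Y"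
            using rel_center_conj[OF Mc sc, of x "Suc p"] norm[OF sS] xY by auto
          hence "inv x \<otimes> (inv s \<otimes> x \<otimes> s) \<in> ?Y"
            using Y xY subgroup.m_closed subgroup.m_inv_closed by metis
          moreover have "comm x s = inv x \<otimes> (inv s \<otimes> x \<otimes> s)" using xc sc by (simp add: word_simps)
          ultimately have "comm x s \<in> ?Z M (Suc p)" by auto
          moreover have "comm x s \<in> ?Z S r" using x sS by auto
          ultimately have "comm x s \<in> B \<inter> ?Z M (Suc p) \<inter> ?Z S r" using cB by blast
          thus ?thesis using Suc.IH by blast
        qed
        thus ?thesis using cB BJ by auto
      qed
      hence "comm x g \<in> ?Z ?J (p * q + r) \<inter> ?J" if "g \<in> ?J" for g
        using comm_generate_right[OF rel_center_normal[OF nJ] xJ _ _ that] subset_generate[of "M \<union> S"] by blast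
      thus "x \<in> ?Z ?J (p * q + Suc r)" using xc by simp
    qed
  qed
  have "B \<inter> ?Z M p \<subseteq> ?Z ?J (p * q)" for p
  proof (induction p)
    case (Suc p)
    show ?case using inner[OF Suc, of q] q by (auto simp: add.commute)
  qed auto
  thus ?thesis using p by blast
qed

lemma rel_center_abelian:
  assumes "B \<subseteq> carrier G" "\<And>x y. x \<in> B \<Longrightarrow> y \<in> B \<Longrightarrow> comm x y = \<one>"
  shows "B \<subseteq> rel_center G {\<one>} B 1"
  using assms by auto

text \<open>Induction on the class of \<open>H/B\<close>. For each generator \<open>a\<close>, the
  subgroup \<open>Ba a\<close>, generated by \<open>B\<close> and the conjugates of
  \<open>a\<close>, has smaller class over \<open>B\<close>, so \<open>B\<close> is hypercentral in
  it by induction. These subgroups are normal in \<open>H\<close> and together generate it, and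
  \<open>rel_center_generate\<close> combines their actions on \<open>B\<close>.\<close>

theorem abelian_in_hypercenter:
  assumes "fin_gen G H" "normal_in G B H" "\<And>x y. x \<in> B \<Longrightarrow> y \<in> B \<Longrightarrow> comm x y = \<one>"
    "finite E" "E \<subseteq> H" "\<And>e. e \<in> E \<Longrightarrow> left_engel G n e"
    "H = generate G (B \<union> E)" "H \<subseteq> rel_center G B H c"
  shows "\<exists>s. B \<subseteq> rel_center G {\<one>} H s"
  using assms
proof (induction c arbitrary: H E)
  case 0
  have "H \<subseteq> B" using 0(8) by simp
  hence "B \<subseteq> rel_center G {\<one>} H 1"
    using rel_center_abelian[of B] rel_center_mono[of "{\<one>}" "{\<one>}" H B G 1] normal_inD(4)[OF 0(2)] 0(3) by blast
  thus ?case by blast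
next
  case (Suc c)
  note fg = Suc.prems(1) and nB = normal_inD[OF Suc.prems(2)] and ab = Suc.prems(3) and E = Suc.prems(4-6)
  define Ba where "Ba a = generate G (B \<union> conjugates a H)" for a
  have nBa: "normal_in G (Ba a) H" if "a \<in> E" for a
    using normal_in_conjugates[OF Suc.prems(2), of "{a}"] subsetD[OF E(2) that] by (simp add: Ba_def)
  have BBa: "B \<subseteq> Ba a" for a unfolding Ba_def by (intro subset_generate) blast
  have nB_Ba: "normal_in G B (Ba a)" if "a \<in> E" for a
    using normal_in_mono[OF Suc.prems(2) normal_inD(1)[OF nBa[OF that]] BBa normal_inD(3)[OF nBa[OF that]]] .
  \<comment> \<open>When \<open>H/B\<close> is abelian, \<open>Ba a\<close> lies in the group
    generated by \<open>B\<close> and \<open>a\<close>; there \<open>B\<close> is central in itself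
    and \<open>a\<close> acts with \<open>n\<close> steps, giving length
    \<open>1 * n\<close>.\<close>
  have local: "\<exists>s. B \<subseteq> rel_center G {\<one>} (Ba a) s" if aE: "a \<in> E" for a
  proof (cases c)
    case 0
    have aH: "a \<in> H" and ac: "a \<in> carrier G" using aE E(2) nB(5) by auto
    have "conjugates a H \<subseteq> generate G (B \<union> {a})"
    proof -
      have "inv h \<otimes> a \<otimes> h \<in> generate G (B \<union> {a})" if h: "h \<in> H" for h
      proof -
        have "comm a h \<in> B" using Suc.prems(8) aH h 0 by auto
        moreover have "inv h \<otimes> a \<otimes> h = a \<otimes> comm a h" using ac h nB by (intro conj_eq_mult_comm) auto
        ultimately show ?thesis by (auto intro!: generate.eng intro: generate.incl)
      qed
      thus ?thesis by (auto simp: conjugates_def)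
    qed
    moreover have "B \<subseteq> generate G (B \<union> {a})" by (intro subset_generate) auto
    moreover have "subgroup (generate G (B \<union> {a})) G" using nB(4) ac by (intro generate_is_subgroup) auto
    ultimately have "Ba a \<subseteq> generate G (B \<union> {a})"
      unfolding Ba_def by (intro generate_subgroup_incl Un_least)
    moreover have "B \<subseteq> rel_center G {\<one>} (generate G (B \<union> {a})) (1 * n)"
    proof (rule rel_center_generate[OF nB(1) order_refl])
      show "{a} \<subseteq> carrier G" using ac by simp
      show "s \<otimes> x \<otimes> inv s \<in> B \<and> inv s \<otimes> x \<otimes> s \<in> B" if "s \<in> {a}" "x \<in> B" for s x
        using that nB(6,7) aH by auto
      show "comm x g \<in> B" if "x \<in> B" "g \<in> B \<union> {a}" for x g
        using normal_in_comm(1)[OF Suc.prems(2), of x g] that aH nB(3) by auto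
      show "B \<subseteq> rel_center G {\<one>} B 1" using rel_center_abelian nB(4) ab by blast
      show "B \<subseteq> rel_center G {\<one>} {a} n"
        using rel_center_singleton[OF ac] E(3)[OF aE] nB(4) by (auto simp: left_engel_def)
    qed
    ultimately show ?thesis using rel_center_mono[OF order_refl, of "Ba a" "generate G (B \<union> {a})"] by blast
  next
    case (Suc c')
    have genH: "H = generate G (Ba a \<union> E)"
    proof
      show "H \<subseteq> generate G (Ba a \<union> E)" unfolding Suc.prems(7) using BBa by (intro mono_generate) auto
      show "generate G (Ba a \<union> E) \<subseteq> H"
        using normal_inD(3)[OF nBa[OF aE]] E(2) nB(2) by (intro generate_subgroup_incl) auto
    qed
    have nilBa: "H \<subseteq> rel_center G (Ba a) H (Suc c)"
      using Suc.prems(8) rel_center_mono[OF BBa order_refl] by blast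
    have aH: "a \<in> H" using aE E(2) by auto
    \<comment> \<open>Finite generation lets the induction hypothesis be used with a finite set of
      conjugates of \<open>a\<close> in place of the whole class.\<close>
    have fgBa: "fin_gen G (Ba a)"
      by (rule fin_gen_kernel_nilpotent[OF fg nBa[OF aE] E genH nilBa])
    have "\<exists>S0. finite S0 \<and> S0 \<subseteq> conjugates a H \<and> Ba a = generate G (B \<union> S0)"
      using nB(4) subset_trans[OF conjugates_subset[OF nB(2) aH] nB(5)] 
      by (intro fin_gen_support[OF fgBa Ba_def] Un_least)
    then obtain S0 where S0: "finite S0" "S0 \<subseteq> conjugates a H" "Ba a = generate G (B \<union> S0)" by blast
    show ?thesis
    proof (rule Suc.IH[OF fgBa nB_Ba[OF aE] ab S0(1) _ _ S0(3)])
      show "S0 \<subseteq> Ba a" unfolding S0(3) by (intro subset_generate) blast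
      show "left_engel G n e" if "e \<in> S0" for e
        using that S0(2) left_engel_conj[OF E(3)[OF aE]] nB(5) by (auto simp: conjugates_def)
      show "Ba a \<subseteq> rel_center G B (Ba a) c"
        using rel_center_normal_closure[OF Suc.prems(2) _ aH Ba_def] Suc.prems(8) Suc by simp
    qed
  qed
  define L where "L E1 = generate G (B \<union> (\<Union>e\<in>E1. conjugates e H))" for E1
  have "\<exists>s. B \<subseteq> rel_center G {\<one>} (L E1) s" if "finite E1" "E1 \<subseteq> E" for E1
    using that
  proof (induction E1)
    case empty
    have "L {} = B" unfolding L_def using generateI[OF nB(1)] by auto
    thus ?case using rel_center_abelian nB(4) ab by blast
  next
    case (insert a E1)
    then obtain p where p: "B \<subseteq> rel_center G {\<one>} (L E1) p" by blast
    obtain q where q: "B \<subseteq> rel_center G {\<one>} (Ba a) q" using local insert by blast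
    have a: "a \<in> E" using insert by auto
    have nL: "normal_in G (L E1) H"
      unfolding L_def using insert E(2) by (intro normal_in_conjugates[OF Suc.prems(2)]) auto
    note nL' = normal_inD[OF nL]
    have BaH: "Ba a \<subseteq> H" using nBa[OF a] by (rule normal_inD)
    have LH: "L E1 \<union> Ba a \<subseteq> H" using nL'(3) BaH by auto
    have BL: "B \<subseteq> L E1" unfolding L_def by (intro subset_generate) blast
    have "B \<subseteq> rel_center G {\<one>} (generate G (L E1 \<union> Ba a)) (p * q)"
    proof (rule rel_center_generate[OF nL'(1) BL _ _ _ p q])
      show "Ba a \<subseteq> carrier G" using BaH nB(5) by auto
      show "s \<otimes> x \<otimes> inv s \<in> L E1 \<and> inv s \<otimes> x \<otimes> s \<in> L E1" if "s \<in> Ba a" "x \<in> L E1" for s x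
        using that nL'(6,7) BaH by blast
      show "comm x g \<in> B" if "x \<in> B" "g \<in> L E1 \<union> Ba a" for x g
        using normal_in_comm(1)[OF Suc.prems(2)] that LH by blast
    qed
    moreover have "L (insert a E1) \<subseteq> generate G (L E1 \<union> Ba a)"
      unfolding L_def[of "insert a E1"]
    proof (rule generate_subgroup_incl)
      have 1: "B \<union> (\<Union>e\<in>E1. conjugates e H) \<subseteq> L E1" unfolding L_def by (intro subset_generate) simp
      have 2: "conjugates a H \<subseteq> Ba a" unfolding Ba_def by (intro subset_generate) simp
      have 3: "L E1 \<union> Ba a \<subseteq> generate G (L E1 \<union> Ba a)" by (intro subset_generate) simp
      show "B \<union> (\<Union>e\<in>insert a E1. conjugates e H) \<subseteq> generate G (L E1 \<union> Ba a)"
        using 1 2 3 by auto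
      show "subgroup (generate G (L E1 \<union> Ba a)) G"
        using LH nB(5) by (intro generate_is_subgroup) auto
    qed
    ultimately show ?case using rel_center_mono[OF order_refl] by blast
  qed
  from this[OF E(1)] obtain s where s: "B \<subseteq> rel_center G {\<one>} (L E) s" by blast
  have "H \<subseteq> L E" 
  proof -
    have "E \<subseteq> (\<Union>e\<in>E. conjugates e H)" using mem_conjugates[OF nB(2)] E(2) by blast
    thus ?thesis unfolding L_def Suc.prems(7)[symmetric]
      by (subst Suc.prems(7)) (intro mono_generate, blast)
  qed
  thus ?case using s rel_center_mono[OF order_refl] by blast
qed

end

section \<open>Finite groups generated by Engel elements\<close>

context group
begin

definition nilpotent_subgroup :: "'a set \<Rightarrow> bool" where
  "nilpotent_subgroup U \<longleftrightarrow> subgroup U G \<and> (\<exists>c. U \<subseteq> rel_center G {\<one>} U c)"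

text \<open>\<open>U\<close> may be any set: besides subgroups, a set of Engel elements is
  normalized below. Asking for both conjugations makes the condition pass to inverses.\<close>

definition normalizes :: "'a \<Rightarrow> 'a set \<Rightarrow> bool" where
  "normalizes g U \<longleftrightarrow> g \<in> carrier G \<and> (\<forall>x\<in>U. inv g \<otimes> x \<otimes> g \<in> U \<and> g \<otimes> x \<otimes> inv g \<in> U)"

lemma normalizes_generate:
  assumes U: "U \<subseteq> carrier G" and S: "\<And>s. s \<in> S \<Longrightarrow> normalizes s U" and g: "g \<in> generate G S"
  shows "normalizes g U"
proof -
  have Sc: "S \<subseteq> carrier G" using S by (auto simp: normalizes_def)
  show ?thesis
    using conj_closed_generate[OF U Sc g] S generate_in_carrier[OF Sc g] by (auto simp: normalizes_def)
qed

lemma normalizes_self: "subgroup U G \<Longrightarrow> u \<in> U \<Longrightarrow> normalizes u U"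
  by (simp add: normalizes_def subgroup.m_closed subgroup.m_inv_closed subgroup.mem_carrier)

lemma normal_in_generate_insert:
  assumes U: "subgroup U G" and v: "normalizes v U"
  shows "normal_in G U (generate G (insert v U))"
proof (rule normal_inI[OF U])
  have c: "insert v U \<subseteq> carrier G" using U v by (auto simp: normalizes_def subgroup.mem_carrier)
  thus "subgroup (generate G (insert v U)) G" by (rule generate_is_subgroup)
  show "U \<subseteq> generate G (insert v U)" by (intro subset_generate) auto
  fix d h assume d: "d \<in> U" and h: "h \<in> generate G (insert v U)"
  have "normalizes h U"
    using normalizes_generate[OF _ _ h] normalizes_self[OF U] v c by auto
  thus "inv h \<otimes> d \<otimes> h \<in> U" using d by (simp add: normalizes_def)
qed

text \<open>\<open>U\<close> is hypercentral in the enlarged group because \<open>v\<close> acts on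
  it with \<open>n\<close> steps. The quotient by \<open>U\<close> is cyclic, which adds one more
  central factor: length \<open>1 + c * n\<close>.\<close>

lemma nilpotent_insert_engel:
  assumes U: "nilpotent_subgroup U" and v: "normalizes v U" and eng: "left_engel G n v"
  shows "nilpotent_subgroup (generate G (insert v U))"
proof -
  let ?J = "generate G (insert v U)"
  from U obtain c where sU: "subgroup U G" and c: "U \<subseteq> rel_center G {\<one>} U c"
    by (auto simp: nilpotent_subgroup_def)
  have vc: "v \<in> carrier G" using v by (simp add: normalizes_def)
  have Uc: "U \<subseteq> carrier G" using sU by (rule subgroup.subset)
  have J: "subgroup ?J G" using Uc vc by (intro generate_is_subgroup) auto
  note nUJ = normal_in_generate_insert[OF sU v]
  have "U \<subseteq> rel_center G {\<one>} (generate G (U \<union> {v})) (c * n)"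
  proof (rule rel_center_generate[OF sU order_refl])
    show "{v} \<subseteq> carrier G" using vc by simp
    show "s \<otimes> x \<otimes> inv s \<in> U \<and> inv s \<otimes> x \<otimes> s \<in> U" if "s \<in> {v}" "x \<in> U" for s x
      using that v by (simp add: normalizes_def)
    show "comm x g \<in> U" if "x \<in> U" "g \<in> U \<union> {v}" for x g
      using normal_in_comm(1)[OF nUJ that(1)] subset_generate[of "{g}" "insert v U"] that(2) by auto
    show "U \<subseteq> rel_center G {\<one>} U c" by (rule c)
    show "U \<subseteq> rel_center G {\<one>} {v} n"
      using rel_center_singleton[OF vc] eng Uc by (auto simp: left_engel_def)
  qed
  hence UJ: "U \<subseteq> rel_center G {\<one>} ?J (c * n)" by simp
  have "comm x g \<in> U" if "x \<in> ?J" "g \<in> ?J" for x g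
  proof (rule comm_generate[OF nUJ _ _ _ that])
    show sub: "insert v U \<subseteq> ?J" "insert v U \<subseteq> ?J" by (intro subset_generate order_refl)+
    have vv: "comm v v \<in> U" using sU vc subgroup.one_closed by (auto simp: word_simps)
    show "comm s t \<in> U" if "s \<in> insert v U" "t \<in> insert v U" for s t
      using that normal_in_comm[OF nUJ] vv sub by blast
  qed
  hence "?J \<subseteq> rel_center G U ?J 1" using subgroup.subset[OF J] by auto
  also have "\<dots> \<subseteq> rel_center G (rel_center G {\<one>} ?J (c * n)) ?J 1"
    using UJ by (rule rel_center_mono) simp
  finally have "?J \<subseteq> rel_center G {\<one>} ?J (1 + c * n)" unfolding rel_center_add .
  thus ?thesis using J unfolding nilpotent_subgroup_def by blast
qed

text \<open>The normalizer condition, kept inside an invariant set \<open>S\<close>. The subgroups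
  generated by \<open>I\<close> and the \<open>q\<close>-th centre of \<open>U\<close> climb from
  \<open>I\<close> to \<open>U\<close>, each normalized by the next. At the first one that meets
  \<open>S\<close> outside \<open>I\<close>, an element \<open>u\<close> found there normalizes the
  previous one, whose intersection with \<open>S\<close> is exactly
  \<open>I \<inter> S\<close>.\<close>

lemma nilpotent_normalizer:
  assumes U: "nilpotent_subgroup U" and I: "subgroup I G" "I \<subseteq> U" and S: "S \<subseteq> U" "\<not> S \<subseteq> I"
    and conj: "\<And>s g. s \<in> S \<Longrightarrow> g \<in> U \<Longrightarrow> inv g \<otimes> s \<otimes> g \<in> S"
  shows "\<exists>u\<in>S - I. normalizes u (I \<inter> S)"
proof -
  from U obtain c where sU: "subgroup U G" and c: "U \<subseteq> rel_center G {\<one>} U c"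
    by (auto simp: nilpotent_subgroup_def)
  have Uc: "U \<subseteq> carrier G" using sU by (rule subgroup.subset)
  define Z where "Z q = rel_center G {\<one>} U q \<inter> U" for q
  have nZ: "normal_in G (Z q) U" for q
    unfolding Z_def by (rule rel_center_normal[OF one_normal_in[OF sU]])
  define K where "K q = generate G (I \<union> Z q)" for q
  have KU: "K q \<subseteq> U" for q
    unfolding K_def using I(2) sU by (intro generate_subgroup_incl) (auto simp: Z_def)
  have sK: "subgroup (K q) G" for q
    unfolding K_def using I(2) Uc by (intro generate_is_subgroup) (auto simp: Z_def)
  have K0: "K 0 \<subseteq> I"
    unfolding K_def using I by (intro generate_subgroup_incl) (auto simp: Z_def subgroup.one_closed)
  have "U \<subseteq> K c" unfolding K_def using c by (intro subset_generate) (auto simp: Z_def)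
  hence "\<not> S \<inter> K c \<subseteq> I" using S by auto
  moreover have "S \<inter> K 0 \<subseteq> I" using K0 by auto
  ultimately obtain q where q: "S \<inter> K q \<subseteq> I" "\<not> S \<inter> K (Suc q) \<subseteq> I"
    by (induction c) auto
  then obtain u where u: "u \<in> S" "u \<in> K (Suc q)" "u \<notin> I" by blast
  have "normalizes s (K q)" if s: "s \<in> I \<union> Z (Suc q)" for s
  proof (cases "s \<in> I")
    case True
    hence "s \<in> K q" unfolding K_def using subset_generate[of I] by auto
    thus ?thesis by (rule normalizes_self[OF sK])
  next
    case False
    hence s: "s \<in> Z (Suc q)" using s by simp
    have sc: "s \<in> carrier G" using s Uc by (auto simp: Z_def)
    have *: "inv t \<otimes> p \<otimes> t \<in> K q" if t: "t \<in> Z (Suc q)" and p: "p \<in> K q" for t p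
    proof -
      have pU: "p \<in> U" using p KU by auto
      have tc: "t \<in> carrier G" "p \<in> carrier G" using t Uc pU by (auto simp: Z_def)
      have "comm t p \<in> Z q" using t pU sU subgroup_comm by (auto simp: Z_def)
      hence "comm t p \<in> K q" unfolding K_def using subset_generate[of "Z q"] by auto
      hence "inv (comm t p) \<in> K q" using sK by (simp add: subgroup.m_inv_closed)
      moreover have "inv t \<otimes> p \<otimes> t = p \<otimes> inv (comm t p)" using tc by (simp add: word_simps)
      ultimately show ?thesis using p sK by (simp add: subgroup.m_closed)
    qed
    have "inv s \<in> Z (Suc q)" using s normal_inD(1)[OF nZ] by (simp add: subgroup.m_inv_closed)
    thus ?thesis using *[OF s] *[of "inv s"] sc by (simp add: normalizes_def)
  qed
  hence uK: "normalizes u (K q)"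
    using normalizes_generate[of "K q" "I \<union> Z (Suc q)"] u(2) subgroup.subset[OF sK] unfolding K_def by blast
  have uU: "u \<in> U" using u S by auto
  have uc: "u \<in> carrier G" using uU Uc by auto
  have IK: "I \<subseteq> K q" unfolding K_def by (intro subset_generate) simp
  have "normalizes u (I \<inter> S)" unfolding normalizes_def
  proof (intro conjI ballI uc)
    fix x assume x: "x \<in> I \<inter> S"
    have a: "inv u \<otimes> x \<otimes> u \<in> K q" "u \<otimes> x \<otimes> inv u \<in> K q" using uK x IK by (auto simp: normalizes_def)
    have b: "inv u \<otimes> x \<otimes> u \<in> S" using conj x uU by auto
    have "inv (inv u) \<otimes> x \<otimes> inv u \<in> S" using x uU sU by (intro conj) (auto simp: subgroup.m_inv_closed)
    hence c: "u \<otimes> x \<otimes> inv u \<in> S" using uc by simp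
    show "inv u \<otimes> x \<otimes> u \<in> I \<inter> S" "u \<otimes> x \<otimes> inv u \<in> I \<inter> S" using a b c q(1) by auto
  qed
  thus ?thesis using u by blast
qed

lemma rel_center_conj_image:
  assumes g: "g \<in> carrier G" and U: "subgroup U G" and x: "x \<in> rel_center G {\<one>} U q"
  shows "g \<otimes> x \<otimes> inv g \<in> rel_center G {\<one>} ((\<lambda>x. g \<otimes> x \<otimes> inv g) ` U) q"
  using x
proof (induction q arbitrary: x)
  case (Suc q)
  have "comm (g \<otimes> x \<otimes> inv g) (g \<otimes> y \<otimes> inv g) \<in> rel_center G {\<one>} ((\<lambda>x. g \<otimes> x \<otimes> inv g) ` U) q"
    if y: "y \<in> U" for y
  proof -
    have "g \<otimes> comm x y \<otimes> inv g = comm (g \<otimes> x \<otimes> inv g) (g \<otimes> y \<otimes> inv g)"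
      using conj_comm[of x y "inv g"] g Suc.prems y subgroup.mem_carrier[OF U] by simp
    moreover have "g \<otimes> comm x y \<otimes> inv g \<in> rel_center G {\<one>} ((\<lambda>x. g \<otimes> x \<otimes> inv g) ` U) q"
      using Suc y by auto
    ultimately show ?thesis by simp
  qed
  thus ?case using Suc.prems g by auto
qed (use g in auto)

text \<open>Baer's theorem: a maximal nilpotent subgroup generated by Engel elements is unique. Otherwise
  choose two of them whose intersection contains as many Engel elements as possible; the normalizer
  condition then produces a conjugate with a larger intersection.\<close>

theorem engel_generated_finite_nilpotent:
  assumes fin: "finite (carrier G)" and gen: "carrier G = generate G E0"
    and eng: "\<And>e. e \<in> E0 \<Longrightarrow> left_engel G n e" and E0: "E0 \<subseteq> carrier G"
  shows "\<exists>c. carrier G \<subseteq> rel_center G {\<one>} (carrier G) c"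
proof -
  define E where "E = {x. left_engel G n x}"
  have Ec: "E \<subseteq> carrier G" by (auto simp: E_def left_engel_def)
  have Econj: "inv g \<otimes> e \<otimes> g \<in> E" if "e \<in> E" "g \<in> carrier G" for e g
    using that left_engel_conj by (auto simp: E_def)
  have Econj': "g \<otimes> e \<otimes> inv g \<in> E" if "e \<in> E" "g \<in> carrier G" for e g
    using Econj[of e "inv g"] that by simp
  \<comment> \<open>A member of \<open>P\<close> is determined by the Engel elements it contains, so
    intersections may be measured by Engel elements alone.\<close>
  define P where "P = {U. nilpotent_subgroup U \<and> U = generate G (U \<inter> E)}"
  have Psub: "subgroup U G" "U \<subseteq> carrier G" if "U \<in> P" for U
    using that subgroup.subset[of U G] by (simp_all add: P_def nilpotent_subgroup_def)
  have finU: "finite U" if "U \<subseteq> carrier G" for U using that fin by (rule finite_subset)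
  have Pgen: "U = generate G (U \<inter> E)" if "U \<in> P" for U using that by (simp add: P_def)
  have Pins: "generate G (insert e U) \<in> P" if U: "U \<in> P" and e: "e \<in> E" "normalizes e U" for e U
  proof -
    have c: "insert e U \<subseteq> carrier G" using Psub(2)[OF U] e Ec by auto
    let ?J = "generate G (insert e U)"
    have J: "subgroup ?J G" using c by (rule generate_is_subgroup)
    have "?J \<subseteq> generate G (?J \<inter> E)"
    proof (rule generate_subgroup_incl)
      have sub: "insert e U \<subseteq> ?J" by (intro subset_generate order_refl)
      have "U \<subseteq> generate G (?J \<inter> E)"
        using Pgen[OF U] mono_generate[of "U \<inter> E" "?J \<inter> E"] sub by blast
      moreover have "e \<in> generate G (?J \<inter> E)" using sub e(1) by (intro generate.incl) auto
      ultimately show "insert e U \<subseteq> generate G (?J \<inter> E)" by blast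
      show "subgroup (generate G (?J \<inter> E)) G" using Ec by (intro generate_is_subgroup) auto
    qed
    moreover have "generate G (?J \<inter> E) \<subseteq> ?J" using J by (intro generate_subgroup_incl) auto
    moreover have "nilpotent_subgroup ?J"
      using nilpotent_insert_engel[of U e n] U e by (auto simp: P_def E_def)
    ultimately show ?thesis by (simp add: P_def)
  qed
  have Pone: "{\<one>} \<in> P"
  proof -
    have "subgroup (generate G ({\<one>} \<inter> E)) G" using Ec by (intro generate_is_subgroup) auto
    moreover have "generate G ({\<one>} \<inter> E) \<subseteq> {\<one>}" by (intro generate_subgroup_incl triv_subgroup) auto
    ultimately have "{\<one>} = generate G ({\<one>} \<inter> E)" using subgroup.one_closed by blast
    moreover have "{\<one>} \<subseteq> rel_center G {\<one>} {\<one>} 0" by simp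
    ultimately show ?thesis unfolding P_def nilpotent_subgroup_def using triv_subgroup by blast
  qed
  define Mx where "Mx = {U \<in> P. \<forall>V\<in>P. U \<subseteq> V \<longrightarrow> V = U}"
  have "\<exists>U. U \<in> Mx"
  proof -
    have "\<forall>U. U \<in> P \<longrightarrow> card U < Suc (card (carrier G))" using Psub(2) by (auto simp: less_Suc_eq_le intro: card_mono[OF fin])
    from ex_has_greatest_nat[of "\<lambda>U. U \<in> P" "{\<one>}" card, OF Pone this]
    obtain U where U: "U \<in> P" "\<And>V. V \<in> P \<Longrightarrow> card V \<le> card U" by blast
    have "V = U" if "V \<in> P" "U \<subseteq> V" for V
      using card_seteq[OF finU[OF Psub(2)] that(2) U(2)] that by auto
    thus ?thesis using U(1) by (auto simp: Mx_def)
  qed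
  then obtain U0 where U0: "U0 \<in> Mx" by blast
  show ?thesis
  proof (cases "\<exists>U V. U \<in> Mx \<and> V \<in> P \<and> \<not> V \<subseteq> U")
    case False
    have "e \<in> U0" if e: "e \<in> E0" for e
    proof -
      have eE: "e \<in> E" using eng e by (simp add: E_def)
      have "normalizes e {\<one>}" using e E0 by (auto simp: normalizes_def)
      hence "generate G (insert e {\<one>}) \<in> P" using Pins[OF Pone eE] by blast
      hence "generate G (insert e {\<one>}) \<subseteq> U0" using False U0 by blast
      thus ?thesis by (auto intro: generate.incl)
    qed
    moreover have U0P: "U0 \<in> P" using U0 by (simp add: Mx_def)
    ultimately have "carrier G \<subseteq> U0" unfolding gen using Psub(1) by (intro generate_subgroup_incl) auto
    hence "U0 = carrier G" using Psub(2)[OF U0P] by auto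
    thus ?thesis using U0P by (auto simp: P_def nilpotent_subgroup_def)
  next
    case True
    then obtain U1 V1 where "U1 \<in> Mx \<and> V1 \<in> P \<and> \<not> V1 \<subseteq> U1" by blast
    \<comment> \<open>Only the first component has to be maximal; the second is any member of
      \<open>P\<close> not contained in it, a role that a conjugate of \<open>U\<close> can take
      over. Pairs are used in order to maximize over both at once.\<close>
    then obtain p0 where p0: "fst p0 \<in> Mx \<and> snd p0 \<in> P \<and> \<not> snd p0 \<subseteq> fst p0"
      using that[of "(U1, V1)"] by simp
    have "\<forall>p. fst p \<in> Mx \<and> snd p \<in> P \<and> \<not> snd p \<subseteq> fst p \<longrightarrow> card (fst p \<inter> snd p \<inter> E) < Suc (card (carrier G))"
      using fin Ec by (auto simp: less_Suc_eq_le intro!: card_mono)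
    from ex_has_greatest_nat[of "\<lambda>p. fst p \<in> Mx \<and> snd p \<in> P \<and> \<not> snd p \<subseteq> fst p" p0
        "\<lambda>p. card (fst p \<inter> snd p \<inter> E)", OF p0 this]
    obtain p1 where p1: "fst p1 \<in> Mx \<and> snd p1 \<in> P \<and> \<not> snd p1 \<subseteq> fst p1"
      "\<forall>p. fst p \<in> Mx \<and> snd p \<in> P \<and> \<not> snd p \<subseteq> fst p \<longrightarrow>
        card (fst p \<inter> snd p \<inter> E) \<le> card (fst p1 \<inter> snd p1 \<inter> E)" by blast
    define U where "U = fst p1"
    define V where "V = snd p1"
    have UV: "U \<in> Mx" "V \<in> P" "\<not> V \<subseteq> U" using p1(1) by (simp_all add: U_def V_def)
    have max: "card (U' \<inter> V' \<inter> E) \<le> card (U \<inter> V \<inter> E)"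
      if "U' \<in> Mx" "V' \<in> P" "\<not> V' \<subseteq> U'" for U' V'
      using p1(2)[rule_format, of "(U', V')"] that by (simp add: U_def V_def)
    have UP: "U \<in> P" and Umax: "\<And>V. V \<in> P \<Longrightarrow> U \<subseteq> V \<Longrightarrow> V = U" using UV(1) by (auto simp: Mx_def)
    note sU = Psub[OF UP] and sV = Psub[OF UV(2)]
    have absorb: "e \<in> U" if e: "e \<in> E" "normalizes e U" for e
    proof -
      have "insert e U \<subseteq> generate G (insert e U)" by (intro subset_generate order_refl)
      thus ?thesis using Umax[OF Pins[OF UP e]] by auto
    qed
    define T where "T = U \<inter> V \<inter> E"
    define I where "I = generate G T"
    have TE: "T \<subseteq> carrier G" using Ec by (auto simp: T_def)
    have sI: "subgroup I G" unfolding I_def using TE by (rule generate_is_subgroup)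
    have "T \<subseteq> U" "T \<subseteq> V" by (auto simp: T_def)
    hence IU: "I \<subseteq> U" and IV: "I \<subseteq> V"
      unfolding I_def using generate_subgroup_incl sU(1) sV(1) by simp_all
    have TI: "T \<subseteq> I" unfolding I_def by (intro subset_generate order_refl)
    have IE: "I \<inter> (U \<inter> E) = T" "I \<inter> (V \<inter> E) = T" using IU IV TI by (auto simp: T_def)
    have "\<not> U \<inter> E \<subseteq> I"
    proof
      assume "U \<inter> E \<subseteq> I"
      hence "generate G (U \<inter> E) \<subseteq> V" using IV sV(1) by (intro generate_subgroup_incl) auto
      hence "U \<subseteq> V" using Pgen[OF UP] by simp
      thus False using Umax[OF UV(2)] UV(3) by simp
    qed
    moreover have "inv g \<otimes> s \<otimes> g \<in> U \<inter> E" if "s \<in> U \<inter> E" "g \<in> U" for s g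
      using subgroup_conj[OF sU(1), of s g] Econj[of s g] that sU(2) by auto
    moreover have "nilpotent_subgroup U" using UP by (simp add: P_def)
    ultimately have "\<exists>u\<in>U \<inter> E - I. normalizes u (I \<inter> (U \<inter> E))"
      using nilpotent_normalizer[OF _ sI IU, of "U \<inter> E"] by blast
    then obtain u where u: "u \<in> U" "u \<in> E" "u \<notin> I" "normalizes u T" unfolding IE by blast
    have "\<not> V \<inter> E \<subseteq> I"
    proof
      assume "V \<inter> E \<subseteq> I"
      hence "generate G (V \<inter> E) \<subseteq> U" using IU sU(1) by (intro generate_subgroup_incl) auto
      thus False using Pgen[OF UV(2)] UV(3) by simp
    qed
    moreover have "inv g \<otimes> s \<otimes> g \<in> V \<inter> E" if "s \<in> V \<inter> E" "g \<in> V" for s g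
      using subgroup_conj[OF sV(1), of s g] Econj[of s g] that sV(2) by auto
    moreover have "nilpotent_subgroup V" using UV(2) by (simp add: P_def)
    ultimately have "\<exists>v\<in>V \<inter> E - I. normalizes v (I \<inter> (V \<inter> E))"
      using nilpotent_normalizer[OF _ sI IV, of "V \<inter> E"] by blast
    then obtain v where v: "v \<in> V" "v \<in> E" "v \<notin> I" "normalizes v T" unfolding IE by blast
    have uvc: "u \<in> carrier G" "v \<in> carrier G" using u v Ec by auto
    \<comment> \<open>The sequence starts at \<open>v\<close>, which does not normalize
      \<open>U\<close>, for otherwise \<open>U\<close> would absorb it and \<open>v\<close> would
      lie in \<open>T\<close>. It ends at the identity since \<open>u\<close> is Engel. So there is
      a last obstruction \<open>g\<close> that does not normalize \<open>U\<close> although [g, u]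
      does.\<close>
    let ?w = "\<lambda>i. iterated_commutator G v i u"
    have wT: "normalizes (?w i) T" for i
    proof -
      have s: "subgroup (generate G {u, v}) G" using uvc by (intro generate_is_subgroup) auto
      have "?w i \<in> generate G {u, v}"
      proof (induction i)
        case (Suc i)
        have "u \<in> generate G {u, v}" by (intro generate.incl) simp
        thus ?case using subgroup_comm[OF s Suc] by simp
      qed (auto intro: generate.incl)
      thus ?thesis using normalizes_generate[OF TE, of "{u, v}"] u v by blast
    qed
    have "\<not> normalizes (?w 0) U"
    proof
      assume "normalizes (?w 0) U"
      hence "v \<in> U" using absorb v by simp
      hence "v \<in> T" using v by (simp add: T_def)
      thus False using v TI by auto
    qed
    moreover have "?w n = \<one>" using u(2) uvc by (simp add: E_def left_engel_def)
    hence "normalizes (?w n) U" using sU(1) by (simp add: normalizes_self subgroup.one_closed)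
    ultimately obtain i where i: "\<not> normalizes (?w i) U" "normalizes (?w (Suc i)) U"
      by (induction n) auto
    define g where "g = ?w i"
    have gc: "g \<in> carrier G" unfolding g_def using uvc by simp
    define x where "x = inv g \<otimes> u \<otimes> g"
    have xE: "x \<in> E" unfolding x_def using Econj u(2) gc by blast
    \<comment> \<open>The conjugate u^g equals u [g, u]^-1, a product of two elements normalizing
      \<open>U\<close>. Being Engel, it is then absorbed by \<open>U\<close>, which puts
      \<open>u\<close> into the conjugate \<open>U'\<close>.\<close>
    have "normalizes x U"
    proof -
      have "x = u \<otimes> inv (comm g u)" unfolding x_def using gc uvc by (simp add: word_simps)
      hence "x \<in> generate G {u, comm g u}" by (auto intro!: generate.eng generate.inv intro: generate.incl)
      moreover have "normalizes s U" if "s \<in> {u, comm g u}" for s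
        using that normalizes_self[OF sU(1) u(1)] i(2) by (auto simp: g_def)
      ultimately show ?thesis using normalizes_generate[OF sU(2)] by blast
    qed
    hence xU: "x \<in> U" using absorb xE by blast
    let ?h = "\<lambda>x. g \<otimes> x \<otimes> inv g"
    interpret h: group_hom G G ?h
      using gc by unfold_locales (auto simp: hom_def word_simps)
    define U' where "U' = ?h ` U"
    have inv_h: "?h (inv g \<otimes> y \<otimes> g) = y" if "y \<in> carrier G" for y
      using gc that by (simp add: word_simps)
    have "U' \<in> P"
    proof -
      have "U' = ?h ` generate G (U \<inter> E)" unfolding U'_def using Pgen[OF UP] by simp
      also have "\<dots> = generate G (?h ` (U \<inter> E))" using Ec by (intro h.generate_img[symmetric]) auto
      also have "?h ` (U \<inter> E) = U' \<inter> E"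
      proof
        show "?h ` (U \<inter> E) \<subseteq> U' \<inter> E" unfolding U'_def using Econj' gc by auto
        show "U' \<inter> E \<subseteq> ?h ` (U \<inter> E)"
        proof
          fix y assume y: "y \<in> U' \<inter> E"
          then obtain z where z: "z \<in> U" "y = ?h z" by (auto simp: U'_def)
          have "z = inv g \<otimes> y \<otimes> g" using z gc sU(2) by (auto simp: word_simps)
          hence "z \<in> E" using Econj[of y g] y gc by simp
          thus "y \<in> ?h ` (U \<inter> E)" using z by blast
        qed
      qed
      finally have 1: "U' = generate G (U' \<inter> E)" .
      from UP obtain c where "U \<subseteq> rel_center G {\<one>} U c" by (auto simp: P_def nilpotent_subgroup_def)
      hence "U' \<subseteq> rel_center G {\<one>} U' c" unfolding U'_def
        using rel_center_conj_image[OF gc sU(1)] by blast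
      thus ?thesis using 1 h.subgroup_img_is_subgroup[OF sU(1)] unfolding P_def nilpotent_subgroup_def U'_def by blast
    qed
    moreover have "\<not> U' \<subseteq> U"
    proof
      assume sub: "U' \<subseteq> U"
      have "inj_on ?h U" using gc sU(2) by (intro inj_onI) (auto simp: subset_iff)
      hence eq: "U' = U" using card_subset_eq[OF finU[OF sU(2)] sub] by (simp add: U'_def card_image)
      have "normalizes g U" unfolding normalizes_def
      proof (intro conjI ballI gc)
        fix y assume y: "y \<in> U"
        thus "?h y \<in> U" using sub unfolding U'_def by blast
        have "y \<in> ?h ` U" using y eq by (simp add: U'_def)
        then obtain z where z: "z \<in> U" "y = ?h z" by blast
        have "inv g \<otimes> y \<otimes> g = z" using z gc sU(2) by (auto simp: word_simps)
        thus "inv g \<otimes> y \<otimes> g \<in> U" using z by simp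
      qed
      thus False using i(1) by (simp add: g_def)
    qed
    \<comment> \<open>\<open>U'\<close> contains \<open>T\<close> and also \<open>u\<close>, which
      is not in \<open>T\<close>, so the pair \<open>(U, U')\<close> beats the chosen
      maximum.\<close>
    ultimately have "card (U \<inter> U' \<inter> E) \<le> card T" using max[OF UV(1)] by (simp add: T_def)
    moreover have "insert u T \<subseteq> U \<inter> U' \<inter> E"
    proof -
      have "?h x = u" unfolding x_def using inv_h uvc by blast
      hence "u \<in> U'" using xU by (force simp: U'_def)
      moreover have "y \<in> U'" if y: "y \<in> T" for y
      proof -
        have "inv g \<otimes> y \<otimes> g \<in> U" using wT[of i] y by (auto simp: normalizes_def g_def T_def)
        moreover have "y \<in> carrier G" using y TE by auto
        ultimately show ?thesis unfolding U'_def using inv_h by force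
      qed
      ultimately show ?thesis using u by (auto simp: T_def)
    qed
    moreover have "finite (U \<inter> U' \<inter> E)" using finU[of "U \<inter> U' \<inter> E"] Ec by auto
    moreover have "u \<notin> T" "finite T" using u(3) TI finU[OF TE] by auto
    ultimately have False using card_mono[of "U \<inter> U' \<inter> E" "insert u T"] by simp
    thus ?thesis ..
  qed
qed

end

section \<open>Ascending series\<close>

text \<open>Local solubility of \<open>B/A\<close>, phrased through finite subsets of
  \<open>B\<close> itself so that neither a quotient nor a restricted carrier appears;
  \<open>loc_finite_over\<close> does the same by counting cosets.\<close>

definition loc_soluble_over :: "('a, 'b) monoid_scheme \<Rightarrow> 'a set \<Rightarrow> 'a set \<Rightarrow> bool" where
  "loc_soluble_over K B A \<longleftrightarrow>
     (\<forall>F. finite F \<and> F \<subseteq> B \<longrightarrow> (\<exists>j. (derived K ^^ j) (generate K F) \<subseteq> A))"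

definition loc_finite_over :: "('a, 'b) monoid_scheme \<Rightarrow> 'a set \<Rightarrow> 'a set \<Rightarrow> bool" where
  "loc_finite_over K B A \<longleftrightarrow>
     (\<forall>F. finite F \<and> F \<subseteq> B \<longrightarrow> finite ((\<lambda>x. A #>\<^bsub>K\<^esub> x) ` generate K F))"

section \<open>Factors of a series seen from inside the group\<close>

lemma (in group) exp_of_derived_subset:
  assumes "subgroup H G" shows "(derived G ^^ j) H \<subseteq> H"
proof (induction j)
  case (Suc j) thus ?case using derived_incl[OF Suc assms] by simp
qed simp

lemma (in group) exp_of_derived_consistent:
  assumes H: "subgroup H G" and T: "subgroup T G" "T \<subseteq> H"
  shows "(derived (G\<lparr>carrier := H\<rparr>) ^^ j) T = (derived G ^^ j) T"
proof (induction j)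
  case (Suc j)
  have "(derived G ^^ j) T \<subseteq> H" using exp_of_derived_subset[OF T(1)] T(2) by blast
  thus ?case using Suc derived_consistent[OF _ H] by simp
qed simp

lemma (in group) solvable_restrict_iff:
  assumes H: "subgroup H G"
  shows "solvable (G\<lparr>carrier := H\<rparr>) \<longleftrightarrow> (\<exists>j. (derived G ^^ j) H = {\<one>})"
  using group.solvable_iff_trivial_derived_seq[OF subgroup_imp_group[OF H]]
    exp_of_derived_consistent[OF H H order_refl] by simp

lemma (in group) factor_hom:
  assumes B: "subgroup B G" and A: "A \<lhd> G" "A \<subseteq> B"
  shows "group_hom (G\<lparr>carrier := B\<rparr>) (G\<lparr>carrier := B\<rparr> Mod A) (\<lambda>x. A #> x)"
    and "(\<lambda>x. A #> x) ` B = carrier (G\<lparr>carrier := B\<rparr> Mod A)"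
proof -
  have n: "A \<lhd> G\<lparr>carrier := B\<rparr>" using B A by (intro normal_restrict_supergroup)
  show "group_hom (G\<lparr>carrier := B\<rparr>) (G\<lparr>carrier := B\<rparr> Mod A) (\<lambda>x. A #> x)"
    using normal.r_coset_hom_Mod[OF n] subgroup_imp_group[OF B] normal.factorgroup_is_group[OF n]
    by (simp add: group_hom_def group_hom_axioms_def)
  show "(\<lambda>x. A #> x) ` B = carrier (G\<lparr>carrier := B\<rparr> Mod A)"
    by (simp add: carrier_FactGroup)
qed

text \<open>A finite subset of the image lifts to a finite subset of the source, and generation
  commutes with homomorphisms.\<close>

lemma group_locally_image:
  assumes h: "group_hom G H h" and surj: "h ` carrier G = carrier H"
  shows "group_locally P H \<longleftrightarrow>
    (\<forall>F. finite F \<and> F \<subseteq> carrier G \<longrightarrow> P (H\<lparr>carrier := h ` generate G F\<rparr>))"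
proof -
  interpret group_hom G H h by (rule h)
  have eq: "subgroup_generated H (h ` F) = H\<lparr>carrier := h ` generate G F\<rparr>" if "F \<subseteq> carrier G" for F
  proof -
    have "carrier H \<inter> h ` F = h ` F" using that by auto
    thus ?thesis using generate_img[OF that] by (simp add: subgroup_generated_def)
  qed
  show ?thesis unfolding group_locally_def
  proof (intro iffI allI impI)
    fix F assume *: "\<forall>S. finite S \<and> S \<subseteq> carrier H \<longrightarrow> P (subgroup_generated H S)"
      and F: "finite F \<and> F \<subseteq> carrier G"
    have "h ` F \<subseteq> carrier H" using F surj by blast
    thus "P (H\<lparr>carrier := h ` generate G F\<rparr>)" using * F eq[of F] by (metis finite_imageI)
  next
    fix S assume *: "\<forall>F. finite F \<and> F \<subseteq> carrier G \<longrightarrow> P (H\<lparr>carrier := h ` generate G F\<rparr>)"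
      and S: "finite S \<and> S \<subseteq> carrier H"
    then obtain F where "F \<subseteq> carrier G" "finite F" "S = h ` F"
      using finite_subset_image[of S h "carrier G"] surj by blast
    thus "P (subgroup_generated H S)" using * eq by simp
  qed
qed

lemma (in group) coset_eq_self_iff:
  assumes "subgroup A G" "x \<in> carrier G"
  shows "A #> x = A \<longleftrightarrow> x \<in> A"
  using assms coset_join1 coset_join2 by (metis rcos_self)

lemma (in group) locally_soluble_factor_iff:
  assumes B: "subgroup B G" and A: "A \<lhd> G" "A \<subseteq> B"
  shows "locally_soluble (G\<lparr>carrier := B\<rparr> Mod A) \<longleftrightarrow> loc_soluble_over G B A"
proof -
  let ?H = "G\<lparr>carrier := B\<rparr>" and ?Q = "G\<lparr>carrier := B\<rparr> Mod A"
  note h = factor_hom[OF B A]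
  interpret h: group_hom ?H ?Q "\<lambda>x. A #> x" by (rule h)
  have sA: "subgroup A G" using A by (simp add: normal_imp_subgroup)
  have Bc: "B \<subseteq> carrier G" using B by (rule subgroup.subset)
  have "solvable (?Q\<lparr>carrier := (\<lambda>x. A #> x) ` generate ?H F\<rparr>) \<longleftrightarrow>
      (\<exists>j. (derived G ^^ j) (generate G F) \<subseteq> A)" if F: "F \<subseteq> B" for F
  proof -
    have s: "subgroup (generate ?H F) ?H" using F by (intro h.G.generate_is_subgroup) simp
    have gen: "generate ?H F = generate G F" by (rule generate_consistent[OF F B])
    have sg: "subgroup (generate G F) G" using F Bc by (intro generate_is_subgroup) auto
    have gB: "generate G F \<subseteq> B" by (rule generate_subgroup_incl[OF F B])
    have "solvable (?Q\<lparr>carrier := (\<lambda>x. A #> x) ` generate ?H F\<rparr>) \<longleftrightarrow>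
        (\<exists>j. (derived ?Q ^^ j) ((\<lambda>x. A #> x) ` generate ?H F) = {\<one>\<^bsub>?Q\<^esub>})"
      by (rule h.H.solvable_restrict_iff[OF h.subgroup_img_is_subgroup[OF s]])
    also have "\<dots> \<longleftrightarrow> (\<exists>j. (\<lambda>x. A #> x) ` ((derived G ^^ j) (generate G F)) = {A})"
      using h.exp_of_derived_img[OF subgroup.subset[OF s]] exp_of_derived_consistent[OF B sg gB]
      by (simp add: gen)
    also have "\<dots> \<longleftrightarrow> (\<exists>j. (derived G ^^ j) (generate G F) \<subseteq> A)"
    proof (rule ex_cong1)
      fix j
      let ?D = "(derived G ^^ j) (generate G F)"
      have D: "subgroup ?D G" using sg by (rule exp_of_derived_is_subgroup)
      have "(\<lambda>x. A #> x) ` ?D = {A} \<longleftrightarrow> (\<forall>x\<in>?D. A #> x = A)"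
        using subgroup.one_closed[OF D] by (auto simp: image_def)
      also have "\<dots> \<longleftrightarrow> ?D \<subseteq> A" using coset_eq_self_iff[OF sA] subgroup.mem_carrier[OF D] by blast
      finally show "(\<lambda>x. A #> x) ` ?D = {A} \<longleftrightarrow> ?D \<subseteq> A" .
    qed
    finally show ?thesis .
  qed
  thus ?thesis
    unfolding locally_soluble_def loc_soluble_over_def using group_locally_image[OF h(1), of solvable] h(2) by auto
qed

lemma (in group) locally_finite_factor_iff:
  assumes B: "subgroup B G" and A: "A \<lhd> G" "A \<subseteq> B"
  shows "locally_finite (G\<lparr>carrier := B\<rparr> Mod A) \<longleftrightarrow> loc_finite_over G B A"
proof -
  note h = factor_hom[OF B A]
  show ?thesis
    unfolding locally_finite_def loc_finite_over_def
    using group_locally_image[OF h(1), of "\<lambda>H. finite (carrier H)"] h(2) generate_consistent[OF _ B] by auto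
qed

lemma (in group) ls_lf_series_iff:
  "ls_lf_series G r C \<longleftrightarrow> ascending_normal_series G r C \<and>
     (\<forall>a b. successor_in r a b \<longrightarrow> loc_soluble_over G (C b) (C a) \<or> loc_finite_over G (C b) (C a))"
proof -
  have "(locally_soluble (G\<lparr>carrier := C b\<rparr> Mod C a) \<longleftrightarrow> loc_soluble_over G (C b) (C a)) \<and>
      (locally_finite (G\<lparr>carrier := C b\<rparr> Mod C a) \<longleftrightarrow> loc_finite_over G (C b) (C a))"
    if "ascending_normal_series G r C" "successor_in r a b" for a b
    using that locally_soluble_factor_iff[of "C b" "C a"] locally_finite_factor_iff[of "C b" "C a"]
    by (auto simp: ascending_normal_series_def successor_in_def normal_imp_subgroup)
  thus ?thesis unfolding ls_lf_series_def by blast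
qed

section \<open>Series of subgroups, of images, and a series with three factors\<close>

lemma (in group) has_ls_lf_series_subgroup:
  assumes H: "subgroup H G" and S: "has_ls_lf_series G"
  shows "has_ls_lf_series (G\<lparr>carrier := H\<rparr>)"
proof -
  let ?H = "G\<lparr>carrier := H\<rparr>"
  interpret H: group ?H by (rule subgroup_imp_group[OF H])
  from S obtain r :: "'a set rel" and C where rC: "ls_lf_series G r C" by (auto simp: has_ls_lf_series_def)
  have A: "ascending_normal_series G r C"
    and F: "\<And>a b. successor_in r a b \<Longrightarrow> loc_soluble_over G (C b) (C a) \<or> loc_finite_over G (C b) (C a)"
    using rC unfolding ls_lf_series_iff by blast+
  have Hc: "H \<subseteq> carrier G" using H by (rule subgroup.subset)
  have "ascending_normal_series ?H r (\<lambda>a. C a \<inter> H)"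
    unfolding ascending_normal_series_def
  proof (intro conjI)
    show "Well_order r" using A by (simp add: ascending_normal_series_def)
    show "\<forall>a\<in>Field r. C a \<inter> H \<lhd> ?H"
      using A normal_Int_subgroup[OF H] by (simp add: ascending_normal_series_def)
    show "\<forall>a\<in>Field r. underS r a = {} \<longrightarrow> C a \<inter> H = {\<one>\<^bsub>?H\<^esub>}"
      using A subgroup.one_closed[OF H] by (auto simp: ascending_normal_series_def)
    obtain b where b: "b \<in> Field r" "under r b = Field r" "C b = carrier G"
      using A by (auto simp: ascending_normal_series_def)
    have "C b \<inter> H = carrier ?H" using b(3) Hc by auto
    thus "\<exists>b\<in>Field r. under r b = Field r \<and> C b \<inter> H = carrier ?H" using b by blast
    show "\<forall>a b. successor_in r a b \<longrightarrow> C a \<inter> H \<subseteq> C b \<inter> H"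
      using A unfolding ascending_normal_series_def by (meson Int_mono order_refl)
    show "\<forall>b. limit_in r b \<longrightarrow> C b \<inter> H = (\<Union>a\<in>underS r b. C a \<inter> H)"
      using A by (simp add: ascending_normal_series_def)
  qed
  moreover have "loc_soluble_over ?H (C b \<inter> H) (C a \<inter> H)" if s: "loc_soluble_over G (C b) (C a)" for a b
    unfolding loc_soluble_over_def
  proof (intro allI impI)
    fix F assume F: "finite F \<and> F \<subseteq> C b \<inter> H"
    then obtain j where j: "(derived G ^^ j) (generate G F) \<subseteq> C a"
      using s by (auto simp: loc_soluble_over_def)
    have FH: "F \<subseteq> H" using F by auto
    have sg: "subgroup (generate G F) G" using FH Hc by (intro generate_is_subgroup) auto
    have gH: "generate G F \<subseteq> H" by (rule generate_subgroup_incl[OF FH H])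
    have "(derived ?H ^^ j) (generate ?H F) = (derived G ^^ j) (generate G F)"
      using exp_of_derived_consistent[OF H sg gH] generate_consistent[OF FH H] by simp
    thus "\<exists>j. (derived ?H ^^ j) (generate ?H F) \<subseteq> C a \<inter> H"
      using j exp_of_derived_subset[OF sg, of j] gH by (intro exI[of _ j]) auto
  qed
  moreover have "loc_finite_over ?H (C b \<inter> H) (C a \<inter> H)"
    if s: "loc_finite_over G (C b) (C a)" and Ca: "C a \<subseteq> carrier G" for a b
    unfolding loc_finite_over_def
  proof (intro allI impI)
    fix F assume F: "finite F \<and> F \<subseteq> C b \<inter> H"
    hence fin: "finite ((\<lambda>x. C a #> x) ` generate G F)" using s by (auto simp: loc_finite_over_def)
    have FH: "F \<subseteq> H" using F by auto
    have gH: "generate G F \<subseteq> H" by (rule generate_subgroup_incl[OF FH H])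
    have "(C a \<inter> H) #> x = (C a #> x) \<inter> H" if x: "x \<in> H" for x
    proof
      show "(C a \<inter> H) #> x \<subseteq> (C a #> x) \<inter> H"
        using x subgroup.m_closed[OF H] by (auto simp: r_coset_def)
      show "(C a #> x) \<inter> H \<subseteq> (C a \<inter> H) #> x"
      proof
        fix y assume y: "y \<in> (C a #> x) \<inter> H"
        obtain z where z: "z \<in> C a" "y = z \<otimes> x" using y by (auto simp: r_coset_def)
        have "z \<in> carrier G" "x \<in> carrier G" using z(1) x Ca Hc by auto
        hence "z = y \<otimes> inv x" using z(2) by (simp add: m_assoc)
        hence "z \<in> H" using y x H by (simp add: subgroup.m_closed subgroup.m_inv_closed)
        thus "y \<in> (C a \<inter> H) #> x" using z by (auto simp: r_coset_def)
      qed
    qed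
    hence "(\<lambda>x. (C a \<inter> H) #>\<^bsub>?H\<^esub> x) ` generate ?H F = (\<lambda>T. T \<inter> H) ` (\<lambda>x. C a #> x) ` generate G F"
      using generate_consistent[OF FH H] gH by (auto simp: image_image intro!: image_cong)
    thus "finite ((\<lambda>x. (C a \<inter> H) #>\<^bsub>?H\<^esub> x) ` generate ?H F)" using fin by simp
  qed
  moreover have "C a \<subseteq> carrier G" if "successor_in r a b" for a b
    using A that normal_imp_subgroup[of "C a" G] subgroup.subset[of "C a" G]
    by (simp add: ascending_normal_series_def successor_in_def)
  ultimately have "ls_lf_series ?H r (\<lambda>a. C a \<inter> H)" using F unfolding H.ls_lf_series_iff by blast
  thus ?thesis by (rule has_ls_lf_seriesI)
qed

text \<open>The terms are pushed forward along the same well-order. Its index set consists of sets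
  of elements of the source, and \<open>has_ls_lf_seriesI\<close> moves it to the target. Distinct
  terms may get the same image, which the definition of a series allows.\<close>

lemma has_ls_lf_series_image:
  assumes h: "group_hom G H h" and surj: "h ` carrier G = carrier H" and S: "has_ls_lf_series G"
  shows "has_ls_lf_series H"
proof -
  interpret group_hom G H h by (rule h)
  from S obtain r :: "'a set rel" and C where rC: "ls_lf_series G r C" by (auto simp: has_ls_lf_series_def)
  have A: "ascending_normal_series G r C"
    and F: "\<And>a b. successor_in r a b \<Longrightarrow> loc_soluble_over G (C b) (C a) \<or> loc_finite_over G (C b) (C a)"
    using rC unfolding G.ls_lf_series_iff by blast+
  have Cc: "C a \<subseteq> carrier G" if "a \<in> Field r" for a
    using A that normal_imp_subgroup[of "C a" G] subgroup.subset[of "C a" G]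
    by (simp add: ascending_normal_series_def)
  have "ascending_normal_series H r (\<lambda>a. h ` C a)"
    unfolding ascending_normal_series_def
  proof (intro conjI)
    show "Well_order r" using A by (simp add: ascending_normal_series_def)
    show "\<forall>a\<in>Field r. h ` C a \<lhd> H"
      using A normal.surj_hom_normal_subgroup[OF _ h surj] by (simp add: ascending_normal_series_def)
    show "\<forall>a\<in>Field r. underS r a = {} \<longrightarrow> h ` C a = {\<one>\<^bsub>H\<^esub>}"
      using A by (simp add: ascending_normal_series_def)
    obtain b where b: "b \<in> Field r" "under r b = Field r" "C b = carrier G"
      using A by (auto simp: ascending_normal_series_def)
    thus "\<exists>b\<in>Field r. under r b = Field r \<and> h ` C b = carrier H" using surj by auto
    show "\<forall>a b. successor_in r a b \<longrightarrow> h ` C a \<subseteq> h ` C b"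
      using A by (simp add: ascending_normal_series_def image_mono)
    show "\<forall>b. limit_in r b \<longrightarrow> h ` C b = (\<Union>a\<in>underS r b. h ` C a)"
      using A by (simp add: ascending_normal_series_def image_UN)
  qed
  moreover have "loc_soluble_over H (h ` C b) (h ` C a)"
    if s: "loc_soluble_over G (C b) (C a)" and b: "b \<in> Field r" for a b
    unfolding loc_soluble_over_def
  proof (intro allI impI)
    fix F assume "finite F \<and> F \<subseteq> h ` C b"
    then obtain E where E: "E \<subseteq> C b" "finite E" "F = h ` E" using finite_subset_image[of F h "C b"] by blast
    then obtain j where j: "(derived G ^^ j) (generate G E) \<subseteq> C a"
      using s by (auto simp: loc_soluble_over_def)
    have Ec: "E \<subseteq> carrier G" using E Cc[OF b] by auto
    have "(derived H ^^ j) (generate H F) = h ` (derived G ^^ j) (generate G E)"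
      using exp_of_derived_img[OF G.generate_incl[OF Ec]] generate_img[OF Ec] E(3) by simp
    thus "\<exists>j. (derived H ^^ j) (generate H F) \<subseteq> h ` C a" using j by (intro exI[of _ j]) auto
  qed
  moreover have "loc_finite_over H (h ` C b) (h ` C a)"
    if s: "loc_finite_over G (C b) (C a)" and ab: "a \<in> Field r" "b \<in> Field r" for a b
    unfolding loc_finite_over_def
  proof (intro allI impI)
    fix F assume "finite F \<and> F \<subseteq> h ` C b"
    then obtain E where E: "E \<subseteq> C b" "finite E" "F = h ` E" using finite_subset_image[of F h "C b"] by blast
    hence fin: "finite ((\<lambda>x. C a #>\<^bsub>G\<^esub> x) ` generate G E)" using s by (auto simp: loc_finite_over_def)
    have Ec: "E \<subseteq> carrier G" using E Cc[OF ab(2)] by auto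
    have "h ` C a #>\<^bsub>H\<^esub> h x = h ` (C a #>\<^bsub>G\<^esub> x)" if "x \<in> carrier G" for x
      using that Cc[OF ab(1)] by (force simp: r_coset_def)
    hence "(\<lambda>y. h ` C a #>\<^bsub>H\<^esub> y) ` generate H F = (\<lambda>T. h ` T) ` (\<lambda>x. C a #>\<^bsub>G\<^esub> x) ` generate G E"
      using generate_img[OF Ec] G.generate_incl[OF Ec] unfolding E(3)
      by (auto simp: image_image intro!: image_cong)
    thus "finite ((\<lambda>y. h ` C a #>\<^bsub>H\<^esub> y) ` generate H F)" using fin by simp
  qed
  ultimately have "ls_lf_series H r (\<lambda>a. h ` C a)"
    using F unfolding H.ls_lf_series_iff successor_in_def by blast
  thus ?thesis by (rule has_ls_lf_seriesI)
qed

text \<open>Four terms are indexed by the natural numbers below 4; every nonzero index there is a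
  successor, so the limit condition is vacuous.\<close>

lemma (in group) has_ls_lf_series_three_step:
  assumes W: "W \<lhd> G" and D: "D \<lhd> G" and WD: "W \<subseteq> D"
    and "loc_soluble_over G W {\<one>}" "loc_finite_over G D W" "loc_soluble_over G (carrier G) D"
  shows "has_ls_lf_series G"
proof -
  let ?r = "natLeq_on 4"
  define C where "C i = (if i = 0 then {\<one>} else if i = 1 then W else if i = 2 then D else carrier G)" for i :: nat
  have s: "successor_in ?r a b \<longleftrightarrow> b = Suc a \<and> b < 4" for a b
  proof -
    have "underS ?r b = {i. i < b \<and> b < 4}" by (auto simp: underS_def)
    moreover have "under ?r a = {i. i \<le> a \<and> a < 4}" by (auto simp: under_def)
    moreover have "{i. i < b \<and> b < 4} = {i. i \<le> a \<and> a < 4} \<longleftrightarrow> b = Suc a" if "a < 4" "b < 4"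
    proof
      assume *: "{i. i < b \<and> b < 4} = {i. i \<le> a \<and> a < 4}"
      have "a \<in> {i. i < b \<and> b < 4}" unfolding * using that by simp
      moreover have "b - 1 \<in> {i. i \<le> a \<and> a < 4}" unfolding *[symmetric] using that calculation by simp
      ultimately show "b = Suc a" by auto
    qed (use that in auto)
    ultimately show ?thesis by (auto simp: successor_in_def Field_natLeq_on)
  qed
  have sW: "subgroup W G" and sD: "subgroup D G" using W D by (simp_all add: normal_imp_subgroup)
  have "ascending_normal_series G ?r C"
    unfolding ascending_normal_series_def
  proof (intro conjI)
    show "Well_order ?r" by (rule natLeq_on_Well_order)
    show "\<forall>a\<in>Field ?r. C a \<lhd> G" using W D one_is_normal normal_self by (simp add: C_def)
    have "underS ?r b \<noteq> {}" if "0 < b" "b < 4" for b using that by (auto simp: underS_def intro!: exI[of _ 0])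
    thus "\<forall>a\<in>Field ?r. underS ?r a = {} \<longrightarrow> C a = {\<one>}"
      by (auto simp: Field_natLeq_on C_def)
    have "under ?r 3 = Field ?r" by (auto simp: under_def Field_natLeq_on)
    thus "\<exists>b\<in>Field ?r. under ?r b = Field ?r \<and> C b = carrier G"
      by (intro bexI[of _ 3]) (auto simp: C_def Field_natLeq_on)
    show "\<forall>a b. successor_in ?r a b \<longrightarrow> C a \<subseteq> C b"
      using subgroup.one_closed[OF sW] subgroup.subset[OF sD] WD by (auto simp: s C_def)
    have "\<not> limit_in ?r b" for b
    proof
      assume l: "limit_in ?r b"
      then obtain a where "a \<in> underS ?r b" by (auto simp: limit_in_def)
      hence "successor_in ?r (b - 1) b" unfolding s by (auto simp: underS_def)
      thus False using l by (auto simp: limit_in_def)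
    qed
    thus "\<forall>b. limit_in ?r b \<longrightarrow> C b = (\<Union>a\<in>underS ?r b. C a)" by blast
  qed
  moreover have "loc_soluble_over G (C b) (C a) \<or> loc_finite_over G (C b) (C a)" if "successor_in ?r a b" for a b
  proof -
    have "a = 0 \<or> a = 1 \<or> a = 2" "b = Suc a" using that by (auto simp: s)
    thus ?thesis using assms(4-6) by (auto simp: C_def)
  qed
  ultimately have "ls_lf_series G ?r C" by (simp add: ls_lf_series_iff)
  thus ?thesis by (rule has_ls_lf_seriesI)
qed

context group
begin

section \<open>Descent along a series\<close>

lemma normal_generate_Un:
  assumes "M \<lhd> G" "D \<lhd> G" shows "generate G (M \<union> D) \<lhd> G"
proof (rule normal_generateI)
  show "M \<union> D \<subseteq> carrier G"
    using assms[THEN normal_imp_subgroup, THEN subgroup.subset] by (rule Un_least)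
  show "g \<otimes> h \<otimes> inv g \<in> M \<union> D" if "h \<in> M \<union> D" "g \<in> carrier G" for g h
    using that normal.inv_op_closed2[OF assms(1)] normal.inv_op_closed2[OF assms(2)] by auto
qed

lemma exp_of_derived_is_normal: "K \<lhd> G \<Longrightarrow> (derived G ^^ j) K \<lhd> G"
  by (induction j) (simp_all add: derived_is_normal)

text \<open>The set \<open>derived_set\<close> consists of the elements x y x^-1 y^-1, which are
  commutators of \<open>inv x\<close> and \<open>inv y\<close> in the present convention.\<close>

lemma derived_subsetI:
  assumes K: "subgroup K G" and M: "subgroup M G" and c: "\<And>x y. x \<in> K \<Longrightarrow> y \<in> K \<Longrightarrow> comm x y \<in> M"
  shows "derived G K \<subseteq> M"
  unfolding derived_def
proof (rule generate_subgroup_incl[OF _ M])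
  have "x \<otimes> y \<otimes> inv x \<otimes> inv y \<in> M" if "x \<in> K" "y \<in> K" for x y
    using c[of "inv x" "inv y"] that subgroup.m_inv_closed[OF K] subgroup.mem_carrier[OF K]
    by (simp add: group_commutator_def)
  thus "derived_set G K \<subseteq> M" by auto
qed

lemma comm_in_derived:
  assumes K: "subgroup K G" and xy: "x \<in> K" "y \<in> K"
  shows "comm x y \<in> derived G K"
proof -
  have "inv x \<otimes> inv y \<otimes> inv (inv x) \<otimes> inv (inv y) \<in> derived_set G K"
    using subgroup.m_inv_closed[OF K] xy by blast
  thus ?thesis using xy subgroup.mem_carrier[OF K] unfolding derived_def
    by (auto simp: group_commutator_def intro: generate.incl)
qed

text \<open>\<open>P K\<close> stands for a property of the quotient by \<open>K\<close>: nilpotency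
  in one use, finiteness in the other. The conclusion is the property of the group itself.\<close>

theorem ls_lf_series_descent:
  fixes P :: "'a set \<Rightarrow> bool"
  assumes S: "has_ls_lf_series G" and top: "P (carrier G)"
    and fg: "\<And>K. K \<lhd> G \<Longrightarrow> P K \<Longrightarrow> fin_gen G K"
    and fin: "\<And>K M. K \<lhd> G \<Longrightarrow> M \<lhd> G \<Longrightarrow> M \<subseteq> K \<Longrightarrow> finite ((\<lambda>x. M #> x) ` K) \<Longrightarrow> P K \<Longrightarrow> P M"
    and ab: "\<And>K M. K \<lhd> G \<Longrightarrow> M \<lhd> G \<Longrightarrow> M \<subseteq> K \<Longrightarrow> derived G K \<subseteq> M \<Longrightarrow> P K \<Longrightarrow> P M"
  shows "P {\<one>}"
proof -
  \<comment> \<open>A soluble factor \<open>K/M\<close> is cut into abelian ones by the subgroups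
    generated by \<open>M\<close> and the derived subgroups of \<open>K\<close>.\<close>
  have sol: "P M" if K: "K \<lhd> G" and M: "M \<lhd> G" "M \<subseteq> K" and j: "(derived G ^^ j) K \<subseteq> M" and PK: "P K" for K M j
  proof -
    define L where "L i = generate G (M \<union> (derived G ^^ i) K)" for i
    have sK: "subgroup K G" and sM: "subgroup M G" using K M by (simp_all add: normal_imp_subgroup)
    have nL: "L i \<lhd> G" for i unfolding L_def
      using M(1) exp_of_derived_is_normal[OF K] by (rule normal_generate_Un)
    have sL: "subgroup (L i) G" for i using nL by (rule normal_imp_subgroup)
    have L0: "L 0 = K"
      using generateI[OF sK, of K] M(2) by (simp add: L_def Un_absorb1)
    have Lj: "L j = M"
      using generateI[OF sM, of M] j by (simp add: L_def Un_absorb2)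
    have sub: "M \<union> (derived G ^^ i) K \<subseteq> L i" for i unfolding L_def by (intro subset_generate order_refl)
    have "P (L i)" for i
    proof (induction i)
      case 0 thus ?case using L0 PK by simp
    next
      case (Suc i)
      have sD: "subgroup ((derived G ^^ i) K) G" using sK by (rule exp_of_derived_is_subgroup)
      have nLS: "normal_in G (L (Suc i)) (carrier G)" and nM: "normal_in G M (carrier G)"
        using nL M(1) by (simp_all add: normal_iff_normal_in[symmetric])
      have c: "M \<union> (derived G ^^ i) K \<subseteq> carrier G"
        using subgroup.subset[OF sM] subgroup.subset[OF sD] by auto
      have "comm x y \<in> L (Suc i)" if "x \<in> M \<union> (derived G ^^ i) K" "y \<in> M \<union> (derived G ^^ i) K" for x y
      proof (cases "x \<in> M \<or> y \<in> M")
        case True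
        hence "comm x y \<in> M" using normal_in_comm[OF nM] that c by blast
        thus ?thesis using sub by blast
      next
        case False
        hence "comm x y \<in> derived G ((derived G ^^ i) K)" using that comm_in_derived[OF sD] by blast
        thus ?thesis using sub[of "Suc i"] by auto
      qed
      hence "comm x y \<in> L (Suc i)" if "x \<in> L i" "y \<in> L i" for x y
        using comm_generate[OF nLS c c] that unfolding L_def by blast
      hence "derived G (L i) \<subseteq> L (Suc i)" using sL by (intro derived_subsetI) auto
      moreover have "L (Suc i) \<subseteq> L i"
        unfolding L_def using derived_incl[OF order_refl sD] by (intro mono_generate) auto
      ultimately show ?case using ab[OF nL nL _ _ Suc] by blast
    qed
    thus ?thesis using Lj by metis
  qed
  from S obtain r :: "'a set rel" and C where rC: "ls_lf_series G r C" by (auto simp: has_ls_lf_series_def)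
  have A: "ascending_normal_series G r C"
    and F: "\<And>a b. successor_in r a b \<Longrightarrow> loc_soluble_over G (C b) (C a) \<or> loc_finite_over G (C b) (C a)"
    using rC unfolding ls_lf_series_iff by blast+
  have nC: "C a \<lhd> G" if "a \<in> Field r" for a using A that by (simp add: ascending_normal_series_def)
  note mono = ascending_normal_series_mono[OF A]
  have wo: "Well_order r" using A by (simp add: ascending_normal_series_def)
  then interpret w: wo_rel r by (simp add: wo_rel_def)
  let ?B = "{a \<in> Field r. P (C a)}"
  have B: "?B \<subseteq> Field r" "?B \<noteq> {}" using A top by (auto simp: ascending_normal_series_def)
  define a where "a = w.minim ?B"
  have a: "a \<in> Field r" "P (C a)" using w.minim_in[OF B] by (auto simp: a_def)
  have least: "\<not> P (C b)" if "b \<in> underS r a" for b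
  proof
    assume Pb: "P (C b)"
    have b: "(b, a) \<in> r" "b \<noteq> a" using that by (auto simp: underS_def)
    hence "b \<in> ?B" using Pb by (auto simp: Field_def)
    hence "(a, b) \<in> r" using w.minim_least[OF B(1)] by (auto simp: a_def)
    thus False using b w.ANTISYM by (auto dest: antisymD)
  qed
  obtain E where E: "finite E" "E \<subseteq> carrier G" "C a = generate G E"
    using fg[OF nC[OF a(1)] a(2)] by (auto simp: fin_gen_def)
  have EC: "E \<subseteq> C a" unfolding E(3) by (intro subset_generate order_refl)
  consider "underS r a = {}" | b where "successor_in r b a" | "limit_in r a"
    using a(1) by (auto simp: limit_in_def)
  thus ?thesis
  proof cases
    case 1
    thus ?thesis using a A by (auto simp: ascending_normal_series_def)
  next
    case (2 b)
    have b: "b \<in> Field r" "underS r a = under r b" using 2 by (auto simp: successor_in_def)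
    hence ba: "b \<in> underS r a" using w.REFL by (simp add: Refl_under_in)
    have sub: "C b \<subseteq> C a" using A 2 by (auto simp: ascending_normal_series_def)
    \<comment> \<open>The finite set \<open>E\<close> generates all of \<open>C a\<close>, so the
      local condition applied to \<open>E\<close> speaks about the whole factor.\<close>
    have "P (C b)"
    proof (cases "loc_finite_over G (C a) (C b)")
      case True
      hence "finite ((\<lambda>x. C b #> x) ` C a)" using E EC unfolding loc_finite_over_def by metis
      thus ?thesis using fin nC a b sub by blast
    next
      case False
      hence "loc_soluble_over G (C a) (C b)" using F 2 by blast
      then obtain j where "(derived G ^^ j) (C a) \<subseteq> C b" using E EC unfolding loc_soluble_over_def by metis
      thus ?thesis using sol nC a b sub by blast
    qed
    thus ?thesis using least ba by blast
  next
    case 3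
    hence u: "C a = (\<Union>b\<in>underS r a. C b)" "underS r a \<noteq> {}"
      using A by (auto simp: ascending_normal_series_def limit_in_def)
    have "\<exists>b\<in>underS r a. E' \<subseteq> C b" if "finite E'" "E' \<subseteq> C a" for E'
      using that
    proof (induction E')
      case empty thus ?case using u(2) by blast
    next
      case (insert x E')
      then obtain b where b: "b \<in> underS r a" "E' \<subseteq> C b" by blast
      obtain c where c: "c \<in> underS r a" "x \<in> C c" using insert u(1) by blast
      have "b \<in> Field r" "c \<in> Field r" using b c by (auto simp: underS_def Field_def)
      hence "(b, c) \<in> r \<or> (c, b) \<in> r" using w.TOTALS by blast
      thus ?case using mono[of b c] mono[of c b] b c by blast
    qed
    then obtain b where b: "b \<in> underS r a" "E \<subseteq> C b" using E(1) EC by blast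
    have bF: "b \<in> Field r" using b by (auto simp: underS_def Field_def)
    have "C a \<subseteq> C b" unfolding E(3)
      using b(2) normal_imp_subgroup[OF nC[OF bF]] by (rule generate_subgroup_incl)
    moreover have "C b \<subseteq> C a" using u(1) b(1) by blast
    ultimately have "C b = C a" by auto
    thus ?thesis using least[OF b(1)] a(2) by simp
  qed
qed

end

section \<open>Groups with a series generated by Engel elements\<close>

text \<open>The counterpart of embedding the quotient by an intersection in the product of the two
  quotients.\<close>

lemma rel_center_Int: "rel_center G (A \<inter> B) S q = rel_center G A S q \<inter> rel_center G B S q"
  by (induction q) auto

lemma finite_image_factor:
  assumes "finite (f ` A)" "\<And>x y. x \<in> A \<Longrightarrow> y \<in> A \<Longrightarrow> f x = f y \<Longrightarrow> g x = g y"
  shows "finite (g ` A)"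
proof -
  have "g x = g (inv_into A f (f x))" if "x \<in> A" for x
    using assms(2)[OF that inv_into_into[of "f x" f A]] that f_inv_into_f[of "f x" f A] by auto
  hence "g ` A \<subseteq> (g \<circ> inv_into A f) ` (f ` A)" by force
  thus ?thesis using assms(1) finite_subset by blast
qed

section \<open>Engel elements and central series under homomorphisms\<close>

context group_hom
begin

lemma hom_group_commutator:
  assumes "x \<in> carrier G" "y \<in> carrier G"
  shows "h (group_commutator G x y) = group_commutator H (h x) (h y)"
  using assms by (simp add: group_commutator_def)

lemma hom_iterated_commutator:
  assumes "x \<in> carrier G" "y \<in> carrier G"
  shows "h (iterated_commutator G x n y) = iterated_commutator H (h x) n (h y)"
  using assms by (induction n) (simp_all add: hom_group_commutator)

lemma left_engel_image:
  assumes surj: "h ` carrier G = carrier H" and x: "left_engel G n x"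
  shows "left_engel H n (h x)"
  unfolding left_engel_def
proof (intro conjI ballI)
  have xc: "x \<in> carrier G" using x by (simp add: left_engel_def)
  thus "h x \<in> carrier H" by simp
  fix g assume "g \<in> carrier H"
  then obtain y where y: "y \<in> carrier G" "g = h y" using surj by blast
  have "iterated_commutator H g n (h x) = h (iterated_commutator G y n x)"
    using y xc by (simp add: hom_iterated_commutator)
  thus "iterated_commutator H g n (h x) = \<one>\<^bsub>H\<^esub>" using x y by (simp add: left_engel_def)
qed

lemma rel_center_image:
  assumes S: "S \<subseteq> carrier G" and x: "x \<in> carrier G" "x \<in> rel_center G D S q"
  shows "h x \<in> rel_center H (h ` D) (h ` S) q"
  using x
proof (induction q arbitrary: x)
  case (Suc q)
  have "group_commutator H (h x) (h g) \<in> rel_center H (h ` D) (h ` S) q" if g: "g \<in> S" for g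
  proof -
    have gc: "g \<in> carrier G" using g S by auto
    thus ?thesis using Suc.IH[of "group_commutator G x g"] Suc.prems g by (simp add: hom_group_commutator)
  qed
  thus ?case using Suc.prems by auto
qed auto

lemma rel_center_preimage:
  assumes S: "S \<subseteq> carrier G" and x: "x \<in> carrier G" "h x \<in> rel_center H D (h ` S) q"
  shows "x \<in> rel_center G {y \<in> carrier G. h y \<in> D} S q"
  using x
proof (induction q arbitrary: x)
  case (Suc q)
  have "group_commutator G x g \<in> rel_center G {y \<in> carrier G. h y \<in> D} S q" if g: "g \<in> S" for g
  proof -
    have gc: "g \<in> carrier G" using g S by auto
    thus ?thesis using Suc.IH[of "group_commutator G x g"] Suc.prems g by (simp add: hom_group_commutator)
  qed
  thus ?case using Suc.prems by auto
qed auto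

end

context group
begin

lemma quotient_hom:
  assumes "M \<lhd> G"
  shows "group_hom G (G Mod M) (\<lambda>x. M #> x)" "(\<lambda>x. M #> x) ` carrier G = carrier (G Mod M)"
    "{y \<in> carrier G. M #> y \<in> {\<one>\<^bsub>G Mod M\<^esub>}} = M"
proof -
  have M: "subgroup M G" using assms by (rule normal_imp_subgroup)
  show "group_hom G (G Mod M) (\<lambda>x. M #> x)"
    using normal.r_coset_hom_Mod[OF assms] is_group normal.factorgroup_is_group[OF assms]
    by (simp add: group_hom_def group_hom_axioms_def)
  show "(\<lambda>x. M #> x) ` carrier G = carrier (G Mod M)" by (simp add: carrier_FactGroup)
  show "{y \<in> carrier G. M #> y \<in> {\<one>\<^bsub>G Mod M\<^esub>}} = M"
    using coset_eq_self_iff[OF M] subgroup.subset[OF M] by auto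
qed

lemma rel_center_quotient:
  assumes M: "M \<lhd> G"
    and nil: "carrier (G Mod M) \<subseteq> rel_center (G Mod M) {\<one>\<^bsub>G Mod M\<^esub>} (carrier (G Mod M)) c"
  shows "carrier G \<subseteq> rel_center G M (carrier G) c"
proof
  interpret q: group_hom G "G Mod M" "\<lambda>x. M #> x" by (rule quotient_hom[OF M])
  fix x assume x: "x \<in> carrier G"
  have "M #> x \<in> rel_center (G Mod M) {\<one>\<^bsub>G Mod M\<^esub>} ((\<lambda>x. M #> x) ` carrier G) c"
    using nil x unfolding quotient_hom(2)[OF M] by (auto simp: carrier_FactGroup)
  thus "x \<in> rel_center G M (carrier G) c"
    using q.rel_center_preimage[OF order_refl x, of "{\<one>\<^bsub>G Mod M\<^esub>}" c]
    unfolding quotient_hom(3)[OF M] by blast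
qed

text \<open>The Engel generators make \<open>K\<close> hypercentral of finite height; stacking the
  central series of the quotient on top finishes.\<close>

lemma engel_abelian_by_nilpotent:
  assumes E: "finite E" "E \<subseteq> carrier G" "\<And>e. e \<in> E \<Longrightarrow> left_engel G n e" "carrier G = generate G E"
    and K: "K \<lhd> G" and ab: "\<And>x y. x \<in> K \<Longrightarrow> y \<in> K \<Longrightarrow> comm x y = \<one>"
    and nil: "carrier G \<subseteq> rel_center G K (carrier G) c"
  shows "\<exists>c. carrier G \<subseteq> rel_center G {\<one>} (carrier G) c"
proof -
  have nK: "normal_in G K (carrier G)" using K by (simp add: normal_iff_normal_in)
  have fg: "fin_gen G (carrier G)" unfolding fin_gen_def using E by blast
  have gen: "carrier G = generate G (K \<union> E)"
  proof
    show "carrier G \<subseteq> generate G (K \<union> E)" unfolding E(4) by (intro mono_generate) simp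
    show "generate G (K \<union> E) \<subseteq> carrier G" using normal_inD(4)[OF nK] E(2) by (intro generate_incl) simp
  qed
  obtain s where s: "K \<subseteq> rel_center G {\<one>} (carrier G) s"
    using abelian_in_hypercenter[OF fg nK ab E(1-3) gen nil] by blast
  have "carrier G \<subseteq> rel_center G (rel_center G {\<one>} (carrier G) s) (carrier G) c"
    using nil rel_center_mono[OF s order_refl] by blast
  thus ?thesis unfolding rel_center_add[symmetric] by blast
qed

text \<open>\<open>G\<close> acts on \<open>K\<close> by conjugation, and elements inducing the same
  map lie in the same coset of the kernel \<open>C\<close>. There are only finitely many maps from
  \<open>K\<close> to itself.\<close>

lemma finite_index_centralizer:
  assumes K: "K \<lhd> G" "finite K"
  defines "C \<equiv> {x \<in> carrier G. \<forall>k\<in>K. comm x k = \<one>}"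
  shows "C \<lhd> G" "finite (carrier (G Mod C))"
proof -
  have nK: "normal_in G K (carrier G)" using K by (simp add: normal_iff_normal_in)
  have Kc: "K \<subseteq> carrier G" using nK by (rule normal_inD)
  have C_iff: "x \<in> C \<longleftrightarrow> x \<in> carrier G \<and> (\<forall>k\<in>K. x \<otimes> k = k \<otimes> x)" for x
    using Kc comm_eq_one_iff by (auto simp: C_def)
  have sC: "subgroup C G"
  proof (rule subgroupI)
    show "C \<subseteq> carrier G" by (auto simp: C_def)
    have "\<one> \<in> C" using Kc by (auto simp: C_iff)
    thus "C \<noteq> {}" by blast
    show "inv a \<in> C" if "a \<in> C" for a
    proof -
      have "inv a \<otimes> k = k \<otimes> inv a" if k: "k \<in> K" for k
      proof -
        have c: "a \<in> carrier G" "k \<in> carrier G" "a \<otimes> k = k \<otimes> a" using \<open>a \<in> C\<close> k Kc by (auto simp: C_iff)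
        have "inv a \<otimes> k = inv a \<otimes> (k \<otimes> a) \<otimes> inv a" using c(1,2) by (simp add: m_assoc)
        also have "\<dots> = k \<otimes> inv a" unfolding c(3)[symmetric] using c(1,2) by simp
        finally show ?thesis .
      qed
      thus ?thesis using that by (auto simp: C_iff)
    qed
    show "a \<otimes> b \<in> C" if ab: "a \<in> C" "b \<in> C" for a b
    proof -
      have "a \<otimes> b \<otimes> k = k \<otimes> (a \<otimes> b)" if k: "k \<in> K" for k
      proof -
        have c: "a \<in> carrier G" "b \<in> carrier G" "k \<in> carrier G" "a \<otimes> k = k \<otimes> a" "b \<otimes> k = k \<otimes> b"
          using ab k Kc by (auto simp: C_iff)
        have "a \<otimes> b \<otimes> k = a \<otimes> k \<otimes> b" using c(1,2,3) by (simp add: m_assoc c(5))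
        also have "\<dots> = k \<otimes> (a \<otimes> b)" using c(1,2,3) by (simp add: m_assoc c(4))
        finally show ?thesis .
      qed
      thus ?thesis using ab by (auto simp: C_iff)
    qed
  qed
  show nC: "C \<lhd> G"
  proof (rule normal_invI[OF sC])
    fix g x assume g: "g \<in> carrier G" and x: "x \<in> C"
    have "comm (g \<otimes> x \<otimes> inv g) k = \<one>" if k: "k \<in> K" for k
    proof -
      have c: "x \<in> carrier G" "k \<in> carrier G" using x k Kc by (auto simp: C_def)
      have "comm (g \<otimes> x \<otimes> inv g) k = g \<otimes> comm x (inv g \<otimes> k \<otimes> g) \<otimes> inv g"
        using c g by (simp add: word_simps)
      moreover have "inv g \<otimes> k \<otimes> g \<in> K" using normal_inD(6)[OF nK k g] .
      ultimately show ?thesis using x g by (simp add: C_def)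
    qed
    thus "g \<otimes> x \<otimes> inv g \<in> C" using g x by (auto simp: C_def)
  qed
  define f where "f x = (\<lambda>k\<in>K. inv x \<otimes> k \<otimes> x)" for x
  have "f ` carrier G \<subseteq> (\<Pi>\<^sub>E k\<in>K. K)" using normal_inD(6)[OF nK] by (auto simp: f_def)
  moreover have "finite (\<Pi>\<^sub>E k\<in>K. K)" using K(2) by (intro finite_PiE)
  ultimately have "finite (f ` carrier G)" by (rule finite_subset)
  moreover have "C #> x = C #> y" if xy: "x \<in> carrier G" "y \<in> carrier G" "f x = f y" for x y
  proof -
    have "(x \<otimes> inv y) \<otimes> k = k \<otimes> (x \<otimes> inv y)" if k: "k \<in> K" for k
    proof -
      have kc: "k \<in> carrier G" using k Kc by auto
      have "inv x \<otimes> k \<otimes> x = inv y \<otimes> k \<otimes> y" using fun_cong[OF xy(3), of k] k by (simp add: f_def)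
      hence "x \<otimes> (inv x \<otimes> k \<otimes> x) \<otimes> inv y = x \<otimes> (inv y \<otimes> k \<otimes> y) \<otimes> inv y" by simp
      thus ?thesis using xy(1,2) kc by (simp add: m_assoc)
    qed
    hence "x \<otimes> inv y \<in> C" using xy by (auto simp: C_iff)
    hence "x \<in> C #> y" using xy subgroup.rcos_module_rev[OF sC is_group] by blast
    thus ?thesis using repr_independence[OF _ xy(2) sC] by simp
  qed
  ultimately show "finite (carrier (G Mod C))"
    unfolding carrier_FactGroup by (rule finite_image_factor)
qed

text \<open>With \<open>C\<close> the centralizer of \<open>K\<close>, the quotient by
  \<open>C\<close> is finite, hence nilpotent by Baer's theorem. So the quotient by
  \<open>K \<inter> C\<close> is nilpotent, and this intersection is abelian, which reduces to the
  abelian case.\<close>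

lemma engel_finite_by_nilpotent:
  assumes E: "finite E" "E \<subseteq> carrier G" "\<And>e. e \<in> E \<Longrightarrow> left_engel G n e" "carrier G = generate G E"
    and K: "K \<lhd> G" "finite K"
    and nil: "carrier G \<subseteq> rel_center G K (carrier G) c"
  shows "\<exists>c. carrier G \<subseteq> rel_center G {\<one>} (carrier G) c"
proof -
  define C where "C = {x \<in> carrier G. \<forall>k\<in>K. comm x k = \<one>}"
  have C: "C \<lhd> G" "finite (carrier (G Mod C))"
    unfolding C_def using finite_index_centralizer[OF K] by auto
  interpret q: group_hom G "G Mod C" "\<lambda>x. C #> x" by (rule quotient_hom[OF C(1)])
  have "carrier (G Mod C) = generate (G Mod C) ((\<lambda>x. C #> x) ` E)"
    using q.generate_img[OF E(2)] quotient_hom(2)[OF C(1)] E(4) by simp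
  moreover have "left_engel (G Mod C) n e" if "e \<in> (\<lambda>x. C #> x) ` E" for e
    using that q.left_engel_image[OF quotient_hom(2)[OF C(1)] E(3)] by auto
  moreover have "(\<lambda>x. C #> x) ` E \<subseteq> carrier (G Mod C)" using quotient_hom(2)[OF C(1)] E(2) by blast
  ultimately obtain d where
    "carrier (G Mod C) \<subseteq> rel_center (G Mod C) {\<one>\<^bsub>G Mod C\<^esub>} (carrier (G Mod C)) d"
    using q.H.engel_generated_finite_nilpotent[OF C(2), of "(\<lambda>x. C #> x) ` E" n] by metis
  hence d: "carrier G \<subseteq> rel_center G C (carrier G) d" by (rule rel_center_quotient[OF C(1)])
  have le: "carrier G \<subseteq> rel_center G M (carrier G) (c + d)"
    if "M \<lhd> G" "carrier G \<subseteq> rel_center G M (carrier G) i" "i \<le> c + d" for M i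
    using rel_center_le_mono[of M "carrier G" i "c + d"] that by (auto simp: normal_iff_normal_in)
  have KC: "carrier G \<subseteq> rel_center G (K \<inter> C) (carrier G) (c + d)"
    unfolding rel_center_Int using le[OF K(1) nil] le[OF C(1) d] by simp
  have "K \<inter> C \<lhd> G" using K(1) C(1) by (rule normal_subgroup_intersect)
  moreover have "comm x y = \<one>" if "x \<in> K \<inter> C" "y \<in> K \<inter> C" for x y
    using that by (auto simp: C_def)
  ultimately show ?thesis using engel_abelian_by_nilpotent[OF E _ _ KC] by blast
qed

theorem engel_generated_nilpotent:
  assumes E: "finite E" "E \<subseteq> carrier G" "\<And>e. e \<in> E \<Longrightarrow> left_engel G n e" "carrier G = generate G E"
    and S: "has_ls_lf_series G"
  shows "\<exists>c. carrier G \<subseteq> rel_center G {\<one>} (carrier G) c"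
proof -
  let ?P = "\<lambda>K. \<exists>c. carrier G \<subseteq> rel_center G K (carrier G) c"
  \<comment> \<open>Both kinds of factor are treated inside the quotient by \<open>M\<close>, where
    the image \<open>K'\<close> of \<open>K\<close> is finite or abelian and the images of the
    generators are still Engel.\<close>
  have quot: "(finite K' \<or> (\<forall>x\<in>K'. \<forall>y\<in>K'. group_commutator (G Mod M) x y = \<one>\<^bsub>G Mod M\<^esub>)) \<Longrightarrow> ?P M"
    if K: "K \<lhd> G" and M: "M \<lhd> G" and P: "?P K" and K': "K' = (\<lambda>x. M #> x) ` K" for K M K'
  proof -
    assume *: "finite K' \<or> (\<forall>x\<in>K'. \<forall>y\<in>K'. group_commutator (G Mod M) x y = \<one>\<^bsub>G Mod M\<^esub>)"
    interpret q: group_hom G "G Mod M" "\<lambda>x. M #> x" by (rule quotient_hom[OF M])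
    note surj = quotient_hom(2)[OF M]
    let ?E = "(\<lambda>x. M #> x) ` E"
    have 1: "finite ?E" "?E \<subseteq> carrier (G Mod M)" using E(1,2) surj by auto
    have 2: "left_engel (G Mod M) n e" if "e \<in> ?E" for e
      using that q.left_engel_image[OF surj E(3)] by auto
    have 3: "carrier (G Mod M) = generate (G Mod M) ?E"
      using q.generate_img[OF E(2)] surj E(4) by simp
    have 4: "K' \<lhd> G Mod M" unfolding K' by (rule normal.surj_hom_normal_subgroup[OF K q.group_hom_axioms surj])
    from P obtain c where c: "carrier G \<subseteq> rel_center G K (carrier G) c" by blast
    have 5: "carrier (G Mod M) \<subseteq> rel_center (G Mod M) K' (carrier (G Mod M)) c"
    proof
      fix y assume "y \<in> carrier (G Mod M)"
      then obtain x where x: "x \<in> carrier G" "y = M #> x" unfolding surj[symmetric] by blast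
      show "y \<in> rel_center (G Mod M) K' (carrier (G Mod M)) c"
        using q.rel_center_image[OF order_refl x(1), of K c] c x unfolding surj K' by blast
    qed
    have "\<exists>c. carrier (G Mod M) \<subseteq> rel_center (G Mod M) {\<one>\<^bsub>G Mod M\<^esub>} (carrier (G Mod M)) c"
      using * q.H.engel_finite_by_nilpotent[OF 1 2 3 4 _ 5] q.H.engel_abelian_by_nilpotent[OF 1 2 3 4 _ 5] by blast
    thus "?P M" using rel_center_quotient[OF M] by blast
  qed
  show ?thesis
  proof (rule ls_lf_series_descent[OF S, of ?P])
    show "?P (carrier G)" by (rule exI[of _ 0]) simp
  next
    fix K assume K: "K \<lhd> G" and P: "?P K"
    have nK: "normal_in G K (carrier G)" using K by (simp add: normal_iff_normal_in)
    have fg: "fin_gen G (carrier G)" unfolding fin_gen_def using E by blast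
    have gen: "carrier G = generate G (K \<union> E)"
    proof
      show "carrier G \<subseteq> generate G (K \<union> E)" unfolding E(4) by (intro mono_generate) simp
      show "generate G (K \<union> E) \<subseteq> carrier G" using normal_inD(4)[OF nK] E(2) by (intro generate_incl) simp
    qed
    show "fin_gen G K" using fin_gen_kernel_nilpotent[OF fg nK E(1-3) gen] P by blast
  next
    fix K M assume "K \<lhd> G" "M \<lhd> G" "finite ((\<lambda>x. M #> x) ` K)" "?P K"
    thus "?P M" using quot[of K M] by simp
  next
    fix K M assume KM: "K \<lhd> G" "M \<lhd> G" "derived G K \<subseteq> M" "?P K"
    interpret q: group_hom G "G Mod M" "\<lambda>x. M #> x" by (rule quotient_hom[OF KM(2)])
    have sK: "subgroup K G" using KM(1) by (rule normal_imp_subgroup)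
    have "group_commutator (G Mod M) (M #> x) (M #> y) = \<one>\<^bsub>G Mod M\<^esub>" if xy: "x \<in> K" "y \<in> K" for x y
    proof -
      have "comm x y \<in> M" using comm_in_derived[OF sK xy] KM(3) by blast
      hence "M #> comm x y = M"
        using coset_eq_self_iff[OF normal_imp_subgroup[OF KM(2)]] xy subgroup.mem_carrier[OF sK] by simp
      thus ?thesis using q.hom_group_commutator[of x y] xy subgroup.mem_carrier[OF sK] by simp
    qed
    thus "?P M" using quot[OF KM(1,2,4) refl] by blast
  qed
qed

text \<open>Commutators of \<open>K\<close> lie one step lower in the upper central series of
  \<open>G\<close>, so each derived subgroup lowers the height by one.\<close>

lemma nilpotent_imp_soluble:
  assumes "subgroup K G" "K \<subseteq> rel_center G {\<one>} (carrier G) q"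
  shows "(derived G ^^ q) K \<subseteq> {\<one>}"
  using assms
proof (induction q arbitrary: K)
  case (Suc q)
  let ?Z = "rel_center G {\<one>} (carrier G) q \<inter> carrier G"
  have "normal_in G ?Z (carrier G)" by (intro rel_center_normal one_normal_in subgroup_self)
  hence Z: "subgroup ?Z G" by (rule normal_inD)
  have "derived G K \<subseteq> ?Z"
  proof (rule derived_subsetI[OF Suc.prems(1) Z])
    fix x y assume xy: "x \<in> K" "y \<in> K"
    hence "x \<in> carrier G" "y \<in> carrier G" using subgroup.subset[OF Suc.prems(1)] by blast+
    thus "comm x y \<in> ?Z" using Suc.prems(2) xy by auto
  qed
  hence "(derived G ^^ q) (derived G K) \<subseteq> {\<one>}"
    using Suc.IH derived_is_subgroup[OF subgroup.subset[OF Suc.prems(1)]] by blast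
  thus ?case by (simp add: funpow_swap1)
qed simp

end

section \<open>Subgroups of finite index and transfer\<close>

context group
begin

lemma mem_rcoset_iff:
  assumes "subgroup K G" "x \<in> carrier G" "y \<in> carrier G"
  shows "x \<in> K #> y \<longleftrightarrow> x \<otimes> inv y \<in> K"
  using subgroup.rcos_module[OF assms(1) is_group assms(3) assms(2)] .

lemma rcoset_eq_iff:
  assumes K: "subgroup K G" and xy: "x \<in> carrier G" "y \<in> carrier G"
  shows "K #> x = K #> y \<longleftrightarrow> x \<otimes> inv y \<in> K"
  using repr_independence[OF _ xy(2) K, of x] rcos_self[OF xy(1) K] mem_rcoset_iff[OF K xy] by metis

lemma finite_index_representatives:
  assumes K: "subgroup K G" and D: "D \<subseteq> carrier G" and fin: "finite ((\<lambda>x. K #> x) ` D)"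
  shows "\<exists>R. finite R \<and> R \<subseteq> D \<and> (\<forall>x\<in>D. \<exists>r\<in>R. x \<otimes> inv r \<in> K)"
proof -
  obtain R where R: "R \<subseteq> D" "finite R" "(\<lambda>x. K #> x) ` D = (\<lambda>x. K #> x) ` R"
    using finite_subset_image[OF fin order_refl] by metis
  have "\<exists>r\<in>R. x \<otimes> inv r \<in> K" if x: "x \<in> D" for x
  proof -
    have "K #> x \<in> (\<lambda>x. K #> x) ` R" using x R(3) by blast
    then obtain r where "r \<in> R" "K #> x = K #> r" by blast
    thus ?thesis using rcoset_eq_iff[OF K, of x r] x R(1) D by blast
  qed
  thus ?thesis using R by blast
qed

lemma finite_index_trans:
  assumes K: "subgroup K G" and M: "subgroup M G"
    and fin: "finite ((\<lambda>x. M #> x) ` K)" "finite ((\<lambda>x. K #> x) ` carrier G)"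
  shows "finite ((\<lambda>x. M #> x) ` carrier G)"
proof -
  have Kc: "K \<subseteq> carrier G" using K by (rule subgroup.subset)
  obtain R where R: "finite R" "R \<subseteq> carrier G" "\<And>x. x \<in> carrier G \<Longrightarrow> \<exists>r\<in>R. x \<otimes> inv r \<in> K"
    using finite_index_representatives[OF K order_refl fin(2)] by blast
  obtain T where T: "finite T" "T \<subseteq> K" "\<And>x. x \<in> K \<Longrightarrow> \<exists>t\<in>T. x \<otimes> inv t \<in> M"
    using finite_index_representatives[OF M Kc fin(1)] by blast
  have "M #> x \<in> (\<lambda>(t, r). M #> (t \<otimes> r)) ` (T \<times> R)" if x: "x \<in> carrier G" for x
  proof -
    obtain r where r: "r \<in> R" "x \<otimes> inv r \<in> K" using R(3) x by blast
    obtain t where t: "t \<in> T" "x \<otimes> inv r \<otimes> inv t \<in> M" using T(3) r by blast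
    have c: "r \<in> carrier G" "t \<in> carrier G" using r t R T Kc by auto
    have "x \<otimes> inv (t \<otimes> r) \<in> M" using t(2) c x by (simp add: word_simps)
    hence "M #> x = M #> (t \<otimes> r)" using rcoset_eq_iff[OF M] x c by simp
    thus ?thesis using r t by force
  qed
  hence "(\<lambda>x. M #> x) ` carrier G \<subseteq> (\<lambda>(t, r). M #> (t \<otimes> r)) ` (T \<times> R)" by blast
  moreover have "finite ((\<lambda>(t, r). M #> (t \<otimes> r)) ` (T \<times> R))" using R(1) T(1) by simp
  ultimately show ?thesis by (rule finite_subset)
qed

text \<open>Schreier's argument. Instead of one chosen representative for each product, all elements
  r z r'^-1 that fall into \<open>K\<close> are taken as generators, with \<open>r\<close> and
  \<open>r'\<close> from a finite set of representatives and \<open>z\<close> a letter. Products of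
  an element of the subgroup they generate with a representative are stable under right
  multiplication by letters.\<close>

lemma fin_gen_finite_index:
  assumes K: "subgroup K G" and fin: "finite ((\<lambda>x. K #> x) ` carrier G)"
    and Y: "finite Y" "Y \<subseteq> carrier G" "carrier G = generate G Y"
  shows "fin_gen G K"
proof -
  obtain R0 where R0: "finite R0" "R0 \<subseteq> carrier G" "\<And>x. x \<in> carrier G \<Longrightarrow> \<exists>r\<in>R0. x \<otimes> inv r \<in> K"
    using finite_index_representatives[OF K order_refl fin] by blast
  define R where "R = insert \<one> R0"
  define Z where "Z = insert \<one> (Y \<union> (\<lambda>y. inv y) ` Y)"
  define T where "T = (\<lambda>(r, z, r'). r \<otimes> z \<otimes> inv r') ` (R \<times> Z \<times> R) \<inter> K"
  have Rc: "R \<subseteq> carrier G" and Zc: "Z \<subseteq> carrier G" using R0(2) Y(2) by (auto simp: R_def Z_def)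
  have finT: "finite T" unfolding T_def using R0(1) Y(1) by (auto simp: R_def Z_def)
  have Tc: "T \<subseteq> carrier G" using subgroup.subset[OF K] by (auto simp: T_def)
  have Timem: "r \<otimes> z \<otimes> inv r' \<in> T" if "r \<in> R" "z \<in> Z" "r' \<in> R" "r \<otimes> z \<otimes> inv r' \<in> K" for r z r'
    using that unfolding T_def by force
  let ?S = "generate G T"
  have S: "subgroup ?S G" using Tc by (rule generate_is_subgroup)
  have SK: "?S \<subseteq> K" using K by (intro generate_subgroup_incl) (auto simp: T_def)
  have step: "\<exists>s'\<in>?S. \<exists>r'\<in>R. s \<otimes> r \<otimes> z = s' \<otimes> r'" if s: "s \<in> ?S" and r: "r \<in> R" and z: "z \<in> Z" for s r z
  proof -
    have c: "s \<in> carrier G" "r \<in> carrier G" "z \<in> carrier G" using s r z Rc Zc subgroup.mem_carrier[OF S] by auto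
    obtain r' where r': "r' \<in> R" "r \<otimes> z \<otimes> inv r' \<in> K" using R0(3)[of "r \<otimes> z"] c by (auto simp: R_def)
    have "r \<otimes> z \<otimes> inv r' \<in> ?S" using Timem[OF r z r'] by (rule generate.incl)
    with s have "s \<otimes> (r \<otimes> z \<otimes> inv r') \<in> ?S" by (rule generate.eng)
    moreover have "s \<otimes> r \<otimes> z = s \<otimes> (r \<otimes> z \<otimes> inv r') \<otimes> r'" using c r' Rc by (auto simp: m_assoc)
    ultimately show ?thesis using r' by blast
  qed
  have "\<forall>s\<in>?S. \<forall>r\<in>R. \<exists>s'\<in>?S. \<exists>r'\<in>R. s \<otimes> r \<otimes> x = s' \<otimes> r'" if "x \<in> generate G Y" for x
    using that
  proof induction
    case one thus ?case using step by (simp add: Z_def)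
  next
    case (incl h) thus ?case using step[of _ _ h] by (simp add: Z_def)
  next
    case (inv h) thus ?case using step[of _ _ "inv h"] by (simp add: Z_def)
  next
    case (eng x y)
    have c: "x \<in> carrier G" "y \<in> carrier G" using eng generate_in_carrier[OF Y(2)] by auto
    show ?case
    proof (intro ballI)
      fix s r assume s: "s \<in> ?S" and r: "r \<in> R"
      have sc: "s \<in> carrier G" "r \<in> carrier G" using s r Rc subgroup.mem_carrier[OF S] by auto
      obtain s' r' where 1: "s' \<in> ?S" "r' \<in> R" "s \<otimes> r \<otimes> x = s' \<otimes> r'" using eng.IH(1) s r by blast
      obtain s'' r'' where 2: "s'' \<in> ?S" "r'' \<in> R" "s' \<otimes> r' \<otimes> y = s'' \<otimes> r''" using eng.IH(2) 1 by blast
      have "s \<otimes> r \<otimes> (x \<otimes> y) = (s \<otimes> r \<otimes> x) \<otimes> y" using sc c by (simp add: m_assoc)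
      also have "\<dots> = s'' \<otimes> r''" using 1 2 by simp
      finally show "\<exists>s'\<in>?S. \<exists>r'\<in>R. s \<otimes> r \<otimes> (x \<otimes> y) = s' \<otimes> r'" using 2 by blast
    qed
  qed
  moreover have "\<one> \<in> ?S" "\<one> \<in> R" by (auto simp: R_def intro: generate.one)
  ultimately have "\<exists>s\<in>?S. \<exists>r\<in>R. \<one> \<otimes> \<one> \<otimes> x = s \<otimes> r" if "x \<in> generate G Y" for x
    using that by blast
  hence dec: "\<exists>s\<in>?S. \<exists>r\<in>R. x = s \<otimes> r" if x: "x \<in> carrier G" for x
    using x by (simp add: Y(3)[symmetric])
  have "K \<subseteq> ?S"
  proof
    fix x assume x: "x \<in> K"
    hence xc: "x \<in> carrier G" using subgroup.mem_carrier[OF K] by blast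
    obtain s r where sr: "s \<in> ?S" "r \<in> R" "x = s \<otimes> r" using dec[OF xc] by blast
    have c: "s \<in> carrier G" "r \<in> carrier G" using sr Rc subgroup.mem_carrier[OF S] by auto
    have "inv s \<otimes> x \<in> K" using sr(1) SK x K by (auto simp: subgroup.m_closed subgroup.m_inv_closed)
    hence "r \<in> K" using sr(3) c by simp
    \<comment> \<open>The identity was added both to the letters and to the representatives so that
      every representative lying in \<open>K\<close> is itself one of the generators.\<close>
    hence "r \<otimes> \<one> \<otimes> inv \<one> \<in> T" using c sr(2) by (intro Timem) (auto simp: R_def Z_def)
    hence "r \<in> ?S" using c by (auto intro: generate.incl)
    thus "x \<in> ?S" using sr by (auto intro: generate.eng)
  qed
  thus ?thesis unfolding fin_gen_def using SK finT Tc by (intro exI[of _ T]) auto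
qed

text \<open>Each new generator \<open>f\<close> multiplies the group by at most \<open>e\<close>
  powers; inverses are written as powers with exponent \<open>e - 1\<close>, so natural exponents
  suffice.\<close>

lemma finite_generate_torsion_abelian:
  assumes K: "K \<subseteq> carrier G" "\<And>x y. x \<in> K \<Longrightarrow> y \<in> K \<Longrightarrow> x \<otimes> y = y \<otimes> x" and sK: "subgroup K G"
    and e: "0 < (e::nat)" "\<And>x. x \<in> K \<Longrightarrow> x [^] e = \<one>" and F: "finite F" "F \<subseteq> K"
  shows "finite (generate G F)"
  using F
proof (induction F)
  case empty thus ?case by (simp add: generate_empty)
next
  case (insert f F)
  have f: "f \<in> K" "f \<in> carrier G" using insert K by auto
  let ?V = "generate G F"
  have Fc: "F \<subseteq> carrier G" using insert K by auto
  have VK: "?V \<subseteq> K" using insert sK by (intro generate_subgroup_incl) auto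
  have pow: "f [^] i \<in> K" for i :: nat by (induction i) (use f sK in \<open>auto simp: subgroup.one_closed subgroup.m_closed\<close>)
  have mod: "f [^] i = f [^] (i mod e)" for i
  proof -
    have "f [^] i = f [^] (e * (i div e) + i mod e)" by simp
    also have "\<dots> = (f [^] e) [^] (i div e) \<otimes> f [^] (i mod e)"
      using f by (simp only: nat_pow_mult[symmetric] nat_pow_pow)
    also have "\<dots> = f [^] (i mod e)" using f e(2)[OF f(1)] by (simp add: nat_pow_one)
    finally show ?thesis .
  qed
  have inv_f: "inv f = f [^] (e - 1)"
  proof -
    have "f [^] (e - 1) \<otimes> f = f [^] Suc (e - 1)" by simp
    also have "\<dots> = \<one>" using e f by simp
    finally show ?thesis using f by (intro inv_equality) auto
  qed
  have "\<exists>v\<in>?V. \<exists>i::nat. x = v \<otimes> f [^] i" if "x \<in> generate G (insert f F)" for x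
    using that
  proof induction
    case one thus ?case by (intro bexI[of _ \<one>] exI[of _ 0]) (auto intro: generate.one)
  next
    case (incl h) 
    show ?case
    proof (cases "h = f")
      case True thus ?thesis using f by (intro bexI[of _ \<one>] exI[of _ 1]) (auto intro: generate.one)
    next
      case False
      hence "h \<in> ?V" using incl by (auto intro: generate.incl)
      thus ?thesis using generate_in_carrier[OF Fc] by (intro bexI[of _ h] exI[of _ 0]) auto
    qed
  next
    case (inv h) 
    show ?case
    proof (cases "h = f")
      case True thus ?thesis using f inv_f by (intro bexI[of _ \<one>] exI[of _ "e - 1"]) (auto intro: generate.one)
    next
      case False
      hence "inv h \<in> ?V" using inv by (auto intro: generate.inv)
      thus ?thesis using generate_in_carrier[OF Fc] by (intro bexI[of _ "inv h"] exI[of _ 0]) auto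
    qed
  next
    case (eng x y)
    then obtain v w and i j :: nat where *: "v \<in> ?V" "w \<in> ?V" "x = v \<otimes> f [^] i" "y = w \<otimes> f [^] j" by blast
    have c: "v \<in> carrier G" "w \<in> carrier G" using * generate_in_carrier[OF Fc] by auto
    have comm: "f [^] i \<otimes> w = w \<otimes> f [^] i" using K(2) pow * VK by blast
    have "x \<otimes> y = v \<otimes> (f [^] i \<otimes> w) \<otimes> f [^] j" using * c f by (simp add: m_assoc)
    also have "\<dots> = (v \<otimes> w) \<otimes> f [^] (i + j)" unfolding comm using c f by (simp add: m_assoc nat_pow_mult)
    finally show ?case using * by (blast intro: generate.eng)
  qed
  hence "\<exists>v\<in>?V. \<exists>i<e. x = v \<otimes> f [^] i" if "x \<in> generate G (insert f F)" for x
    using that mod e(1) by (metis mod_less_divisor)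
  hence "generate G (insert f F) \<subseteq> (\<lambda>(v, i). v \<otimes> f [^] i) ` (?V \<times> {..<e})" by fastforce
  moreover have "finite ((\<lambda>(v, i). v \<otimes> f [^] i) ` (?V \<times> {..<e}))" using insert by simp
  ultimately show ?case by (rule finite_subset)
qed

text \<open>The transfer into an abelian subgroup of finite index \<open>d\<close>: for a section
  \<open>s\<close> of the right cosets, \<open>x\<close> is sent to the product over all cosets
  \<open>c\<close> of s(c) x s(cx)^-1. A central element of \<open>K\<close> fixes every coset, so
  each factor of its transfer is the element itself and the product is its \<open>d\<close>-th
  power.\<close>

lemma transfer_hom:
  assumes K: "subgroup K G" and ab: "\<And>x y. x \<in> K \<Longrightarrow> y \<in> K \<Longrightarrow> x \<otimes> y = y \<otimes> x"
    and fin: "finite ((\<lambda>x. K #> x) ` carrier G)"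
  shows "\<exists>t (d::nat). 0 < d \<and> group_hom G (G\<lparr>carrier := K\<rparr>) t \<and>
    (\<forall>z\<in>K. (\<forall>x\<in>carrier G. z \<otimes> x = x \<otimes> z) \<longrightarrow> t z = z [^] d)"
proof -
  let ?K = "G\<lparr>carrier := K\<rparr>"
  define Q where "Q = (\<lambda>x. K #> x) ` carrier G"
  interpret K: comm_group ?K
    using subgroup_imp_group[OF K] ab by (intro group.group_comm_groupI) auto
  have Kc: "K \<subseteq> carrier G" using K by (rule subgroup.subset)
  define s where "s c = (SOME x. x \<in> c)" for c :: "'a set"
  have s: "s c \<in> c" "s c \<in> carrier G" "K #> s c = c" if c: "c \<in> Q" for c
  proof -
    obtain x where x: "x \<in> carrier G" "c = K #> x" using c by (auto simp: Q_def)
    have "x \<in> c" using rcos_self[OF x(1) K] x(2) by simp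
    thus 1: "s c \<in> c" unfolding s_def by (rule someI)
    show 2: "s c \<in> carrier G" using 1 x Kc r_coset_subset_G by blast
    show "K #> s c = c" using repr_independence[OF _ x(1) K, of "s c"] 1 x(2) by simp
  qed
  have shift: "c #> x \<in> Q" if c: "c \<in> Q" and x: "x \<in> carrier G" for c x
  proof -
    have "K #> s c #> x = K #> (s c \<otimes> x)" using coset_mult_assoc[OF Kc s(2)[OF c] x] .
    thus ?thesis using s[OF c] x by (auto simp: Q_def)
  qed
  have shift2: "c #> x #> y = c #> (x \<otimes> y)" if c: "c \<in> Q" and x: "x \<in> carrier G" "y \<in> carrier G" for c x y
  proof -
    have "c \<subseteq> carrier G" using c Kc r_coset_subset_G by (auto simp: Q_def)
    thus ?thesis using x coset_mult_assoc by blast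
  qed
  define u where "u x c = s c \<otimes> x \<otimes> inv (s (c #> x))" for x c
  have u: "u x c \<in> K" if c: "c \<in> Q" and x: "x \<in> carrier G" for x c
  proof -
    have "K #> (s c \<otimes> x) = K #> s (c #> x)"
      using coset_mult_assoc[OF Kc s(2)[OF c] x] s[OF c] s[OF shift[OF c x]] by simp
    thus ?thesis unfolding u_def
      using rcoset_eq_iff[OF K, of "s c \<otimes> x" "s (c #> x)"] s(2)[OF c] s(2)[OF shift[OF c x]] x by simp
  qed
  define t where "t x = finprod ?K (u x) Q" for x
  have tK: "t x \<in> K" if "x \<in> carrier G" for x
    using K.finprod_closed[of "u x" Q] u that by (auto simp: t_def)
  have "t (x \<otimes> y) = t x \<otimes> t y" if x: "x \<in> carrier G" and y: "y \<in> carrier G" for x y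
  proof -
    have "t (x \<otimes> y) = finprod ?K (\<lambda>c. u x c \<otimes>\<^bsub>?K\<^esub> u y (c #> x)) Q"
      unfolding t_def
    proof (rule K.finprod_cong')
      fix c assume c: "c \<in> Q"
      have "s c \<in> carrier G" "s (c #> x) \<in> carrier G" "s (c #> x #> y) \<in> carrier G"
        using s(2) shift c x y by blast+
      thus "u (x \<otimes> y) c = u x c \<otimes>\<^bsub>?K\<^esub> u y (c #> x)"
        unfolding u_def using x y shift2[OF c x y] by (simp add: m_assoc)
    qed (use u x y shift K.m_closed in auto)
    also have "\<dots> = finprod ?K (u x) Q \<otimes>\<^bsub>?K\<^esub> finprod ?K (\<lambda>c. u y (c #> x)) Q"
      using u x y shift by (intro K.finprod_multf) auto
    \<comment> \<open>Right multiplication by \<open>x\<close> permutes the cosets, so the product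
      may be reindexed.\<close>
    also have "finprod ?K (\<lambda>c. u y (c #> x)) Q = finprod ?K (u y) Q"
    proof -
      have bij: "(\<lambda>c. c #> x) ` Q = Q"
      proof
        show "(\<lambda>c. c #> x) ` Q \<subseteq> Q" using shift x by blast
        show "Q \<subseteq> (\<lambda>c. c #> x) ` Q"
        proof
          fix c assume c: "c \<in> Q"
          have "c #> inv x #> x = c"
            using shift2[OF c, of "inv x" x] x c Kc by (auto simp: Q_def coset_mult_one r_coset_subset_G)
          thus "c \<in> (\<lambda>c. c #> x) ` Q" using shift[OF c, of "inv x"] x by (metis image_eqI inv_closed)
        qed
      qed
      have inj: "inj_on (\<lambda>c. c #> x) Q"
        using fin bij by (intro eq_card_imp_inj_on) (auto simp: Q_def)
      have "u y \<in> (\<lambda>c. c #> x) ` Q \<rightarrow> carrier ?K" unfolding bij using u y by auto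
      from K.finprod_reindex[OF this inj]
      show ?thesis unfolding bij ..
    qed
    finally show ?thesis unfolding t_def by simp
  qed
  hence hom: "group_hom G ?K t"
    using tK K.is_group is_group unfolding group_hom_def group_hom_axioms_def hom_def by auto
  have "t z = z [^] card Q" if z: "z \<in> K" and cen: "\<And>x. x \<in> carrier G \<Longrightarrow> z \<otimes> x = x \<otimes> z" for z
  proof -
    have zc: "z \<in> carrier G" using z Kc by auto
    have "t z = finprod ?K (\<lambda>c. z) Q" unfolding t_def
    proof (rule K.finprod_cong')
      fix c assume c: "c \<in> Q"
      note sc = s(2)[OF c]
      have "c #> z = K #> (s c \<otimes> z)" using coset_mult_assoc[OF Kc sc zc] s(3)[OF c] by simp
      also have "\<dots> = K #> (z \<otimes> s c)" using cen[OF sc] by simp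
      also have "\<dots> = K #> s c" using rcoset_eq_iff[OF K, of "z \<otimes> s c" "s c"] sc zc z by (simp add: m_assoc)
      finally have "c #> z = c" using s(3)[OF c] by simp
      thus "u z c = z" unfolding u_def using cen[OF sc, symmetric] sc zc by (simp add: m_assoc)
    qed (use z in auto)
    also have "\<dots> = z [^] card Q" using z K.finprod_const[of z Q] nat_pow_consistent[of z "card Q" K] by simp
    finally show ?thesis .
  qed
  moreover have "0 < card Q" using fin by (auto simp: Q_def card_gt_0_iff)
  ultimately show ?thesis using hom by blast
qed

end

section \<open>Groups with a series generated by torsion elements\<close>

context group
begin

text \<open>Write c = [b, y]. As \<open>c\<close> commutes with \<open>y\<close>, moving
  \<open>b\<close> past \<open>i\<close> factors \<open>y\<close> gives b y^i = y^i b c^i. For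
  \<open>i = m\<close> the powers of \<open>y\<close> disappear and c^m = 1 remains.\<close>

lemma comm_pow_eq_one:
  assumes b: "b \<in> carrier G" and y: "y \<in> carrier G" "y [^] (m::nat) = \<one>"
    and c: "comm b y \<otimes> y = y \<otimes> comm b y"
  shows "comm b y [^] m = \<one>"
proof -
  let ?c = "comm b y"
  have cc: "?c \<in> carrier G" using b y by simp
  have by_eq: "b \<otimes> y = y \<otimes> b \<otimes> ?c" using b y by (simp add: word_simps)
  have pow: "?c [^] i \<otimes> y = y \<otimes> ?c [^] i" for i :: nat
    using pow_mult_distrib group_commutes_pow[OF c cc y(1)] by simp
  have "b \<otimes> y [^] i = y [^] i \<otimes> b \<otimes> ?c [^] i" for i :: nat
  proof (induction i)
    case (Suc i)
    have "b \<otimes> y [^] Suc i = (b \<otimes> y [^] i) \<otimes> y" using b y by (simp add: m_assoc)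
    also have "\<dots> = y [^] i \<otimes> b \<otimes> (?c [^] i \<otimes> y)" unfolding Suc using b y cc by (simp add: m_assoc)
    also have "\<dots> = y [^] i \<otimes> (b \<otimes> y) \<otimes> ?c [^] i" unfolding pow using b y cc by (simp add: m_assoc)
    also have "\<dots> = (y [^] i \<otimes> y) \<otimes> b \<otimes> (?c \<otimes> ?c [^] i)" unfolding by_eq using b y cc by (simp add: m_assoc)
    also have "\<dots> = y [^] Suc i \<otimes> b \<otimes> ?c [^] Suc i" using cc by (simp only: nat_pow_Suc nat_pow_Suc2[symmetric])
    finally show ?case .
  qed (use b in simp)
  from this[of m] have "b \<otimes> \<one> = b \<otimes> ?c [^] m" using y b cc by simp
  thus ?thesis using b cc by (metis l_cancel nat_pow_closed one_closed)
qed

text \<open>On the abelian \<open>K\<close> the map sending \<open>a\<close> to [a, y] is an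
  endomorphism, so powers pass through iterated commutators. A fixed power \<open>q\<close> of every
  element of \<open>K\<close> turns out to be central, where the transfer is the \<open>d\<close>-th
  power map. The transfer has abelian image, generated by elements whose \<open>m\<close>-th power
  is trivial. Hence \<open>K\<close> has finite exponent and, being finitely generated, is
  finite.\<close>

lemma torsion_generated_abelian_by_finite:
  assumes Y: "finite Y" "Y \<subseteq> carrier G" "carrier G = generate G Y" and m: "0 < (m::nat)"
    and tors: "\<And>y. y \<in> Y \<Longrightarrow> y [^] m = \<one>"
    and com: "\<And>a y. a \<in> carrier G \<Longrightarrow> y \<in> Y \<Longrightarrow> iterated_commutator G a k y [^] m = \<one>"
    and K: "K \<lhd> G" and ab: "\<And>x y. x \<in> K \<Longrightarrow> y \<in> K \<Longrightarrow> x \<otimes> y = y \<otimes> x"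
    and fin: "finite ((\<lambda>x. K #> x) ` carrier G)"
  shows "finite (carrier G)"
proof -
  have nK: "normal_in G K (carrier G)" using K by (simp add: normal_iff_normal_in)
  have sK: "subgroup K G" and Kc: "K \<subseteq> carrier G" using normal_inD[OF nK] by blast+
  have Kcomm: "comm a y \<in> K" if "a \<in> K" "y \<in> carrier G" for a y using normal_in_comm(1)[OF nK that] .
  have Kiter: "iterated_commutator G a i y \<in> K" if "a \<in> K" "y \<in> carrier G" for a i y
    using that Kcomm by (induction i) auto
  have Kpow: "a [^] (i::nat) \<in> K" if "a \<in> K" for a i
    using that sK by (induction i) (auto simp: subgroup.one_closed subgroup.m_closed)
  have comm_mult: "comm (a \<otimes> b) y = comm a y \<otimes> comm b y" if "a \<in> K" "b \<in> K" "y \<in> carrier G" for a b y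
  proof -
    have c: "a \<in> carrier G" "b \<in> carrier G" using that Kc by auto
    have "inv b \<otimes> comm a y \<otimes> b = comm a y"
      using ab[OF Kcomm[OF that(1,3)] that(2)] c that(3) by (simp add: m_assoc)
    thus ?thesis using comm_mult_left[OF c that(3)] by simp
  qed
  have comm_pow: "comm (a [^] i) y = comm a y [^] i" if "a \<in> K" "y \<in> carrier G" for a y and i :: nat
  proof (induction i)
    case 0 thus ?case using that by (simp add: word_simps)
  next
    case (Suc i) thus ?case using comm_mult[OF Kpow[OF that(1)] that, of i] by simp
  qed
  have iter_pow: "iterated_commutator G (a [^] e) i y = iterated_commutator G a i y [^] e"
    if "a \<in> K" "y \<in> carrier G" for a y i and e :: nat
    by (induction i) (use comm_pow[OF Kiter[OF that] that(2)] in auto)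
  \<comment> \<open>Each factor \<open>m\<close> in the exponent removes one commutator: the last
    but one, [b, y], commutes with \<open>y\<close>, so its \<open>m\<close>-th power is trivial by
    \<open>comm_pow_eq_one\<close>, and this power may be moved onto \<open>a\<close>.\<close>
  have kill: "comm (a [^] (m ^ j)) y = \<one>"
    if "a \<in> K" "y \<in> Y" "iterated_commutator G a (Suc j) y = \<one>" for a y j
    using that
  proof (induction j arbitrary: a)
    case 0
    hence "a [^] (m ^ 0) = a" using Kc by auto
    thus ?case using 0 by simp
  next
    case (Suc j)
    have yc: "y \<in> carrier G" using Suc Y by auto
    let ?b = "iterated_commutator G a j y"
    have b: "?b \<in> carrier G" using Kiter[OF Suc.prems(1) yc] Kc by auto
    have "comm (comm ?b y) y = \<one>" using Suc.prems(3) by simp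
    hence "comm ?b y \<otimes> y = y \<otimes> comm ?b y" using comm_eq_one_iff b yc by simp
    hence "comm ?b y [^] m = \<one>" using comm_pow_eq_one[OF b yc tors] Suc.prems(2) by simp
    hence "iterated_commutator G (a [^] m) (Suc j) y = \<one>"
      using iter_pow[OF Suc.prems(1) yc, of m "Suc j"] by simp
    hence "comm ((a [^] m) [^] (m ^ j)) y = \<one>" using Suc.IH[OF Kpow[OF Suc.prems(1)] Suc.prems(2)] by simp
    thus ?case using Suc.prems(1) Kc by (simp add: nat_pow_pow subset_iff)
  qed
  \<comment> \<open>The first \<open>m\<close> makes the \<open>k\<close>-fold commutator trivial by
    hypothesis. The factor \<open>m ^ k\<close> then feeds \<open>kill\<close> at
    \<open>j = k\<close>, one commutator beyond that, which also covers
    \<open>k = 0\<close>.\<close>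
  define q where "q = m * m ^ k"
  have central: "a [^] q \<otimes> x = x \<otimes> a [^] q" if a: "a \<in> K" and x: "x \<in> carrier G" for a x
  proof -
    have ac: "a \<in> carrier G" using a Kc by auto
    have "comm (a [^] q) y = \<one>" if y: "y \<in> Y" for y
    proof -
      have yc: "y \<in> carrier G" using y Y by auto
      have "iterated_commutator G (a [^] m) k y = \<one>" using iter_pow[OF a yc] com[OF ac y] by simp
      hence "iterated_commutator G (a [^] m) (Suc k) y = \<one>" using yc by (simp add: word_simps)
      hence "comm ((a [^] m) [^] (m ^ k)) y = \<one>" using kill[OF Kpow[OF a] y] by simp
      thus ?thesis using ac by (simp add: nat_pow_pow q_def)
    qed
    hence "comm (a [^] q) x \<in> {\<one>}"
      using comm_generate_right[OF one_normal_in[OF subgroup_self], of "a [^] q" Y x] ac Y(2) x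
      unfolding Y(3)[symmetric] by (metis nat_pow_closed singletonI)
    thus ?thesis using comm_eq_one_iff[of "a [^] q" x] ac x by simp
  qed
  obtain t and d :: nat where d: "0 < d" and t: "group_hom G (G\<lparr>carrier := K\<rparr>) t"
    and tz: "\<And>z. z \<in> K \<Longrightarrow> (\<And>x. x \<in> carrier G \<Longrightarrow> z \<otimes> x = x \<otimes> z) \<Longrightarrow> t z = z [^] d"
    using transfer_hom[OF sK ab fin] by metis
  interpret t: group_hom G "G\<lparr>carrier := K\<rparr>" t by (rule t)
  have tK: "t x \<in> K" if "x \<in> carrier G" for x using t.hom_closed[OF that] by simp
  have tmult: "t (x \<otimes> y) = t x \<otimes> t y" if "x \<in> carrier G" "y \<in> carrier G" for x y
    using t.hom_mult[OF that] by simp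
  have tY: "t y [^] m = \<one>" if y: "y \<in> Y" for y
    using t.hom_nat_pow[of y m] tors[OF y] subsetD[OF Y(2) y] nat_pow_consistent[of "t y" m K] t.hom_one by simp
  have "t x [^] m = \<one>" if "x \<in> generate G Y" for x
    using that
  proof induction
    case one thus ?case using t.hom_one by (simp add: nat_pow_one)
  next
    case (incl y) thus ?case by (rule tY)
  next
    case (inv y)
    hence yc: "y \<in> carrier G" using Y by auto
    have "t (inv y) = inv (t y)"
      using t.hom_inv[OF yc] m_inv_consistent[OF sK tK[OF yc]] by simp
    thus ?case using tY[OF inv] tK[OF yc] Kc by (auto simp: nat_pow_inv)
  next
    case (eng x y)
    have c: "x \<in> carrier G" "y \<in> carrier G" using eng(1,2) by (simp_all add: Y(3)[symmetric])
    have "(t x \<otimes> t y) [^] m = t x [^] m \<otimes> t y [^] m"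
      using tK[OF c(1)] tK[OF c(2)] Kc ab by (intro pow_mult_distrib) auto
    thus ?case using eng tmult[OF c] by simp
  qed
  hence tm: "t x [^] m = \<one>" if "x \<in> carrier G" for x using that Y(3) by auto
  have "a [^] (q * d * m) = \<one>" if a: "a \<in> K" for a
  proof -
    have ac: "a \<in> carrier G" using a Kc by auto
    have "t (a [^] q) = (a [^] q) [^] d" using tz[OF Kpow[OF a]] central[OF a] by simp
    thus ?thesis using tm[of "a [^] q"] ac by (simp add: nat_pow_pow)
  qed
  moreover have "0 < q * d * m" using m d by (simp add: q_def)
  moreover obtain F where F: "finite F" "F \<subseteq> carrier G" "K = generate G F"
    using fin_gen_finite_index[OF sK fin Y] by (auto simp: fin_gen_def)
  ultimately have "finite K"
    using finite_generate_torsion_abelian[OF Kc ab sK, of "q * d * m" F] subset_generate[of F F] by auto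
  moreover have "carrier G = \<Union> ((\<lambda>x. K #> x) ` carrier G)"
    using rcos_self[OF _ sK] r_coset_subset_G[OF Kc] by auto
  moreover have "finite (K #> x)" if "x \<in> carrier G" for x
    using \<open>finite K\<close> by (simp add: r_coset_def)
  ultimately show ?thesis using fin by (metis (no_types, lifting) finite_UN finite_Union imageE)
qed

text \<open>Descent for the property that \<open>K\<close> has finite index. Across an abelian
  factor the preceding lemma applies to the quotient by \<open>M\<close>, because both power
  conditions pass to quotients.\<close>

theorem torsion_generated_finite:
  assumes Y: "finite Y" "Y \<subseteq> carrier G" "carrier G = generate G Y" and m: "0 < (m::nat)"
    and tors: "\<And>y. y \<in> Y \<Longrightarrow> y [^] m = \<one>"
    and com: "\<And>a y. a \<in> carrier G \<Longrightarrow> y \<in> Y \<Longrightarrow> iterated_commutator G a k y [^] m = \<one>"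
    and S: "has_ls_lf_series G"
  shows "finite (carrier G)"
proof -
  let ?P = "\<lambda>K. finite ((\<lambda>x. K #> x) ` carrier G)"
  have "?P {\<one>}"
  proof (rule ls_lf_series_descent[OF S, of ?P])
    have "(\<lambda>x. carrier G #> x) ` carrier G \<subseteq> {carrier G}"
      using coset_join2[OF _ subgroup_self] by auto
    thus "?P (carrier G)" using finite_subset by blast
  next
    fix K assume K: "K \<lhd> G" "?P K"
    show "fin_gen G K" using fin_gen_finite_index[OF normal_imp_subgroup[OF K(1)] K(2) Y] .
  next
    fix K M assume KM: "K \<lhd> G" "M \<lhd> G" "finite ((\<lambda>x. M #> x) ` K)" "?P K"
    show "?P M" using finite_index_trans[OF normal_imp_subgroup[OF KM(1)] normal_imp_subgroup[OF KM(2)] KM(3,4)] .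
  next
    fix K M assume KM: "K \<lhd> G" "M \<lhd> G" "M \<subseteq> K" "derived G K \<subseteq> M" "?P K"
    have sK: "subgroup K G" and sM: "subgroup M G" using KM(1,2) by (simp_all add: normal_imp_subgroup)
    let ?h = "\<lambda>x. M #> x"
    interpret q: group_hom G "G Mod M" ?h by (rule quotient_hom[OF KM(2)])
    note surj = quotient_hom(2)[OF KM(2)]
    let ?K = "?h ` K"
    have pow: "(?h x) [^]\<^bsub>G Mod M\<^esub> m = ?h (x [^] m)" if "x \<in> carrier G" for x
      using q.hom_nat_pow[OF that] by simp
    have one: "?h \<one> = \<one>\<^bsub>G Mod M\<^esub>" by (rule q.hom_one)
    have "finite (carrier (G Mod M))"
    proof (rule q.H.torsion_generated_abelian_by_finite[of "?h ` Y" m k ?K])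
      show "finite (?h ` Y)" "?h ` Y \<subseteq> carrier (G Mod M)" using Y surj by auto
      show "carrier (G Mod M) = generate (G Mod M) (?h ` Y)" using q.generate_img[OF Y(2)] surj Y(3) by simp
      show "0 < m" by (rule m)
      show "y [^]\<^bsub>G Mod M\<^esub> m = \<one>\<^bsub>G Mod M\<^esub>" if "y \<in> ?h ` Y" for y
        using that pow tors Y(2) one by auto
      show "iterated_commutator (G Mod M) a k y [^]\<^bsub>G Mod M\<^esub> m = \<one>\<^bsub>G Mod M\<^esub>"
        if a: "a \<in> carrier (G Mod M)" and y: "y \<in> ?h ` Y" for a y
      proof -
        obtain b where b: "b \<in> carrier G" "a = ?h b" using a unfolding surj[symmetric] by blast
        obtain z where z: "z \<in> Y" "y = ?h z" using y by blast
        have zc: "z \<in> carrier G" using z Y by auto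
        have "iterated_commutator (G Mod M) a k y = ?h (iterated_commutator G b k z)"
          using q.hom_iterated_commutator[OF b(1) zc] b z by simp
        thus ?thesis using pow[of "iterated_commutator G b k z"] com[OF b(1) z(1)] b zc one by simp
      qed
      show "?K \<lhd> G Mod M" by (rule normal.surj_hom_normal_subgroup[OF KM(1) q.group_hom_axioms surj])
      show "x \<otimes>\<^bsub>G Mod M\<^esub> y = y \<otimes>\<^bsub>G Mod M\<^esub> x" if xy: "x \<in> ?K" "y \<in> ?K" for x y
      proof -
        obtain a b where a: "a \<in> K" "x = ?h a" and b: "b \<in> K" "y = ?h b" using xy by blast
        have c: "a \<in> carrier G" "b \<in> carrier G" using a b subgroup.mem_carrier[OF sK] by auto
        have "comm a b \<in> M" using comm_in_derived[OF sK a(1) b(1)] KM(4) by blast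
        hence "?h (comm a b) = \<one>\<^bsub>G Mod M\<^esub>" using coset_eq_self_iff[OF sM] c by simp
        hence "group_commutator (G Mod M) x y = \<one>\<^bsub>G Mod M\<^esub>" using q.hom_group_commutator[OF c] a b by simp
        moreover have "x \<in> carrier (G Mod M)" "y \<in> carrier (G Mod M)" using a b q.hom_closed c by blast+
        ultimately show ?thesis by (simp only: q.H.comm_eq_one_iff)
      qed
      show "finite ((\<lambda>x. ?K #>\<^bsub>G Mod M\<^esub> x) ` carrier (G Mod M))"
      proof -
        have "?K #>\<^bsub>G Mod M\<^esub> ?h x = (\<lambda>y. ?h y) ` (K #> x)" if "x \<in> carrier G" for x
        proof -
          have "?h (k \<otimes> x) = ?h k \<otimes>\<^bsub>G Mod M\<^esub> ?h x" if "k \<in> K" for k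
            using q.hom_mult[of k x] subgroup.mem_carrier[OF sK that] \<open>x \<in> carrier G\<close> by blast
          thus ?thesis unfolding r_coset_def[of "G Mod M"] r_coset_def[of G K x] by auto
        qed
        hence "(\<lambda>x. ?K #>\<^bsub>G Mod M\<^esub> x) ` carrier (G Mod M) = (\<lambda>T. ?h ` T) ` (\<lambda>x. K #> x) ` carrier G"
          unfolding surj[symmetric] image_image by (intro image_cong) auto
        thus ?thesis using KM(5) by simp
      qed
    qed
    thus "?P M" unfolding surj .
  qed
  moreover have "inj_on (\<lambda>x. {\<one>} #> x) (carrier G)"
    by (intro inj_onI) (simp add: r_coset_def)
  ultimately show ?thesis by (rule finite_imageD)
qed

end

section \<open>Word values and the theorem\<close>

text \<open>The values of the derived words of level \<open>i\<close>: the generic element at level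
  0, then commutators of two values of the previous level. Only their values matter, so no words are
  built.\<close>

primrec derived_values :: "('a, 'b) monoid_scheme \<Rightarrow> nat \<Rightarrow> 'a set" where
  "derived_values G 0 = carrier G"
| "derived_values G (Suc i) =
    (\<lambda>(x, y). group_commutator G x y) ` (derived_values G i \<times> derived_values G i)"

context group
begin

section \<open>Restriction to subgroups and derived-word values\<close>

lemma group_commutator_consistent:
  assumes "subgroup H G" "x \<in> H" "y \<in> H"
  shows "group_commutator (G\<lparr>carrier := H\<rparr>) x y = comm x y"
  using assms m_inv_consistent by (simp add: group_commutator_def)

lemma iterated_commutator_consistent:
  assumes "subgroup H G" "x \<in> H" "y \<in> H"
  shows "iterated_commutator (G\<lparr>carrier := H\<rparr>) x n y = iterated_commutator G x n y"
    and "iterated_commutator G x n y \<in> H"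
proof -
  have *: "iterated_commutator G x n y \<in> H" for n
    using assms by (induction n) (auto simp: subgroup_comm)
  show "iterated_commutator (G\<lparr>carrier := H\<rparr>) x n y = iterated_commutator G x n y"
    using assms * by (induction n) (simp_all add: group_commutator_consistent)
  show "iterated_commutator G x n y \<in> H" by (rule *)
qed

lemma left_engel_subgroup:
  assumes H: "subgroup H G" and x: "x \<in> H" "left_engel G n x"
  shows "left_engel (G\<lparr>carrier := H\<rparr>) n x"
  using assms iterated_commutator_consistent(1)[OF H] subgroup.mem_carrier[OF H]
  by (simp add: left_engel_def)

lemma derived_values_closed: "derived_values G i \<subseteq> carrier G"
proof (induction i)
  case (Suc i)
  have "comm x y \<in> carrier G" if "x \<in> derived_values G i" "y \<in> derived_values G i" for x y
    using subsetD[OF Suc that(1)] subsetD[OF Suc that(2)] by simp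
  thus ?case by auto
qed simp

lemma derived_values_Suc: "derived_values G (Suc i) \<subseteq> derived_values G i"
proof (induction i)
  case (Suc i)
  have "derived_values G (Suc i) \<times> derived_values G (Suc i) \<subseteq> derived_values G i \<times> derived_values G i"
    using Suc by blast
  thus ?case unfolding derived_values.simps(2)[of G "Suc i"] derived_values.simps(2)[of G i]
    by (rule image_mono)
qed auto

lemma derived_values_mono: "i \<le> j \<Longrightarrow> derived_values G j \<subseteq> derived_values G i"
  by (induction rule: dec_induct) (use derived_values_Suc in blast)+

lemma derived_values_conj:
  "x \<in> derived_values G i \<Longrightarrow> g \<in> carrier G \<Longrightarrow> inv g \<otimes> x \<otimes> g \<in> derived_values G i"
proof (induction i arbitrary: x)
  case (Suc i)
  then obtain a b where ab: "a \<in> derived_values G i" "b \<in> derived_values G i" "x = comm a b" by auto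
  have "inv g \<otimes> x \<otimes> g = comm (inv g \<otimes> a \<otimes> g) (inv g \<otimes> b \<otimes> g)"
    using conj_comm[OF subsetD[OF derived_values_closed ab(1)] subsetD[OF derived_values_closed ab(2)] Suc.prems(2)]
      ab(3) by simp
  moreover have "inv g \<otimes> a \<otimes> g \<in> derived_values G i" "inv g \<otimes> b \<otimes> g \<in> derived_values G i"
    using Suc ab by auto
  ultimately show ?case by force
qed simp

lemma normal_generate_conj_closed:
  assumes S: "S \<subseteq> carrier G" and conj: "\<And>x g. x \<in> S \<Longrightarrow> g \<in> carrier G \<Longrightarrow> inv g \<otimes> x \<otimes> g \<in> S"
  shows "generate G S \<lhd> G"
proof (rule normal_generateI[OF S])
  show "g \<otimes> h \<otimes> inv g \<in> S" if "h \<in> S" "g \<in> carrier G" for h g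
    using conj[OF that(1), of "inv g"] that(2) by simp
qed

text \<open>The subgroup generated by the values of the next level is normal, so it contains all
  commutators of the group generated by the present level once it contains those of its generators.
  This makes the top factor soluble.\<close>

lemma exp_of_derived_in_derived_values:
  "(derived G ^^ i) (carrier G) \<subseteq> generate G (derived_values G i)"
proof (induction i)
  case 0 show ?case by (simp add: subset_generate)
next
  case (Suc i)
  let ?S = "derived_values G i" and ?T = "derived_values G (Suc i)"
  have sS: "subgroup (generate G ?S) G" and sT: "subgroup (generate G ?T) G"
    by (intro generate_is_subgroup derived_values_closed)+
  have "generate G ?T \<lhd> G"
    using derived_values_closed derived_values_conj by (rule normal_generate_conj_closed)
  hence n: "normal_in G (generate G ?T) (carrier G)" by (simp add: normal_iff_normal_in)
  have c: "comm s t \<in> generate G ?T" if "s \<in> ?S" "t \<in> ?S" for s t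
    using that by (intro generate.incl) force
  have "derived G (generate G ?S) \<subseteq> generate G ?T"
    using comm_generate[OF n derived_values_closed derived_values_closed c]
    by (intro derived_subsetI[OF sS sT])
  thus ?case using mono_derived[OF Suc] by simp
qed

text \<open>Any \<open>b\<close> is a value of level 0, and \<open>y\<close> is a value of every
  level up to \<open>k\<close>, so each commutator with \<open>y\<close> raises the level by one. At
  \<open>i = k\<close> the result is again of level \<open>k\<close>.\<close>

lemma iterated_commutator_derived_values:
  assumes "b \<in> carrier G" "y \<in> derived_values G k" "i \<le> k"
  shows "iterated_commutator G b i y \<in> derived_values G i"
  using assms(3)
proof (induction i)
  case (Suc i)
  hence "iterated_commutator G b i y \<in> derived_values G i" by simp
  moreover have "y \<in> derived_values G i" using derived_values_mono[of i k] Suc assms by auto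
  ultimately show ?case by force
qed (use assms in simp)

lemma powers_generate_normal:
  assumes U: "U \<subseteq> carrier G" "\<And>x g. x \<in> U \<Longrightarrow> g \<in> carrier G \<Longrightarrow> inv g \<otimes> x \<otimes> g \<in> U"
  shows "generate G ((\<lambda>x. x [^] (m::nat)) ` U) \<lhd> G"
proof (rule normal_generate_conj_closed)
  show "(\<lambda>x. x [^] m) ` U \<subseteq> carrier G" using U by auto
  fix y g assume "y \<in> (\<lambda>x. x [^] m) ` U" and g: "g \<in> carrier G"
  then obtain x where x: "x \<in> U" "y = x [^] m" by blast
  have xc: "x \<in> carrier G" using x U by auto
  have "inv g \<otimes> x [^] m \<otimes> g = (inv g \<otimes> x \<otimes> g) [^] m"
  proof (induction m)
    case (Suc m)
    have "inv g \<otimes> x [^] Suc m \<otimes> g = (inv g \<otimes> x [^] m \<otimes> g) \<otimes> (inv g \<otimes> x \<otimes> g)"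
      using xc g by (simp add: m_assoc)
    thus ?case unfolding Suc by simp
  qed (use g in simp)
  thus "inv g \<otimes> y \<otimes> g \<in> (\<lambda>x. x [^] m) ` U" using U(2)[OF x(1) g] x(2) by simp
qed

lemma has_ls_lf_series_restrict_hom:
  assumes T: "subgroup T G" and S: "has_ls_lf_series (G\<lparr>carrier := T\<rparr>)" and h: "group_hom G H h"
  shows "group_hom (G\<lparr>carrier := T\<rparr>) (H\<lparr>carrier := h ` T\<rparr>) h"
    and "has_ls_lf_series (H\<lparr>carrier := h ` T\<rparr>)"
proof -
  interpret h: group_hom G H h by (rule h)
  have Tc: "T \<subseteq> carrier G" using T by (rule subgroup.subset)
  show 1: "group_hom (G\<lparr>carrier := T\<rparr>) (H\<lparr>carrier := h ` T\<rparr>) h"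
    using subgroup_imp_group[OF T] h.H.subgroup_imp_group[OF h.subgroup_img_is_subgroup[OF T]]
      subsetD[OF Tc] h.hom_mult
    by (simp add: group_hom_def group_hom_axioms_def hom_def)
  show "has_ls_lf_series (H\<lparr>carrier := h ` T\<rparr>)"
    using has_ls_lf_series_image[OF 1 _ S] by simp
qed

section \<open>The factors of the series for the verbal subgroup\<close>

text \<open>Modulo \<open>W\<close>, a finite subset lies in the image of a group \<open>T\<close>
  generated by finitely many derived-word values \<open>Y\<close>. Both the elements
  \<open>y\<close> of \<open>Y\<close> and the commutators [b, y, ..., y] with \<open>k\<close>
  entries are derived-word values, so their \<open>m\<close>-th powers lie in \<open>W\<close> and
  \<open>torsion_generated_finite\<close> applies to the image of \<open>T\<close>.\<close>

lemma loc_finite_over_engel_powers: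
  assumes loc: "group_locally has_ls_lf_series G" and m: "0 < (m::nat)"
    and W: "W \<lhd> G" "\<And>y. y \<in> derived_values G k \<Longrightarrow> y [^] m \<in> W"
  shows "loc_finite_over G (generate G (W \<union> derived_values G k)) W"
  unfolding loc_finite_over_def
proof (intro allI impI)
  let ?V = "derived_values G k"
  let ?h = "\<lambda>x. W #> x"
  interpret h: group_hom G "G Mod W" ?h by (rule quotient_hom[OF W(1)])
  have sW: "subgroup W G" using W(1) by (rule normal_imp_subgroup)
  have one: "?h w = \<one>\<^bsub>G Mod W\<^esub>" if "w \<in> W" for w
    using that coset_eq_self_iff[OF sW] subgroup.mem_carrier[OF sW] by simp
  fix F assume F: "finite F \<and> F \<subseteq> generate G (W \<union> ?V)"
  hence "finite F" "F \<subseteq> generate G (W \<union> ?V)" by simp_all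
  from finite_support[OF this] obtain A where A: "finite A" "A \<subseteq> W \<union> ?V" "F \<subseteq> generate G A"
    by blast
  define Y where "Y = A \<inter> ?V"
  have Y: "finite Y" "Y \<subseteq> ?V" and Yc: "Y \<subseteq> carrier G"
    using A derived_values_closed[of k] by (auto simp: Y_def)
  define T where "T = generate G Y"
  have sT: "subgroup T G" unfolding T_def using Yc by (rule generate_is_subgroup)
  have YT: "Y \<subseteq> T" unfolding T_def by (intro subset_generate order_refl)
  let ?T = "G\<lparr>carrier := T\<rparr>" and ?Q = "(G Mod W)\<lparr>carrier := ?h ` T\<rparr>"
  \<comment> \<open>A series is available only for finitely generated subgroups of \<open>G\<close>;
    it is taken for \<open>T\<close> and then pushed to the image of \<open>T\<close> modulo
    \<open>W\<close>.\<close>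
  have "subgroup_generated G Y = ?T" using Yc by (simp add: subgroup_generated_def T_def Int_absorb1)
  hence "has_ls_lf_series ?T" using loc Y(1) Yc by (metis group_locally_def)
  note q = has_ls_lf_series_restrict_hom[OF sT this h.group_hom_axioms]
  interpret q: group_hom ?T ?Q ?h by (rule q)
  have pow: "?h x [^]\<^bsub>?Q\<^esub> m = ?h (x [^] m)" if "x \<in> T" for x
    using q.hom_nat_pow[of x m] that by (simp add: nat_pow_consistent[of x m T])
  have "finite (carrier ?Q)"
  proof (rule q.H.torsion_generated_finite[of "?h ` Y" m k])
    show "finite (?h ` Y)" "?h ` Y \<subseteq> carrier ?Q" using Y(1) YT by auto
    show "carrier ?Q = generate ?Q (?h ` Y)"
      using q.generate_img[of Y] YT generate_consistent[OF YT sT] by (simp add: T_def)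
    show "0 < m" by (rule m)
    show "y [^]\<^bsub>?Q\<^esub> m = \<one>\<^bsub>?Q\<^esub>" if y: "y \<in> ?h ` Y" for y
    proof -
      obtain z where z: "z \<in> Y" "y = ?h z" using y by blast
      have "z [^] m \<in> W" using W(2) z Y by blast
      thus ?thesis using pow[of z] z YT one by auto
    qed
    show "iterated_commutator ?Q a k y [^]\<^bsub>?Q\<^esub> m = \<one>\<^bsub>?Q\<^esub>" if a: "a \<in> carrier ?Q" and y: "y \<in> ?h ` Y" for a y
    proof -
      obtain z where z: "z \<in> Y" "y = ?h z" using y by blast
      obtain b where b: "b \<in> T" "a = ?h b" using a by auto
      have zT: "z \<in> T" using z YT by auto
      note it = iterated_commutator_consistent[OF sT b(1) zT, of k]
      have "iterated_commutator ?Q a k y = ?h (iterated_commutator G b k z)"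
        using q.hom_iterated_commutator[of b z k] b z zT it(1) by simp
      moreover have "iterated_commutator G b k z \<in> ?V"
        using iterated_commutator_derived_values[of b z k k] z Y(2) b(1) subgroup.mem_carrier[OF sT] by auto
      hence "iterated_commutator G b k z [^] m \<in> W" by (rule W(2))
      ultimately show ?thesis using pow[OF it(2)] one by simp
    qed
    show "has_ls_lf_series ?Q" by (rule q(2))
  qed
  hence fin: "finite (?h ` T)" by simp
  have "?h ` generate G A = generate (G Mod W) (?h ` A)"
    using h.generate_img[of A] A(2) derived_values_closed[of k] subgroup.subset[OF sW] by blast
  also have "\<dots> \<subseteq> ?h ` T"
  proof (rule h.H.generate_subgroup_incl[OF _ h.subgroup_img_is_subgroup[OF sT]])
    have "?h a \<in> ?h ` T" if a: "a \<in> A" for a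
    proof (cases "a \<in> W")
      case True
      hence "?h a = ?h \<one>" using one h.hom_one by simp
      thus ?thesis using subgroup.one_closed[OF sT] by blast
    next
      case False
      hence "a \<in> T" using a A(2) YT by (auto simp: Y_def)
      thus ?thesis by blast
    qed
    thus "?h ` A \<subseteq> ?h ` T" by blast
  qed
  finally have "?h ` generate G A \<subseteq> ?h ` T" .
  moreover have "generate G F \<subseteq> generate G A"
    using A derived_values_closed[of k] subgroup.subset[OF sW]
    by (intro generate_subgroup_incl generate_is_subgroup) auto
  ultimately have "?h ` generate G F \<subseteq> ?h ` T" by blast
  thus "finite (?h ` generate G F)" using fin by (rule finite_subset)
qed

text \<open>The elements of \<open>F\<close> need not be Engel themselves. They lie in a subgroup
  generated by finitely many elements of \<open>S\<close>, which has a series and is therefore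
  nilpotent.\<close>

lemma loc_soluble_over_engel:
  assumes loc: "group_locally has_ls_lf_series G" and S: "\<And>x. x \<in> S \<Longrightarrow> left_engel G n x"
  shows "loc_soluble_over G (generate G S) {\<one>}"
  unfolding loc_soluble_over_def
proof (intro allI impI)
  fix F assume F: "finite F \<and> F \<subseteq> generate G S"
  hence "finite F" "F \<subseteq> generate G S" by simp_all
  from finite_support[OF this] obtain E where E: "finite E" "E \<subseteq> S" "F \<subseteq> generate G E" by blast
  have Ec: "E \<subseteq> carrier G" using E(2) S by (auto simp: left_engel_def)
  define A where "A = generate G E"
  have sA: "subgroup A G" unfolding A_def using Ec by (rule generate_is_subgroup)
  have EA: "E \<subseteq> A" unfolding A_def by (intro subset_generate order_refl)
  interpret A: group "G\<lparr>carrier := A\<rparr>" by (rule subgroup_imp_group[OF sA])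
  have "subgroup_generated G E = G\<lparr>carrier := A\<rparr>"
    using Ec by (simp add: subgroup_generated_def A_def Int_absorb1)
  hence ser: "has_ls_lf_series (G\<lparr>carrier := A\<rparr>)" using loc E(1) Ec by (metis group_locally_def)
  have 1: "carrier (G\<lparr>carrier := A\<rparr>) = generate (G\<lparr>carrier := A\<rparr>) E"
    using generate_consistent[OF EA sA] by (simp add: A_def)
  have 2: "left_engel (G\<lparr>carrier := A\<rparr>) n e" if "e \<in> E" for e
    using left_engel_subgroup[OF sA] that EA E(2) S by blast
  have 3: "E \<subseteq> carrier (G\<lparr>carrier := A\<rparr>)" using EA by simp
  obtain c where "carrier (G\<lparr>carrier := A\<rparr>) \<subseteq>
      rel_center (G\<lparr>carrier := A\<rparr>) {\<one>\<^bsub>G\<lparr>carrier := A\<rparr>\<^esub>} (carrier (G\<lparr>carrier := A\<rparr>)) c"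
    using A.engel_generated_nilpotent[OF E(1) 3 2 1 ser] by blast
  from A.nilpotent_imp_soluble[OF A.subgroup_self this]
  have "(derived G ^^ c) A \<subseteq> {\<one>}" using exp_of_derived_consistent[OF sA sA order_refl] by simp
  moreover have "generate G F \<subseteq> A" using E(3) sA unfolding A_def by (rule generate_subgroup_incl)
  ultimately show "\<exists>j. (derived G ^^ j) (generate G F) \<subseteq> {\<one>}"
    using mono_exp_of_derived[of "generate G F" A c] by blast
qed

text \<open>\<open>U\<close> is kept abstract because two groups are involved: it will consist of
  the values of \<open>u\<close> in an ambient group, while \<open>G\<close> is the verbal subgroup
  they generate and the derived-word values are formed inside \<open>G\<close>.\<close>

theorem local_series_imp_series:
  assumes loc: "group_locally has_ls_lf_series G" and m: "0 < (m::nat)"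
    and U: "U \<subseteq> carrier G" "\<And>x g. x \<in> U \<Longrightarrow> g \<in> carrier G \<Longrightarrow> inv g \<otimes> x \<otimes> g \<in> U"
    and eng: "\<And>x. x \<in> U \<Longrightarrow> left_engel G n (x [^] m)"
    and k: "derived_values G k \<subseteq> U"
  shows "has_ls_lf_series G"
proof -
  define W where "W = generate G ((\<lambda>x. x [^] m) ` U)"
  define D where "D = generate G (W \<union> derived_values G k)"
  have W: "W \<lhd> G" unfolding W_def using U by (rule powers_generate_normal)
  have Wpow: "y [^] m \<in> W" if "y \<in> derived_values G k" for y
    unfolding W_def using that k by (intro generate.incl) blast
  have D: "D \<lhd> G"
    unfolding D_def
  proof (rule normal_generate_conj_closed)
    show "W \<union> derived_values G k \<subseteq> carrier G"
      using derived_values_closed[of k] subgroup.subset[OF normal_imp_subgroup[OF W]] by simp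
    show "inv g \<otimes> x \<otimes> g \<in> W \<union> derived_values G k" if "x \<in> W \<union> derived_values G k" "g \<in> carrier G" for x g
      using that derived_values_conj[of x k g] normal.inv_op_closed1[OF W] by auto
  qed
  have WD: "W \<subseteq> D" and VD: "derived_values G k \<subseteq> D" unfolding D_def by (intro subset_generate; simp)+
  have "loc_soluble_over G W {\<one>}"
    unfolding W_def using eng by (intro loc_soluble_over_engel[OF loc]) auto
  moreover have "loc_finite_over G D W"
    unfolding D_def by (rule loc_finite_over_engel_powers[OF loc m W Wpow])
  moreover have "loc_soluble_over G (carrier G) D"
    unfolding loc_soluble_over_def
  proof (intro allI impI exI[of _ k])
    fix F assume "finite F \<and> F \<subseteq> carrier G"
    hence "(derived G ^^ k) (generate G F) \<subseteq> (derived G ^^ k) (carrier G)"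
      by (intro mono_exp_of_derived generate_incl) simp
    also have "\<dots> \<subseteq> generate G (derived_values G k)" by (rule exp_of_derived_in_derived_values)
    also have "\<dots> \<subseteq> D" using VD normal_imp_subgroup[OF D] by (rule generate_subgroup_incl)
    finally show "(derived G ^^ k) (generate G F) \<subseteq> D" .
  qed
  ultimately show ?thesis using has_ls_lf_series_three_step[OF W D WD] by blast
qed

section \<open>Values of words\<close>

lemma word_eval_closed: "\<theta> \<in> UNIV \<rightarrow> carrier G \<Longrightarrow> word_eval G \<theta> w \<in> carrier G"
  by (induction w) auto

lemma word_eval_cong: "(\<And>x. x \<in> vars w \<Longrightarrow> \<theta> x = \<eta> x) \<Longrightarrow> word_eval G \<theta> w = word_eval G \<eta> w"
  by (induction w) auto

lemma word_eval_rename: "word_eval G \<theta> (rename_vars f w) = word_eval G (\<theta> \<circ> f) w"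
  by (induction w) auto

lemma word_eval_one: "word_eval G (\<lambda>_. \<one>) w = \<one>"
  by (induction w) auto

lemma word_eval_power: "word_eval G \<theta> (power_word w m) = word_eval G \<theta> w [^] m"
  by (induction m) auto

lemma word_eval_comm: "word_eval G \<theta> (WComm a b) = comm (word_eval G \<theta> a) (word_eval G \<theta> b)"
  by (simp add: WComm_def group_commutator_def)

lemma word_values_closed: "word_values G w \<subseteq> carrier G"
  using word_eval_closed by (auto simp: word_values_def)

lemma word_values_conj:
  assumes "x \<in> word_values G w" "g \<in> carrier G"
  shows "inv g \<otimes> x \<otimes> g \<in> word_values G w"
proof -
  obtain \<theta> where \<theta>: "\<theta> \<in> UNIV \<rightarrow> carrier G" "x = word_eval G \<theta> w" using assms by (auto simp: word_values_def)
  let ?\<theta> = "\<lambda>v. inv g \<otimes> \<theta> v \<otimes> g"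
  have "inv g \<otimes> word_eval G \<theta> w \<otimes> g = word_eval G ?\<theta> w" for w
  proof (induction w)
    case (WInv w)
    show ?case unfolding word_eval.simps WInv[symmetric]
      using word_eval_closed[OF \<theta>(1), of w] assms(2) by (simp add: word_simps)
  next
    case (WMul w v)
    show ?case unfolding word_eval.simps WMul[symmetric]
      using word_eval_closed[OF \<theta>(1)] assms(2) by (simp add: word_simps)
  qed (use assms(2) in auto)
  moreover have "?\<theta> \<in> UNIV \<rightarrow> carrier G" using \<theta>(1) assms(2) by auto
  ultimately show ?thesis using \<theta>(2) by (auto simp: word_values_def)
qed

text \<open>Substituting the identity into all copies of \<open>u\<close> but the first one.\<close>

lemma word_values_product_word:
  assumes "0 < s"
  shows "word_values G u \<subseteq> word_values G (product_word s u)"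
proof
  fix x assume "x \<in> word_values G u"
  then obtain \<theta> where \<theta>: "\<theta> \<in> UNIV \<rightarrow> carrier G" "x = word_eval G \<theta> u" by (auto simp: word_values_def)
  define \<eta> where "\<eta> = (\<lambda>(j::nat, v). if j = 0 then \<theta> v else \<one>)"
  have "word_eval G \<eta> (foldr WMul (map (\<lambda>j. rename_vars (Pair j) u) js) WOne) = \<one>" if "0 \<notin> set js" for js
    using that
  proof (induction js)
    case (Cons j js)
    have "\<eta> \<circ> Pair j = (\<lambda>_. \<one>)" using Cons.prems by (auto simp: \<eta>_def)
    thus ?case using Cons by (simp add: word_eval_rename word_eval_one)
  qed simp
  moreover have "[0..<s] = 0 # [1..<s]" using assms by (simp add: upt_conv_Cons)
  moreover have "\<eta> \<circ> Pair 0 = \<theta>" by (auto simp: \<eta>_def)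
  ultimately have "word_eval G \<eta> (product_word s u) = x"
    using \<theta> word_eval_closed[OF \<theta>(1)] by (simp add: product_word_def word_eval_rename)
  moreover have "\<eta> \<in> UNIV \<rightarrow> carrier G" using \<theta>(1) by (auto simp: \<eta>_def)
  ultimately show "x \<in> word_values G (product_word s u)" by (auto simp: word_values_def)
qed

lemma pow_word_values:
  assumes "x \<in> word_values G w"
  shows "x [^] m \<in> word_values G (power_word w m)"
proof -
  obtain \<theta> where "\<theta> \<in> UNIV \<rightarrow> carrier G" "x = word_eval G \<theta> w"
    using assms unfolding word_values_def by blast
  moreover from this have "x [^] m = word_eval G \<theta> (power_word w m)" by (simp add: word_eval_power)
  ultimately show ?thesis unfolding word_values_def by blast
qed

text \<open>Induction on the formation of the word. For a bracket, a value of level one above both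
  levels is a commutator of two values that lie in both earlier levels, hence of a value of each
  part.\<close>

lemma derived_values_in_word_values:
  assumes "mlc_of_weight s u"
  shows "\<exists>k. derived_values G k \<subseteq> word_values G u"
  using assms
proof induction
  case (variable x)
  have "y = word_eval G (\<lambda>_. y) (WVar x) \<and> (\<lambda>_. y) \<in> UNIV \<rightarrow> carrier G" if "y \<in> carrier G" for y
    using that by simp
  hence "derived_values G 0 \<subseteq> word_values G (WVar x)" unfolding word_values_def by fastforce
  thus ?case by blast
next
  case (bracket s a t b)
  then obtain i j where i: "derived_values G i \<subseteq> word_values G a" and j: "derived_values G j \<subseteq> word_values G b"
    by blast
  let ?k = "max i j"
  have "derived_values G (Suc ?k) \<subseteq> word_values G (WComm a b)"
  proof
    fix z assume "z \<in> derived_values G (Suc ?k)"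
    then obtain x y where xy: "x \<in> derived_values G ?k" "y \<in> derived_values G ?k" "z = comm x y" by auto
    have "x \<in> word_values G a" "y \<in> word_values G b"
      using xy i j derived_values_mono[of i ?k] derived_values_mono[of j ?k] by auto
    obtain \<theta> where \<theta>: "\<theta> \<in> UNIV \<rightarrow> carrier G" "x = word_eval G \<theta> a"
      using \<open>x \<in> word_values G a\<close> unfolding word_values_def by blast
    obtain \<eta> where \<eta>: "\<eta> \<in> UNIV \<rightarrow> carrier G" "y = word_eval G \<eta> b"
      using \<open>y \<in> word_values G b\<close> unfolding word_values_def by blast
    \<comment> \<open>The two parts have disjoint variables, so one substitution can realize both
      values at once.\<close>
    define \<zeta> where "\<zeta> v = (if v \<in> vars a then \<theta> v else \<eta> v)" for v
    have "word_eval G \<zeta> a = x" unfolding \<theta>(2) by (rule word_eval_cong) (simp add: \<zeta>_def)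
    moreover have "word_eval G \<zeta> b = y"
      unfolding \<eta>(2) using bracket(3) by (intro word_eval_cong) (auto simp: \<zeta>_def)
    ultimately have "z = word_eval G \<zeta> (WComm a b)" using xy(3) by (simp add: word_eval_comm)
    moreover have "\<zeta> \<in> UNIV \<rightarrow> carrier G" using \<theta>(1) \<eta>(1) by (simp add: \<zeta>_def Pi_iff)
    ultimately show "z \<in> word_values G (WComm a b)" unfolding word_values_def by blast
  qed
  thus ?case by blast
qed

lemma derived_values_subgroup:
  assumes "subgroup H G"
  shows "derived_values (G\<lparr>carrier := H\<rparr>) i \<subseteq> derived_values G i"
proof (induction i)
  case 0 show ?case using subgroup.subset[OF assms] by simp
next
  case (Suc i)
  interpret H: group "G\<lparr>carrier := H\<rparr>" by (rule subgroup_imp_group[OF assms])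
  show ?case
  proof
    fix z assume "z \<in> derived_values (G\<lparr>carrier := H\<rparr>) (Suc i)"
    then obtain x y where xy: "x \<in> derived_values (G\<lparr>carrier := H\<rparr>) i"
      "y \<in> derived_values (G\<lparr>carrier := H\<rparr>) i" "z = group_commutator (G\<lparr>carrier := H\<rparr>) x y" by auto
    have "x \<in> H" "y \<in> H" using xy H.derived_values_closed[of i] by auto
    hence "z = comm x y" using group_commutator_consistent[OF assms] xy by simp
    thus "z \<in> derived_values G (Suc i)" using Suc xy by force
  qed
qed

text \<open>From left to right, every subgroup inherits a series by intersection. In the other
  direction, a \<open>u\<close>-value is also a value of the product word, so its
  \<open>m\<close>-th power is Engel in \<open>G\<close> and hence in the verbal subgroup.\<close>

theorem has_ls_lf_series_verbal_subgroup_iff: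
  assumes m: "0 < m" and s: "0 < s" and u: "multilinear_commutator_word u"
    and eng: "\<forall>x\<in>word_values G (power_word (product_word s u) m). left_engel G n x"
  shows "has_ls_lf_series (verbal_subgroup G u) \<longleftrightarrow> group_locally has_ls_lf_series (verbal_subgroup G u)"
proof -
  let ?N = "verbal_subgroup G u"
  let ?U = "word_values G u"
  define M where "M = generate G ?U"
  have N: "?N = G\<lparr>carrier := M\<rparr>"
    using word_values_closed[of u] by (simp add: verbal_subgroup_def subgroup_generated_def M_def Int_absorb1)
  have sM: "subgroup M G" unfolding M_def using word_values_closed by (rule generate_is_subgroup)
  have Mc: "M \<subseteq> carrier G" using sM by (rule subgroup.subset)
  interpret N: group ?N unfolding N by (rule subgroup_imp_group[OF sM])
  have inv_N: "inv\<^bsub>?N\<^esub> g = inv g" if "g \<in> M" for g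
    unfolding N using that m_inv_consistent[OF sM] by simp
  show ?thesis
  proof
    assume S: "has_ls_lf_series ?N"
    show "group_locally has_ls_lf_series ?N"
      unfolding group_locally_def subgroup_generated_def
    proof (intro allI impI)
      fix F
      have "subgroup (generate ?N (carrier ?N \<inter> F)) ?N" by (intro N.generate_is_subgroup) auto
      thus "has_ls_lf_series (?N\<lparr>carrier := generate ?N (carrier ?N \<inter> F)\<rparr>)"
        using S by (rule N.has_ls_lf_series_subgroup)
    qed
  next
    assume loc: "group_locally has_ls_lf_series ?N"
    obtain t where "mlc_of_weight t u" using u by (auto simp: multilinear_commutator_word_def)
    then obtain k where k: "derived_values G k \<subseteq> ?U" using derived_values_in_word_values by blast
    have UM: "?U \<subseteq> M" unfolding M_def by (intro subset_generate order_refl)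
    show "has_ls_lf_series ?N"
    proof (rule N.local_series_imp_series[OF loc m])
      show "?U \<subseteq> carrier ?N" using UM by (simp add: N)
      show "inv\<^bsub>?N\<^esub> g \<otimes>\<^bsub>?N\<^esub> x \<otimes>\<^bsub>?N\<^esub> g \<in> ?U" if "x \<in> ?U" "g \<in> carrier ?N" for x g
      proof -
        have g: "g \<in> M" using that(2) by (simp add: N)
        have "inv g \<otimes> x \<otimes> g \<in> ?U" using word_values_conj[OF that(1)] g Mc by blast
        thus ?thesis using inv_N[OF g] by (simp add: N)
      qed
      show "left_engel ?N n (x [^]\<^bsub>?N\<^esub> m)" if x: "x \<in> ?U" for x
      proof -
        have "x \<in> word_values G (product_word s u)" using x word_values_product_word[OF s, of u] by auto
        hence "x [^] m \<in> word_values G (power_word (product_word s u) m)" by (rule pow_word_values)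
        hence e: "left_engel G n (x [^] m)" using eng by blast
        have "x [^] m = x [^]\<^bsub>?N\<^esub> m" unfolding N by (rule nat_pow_consistent)
        moreover have "x [^]\<^bsub>?N\<^esub> m \<in> M" using N.nat_pow_closed[of x m] x UM by (auto simp: N)
        ultimately show ?thesis using left_engel_subgroup[OF sM _ e] by (simp add: N)
      qed
      show "derived_values ?N k \<subseteq> ?U" using derived_values_subgroup[OF sM, of k] k unfolding N by blast
    qed
  qed
qed

end

theorem mainTheorem7:
  fixes m n :: nat and u :: "nat gword"
  assumes "m > 0" and "n > 0" and "multilinear_commutator_word u"
  shows "(class_U m n u :: 'a monoid set) =
    {G. group G \<and>
      (\<forall>x\<in>word_values G (power_word (product_word 896 u) m). left_engel G n x) \<and>
      group_locally has_ls_lf_series (verbal_subgroup G u)}"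
  unfolding class_U_def
  using group.has_ls_lf_series_verbal_subgroup_iff[OF _ assms(1) _ assms(3), of _ 896] by auto

end
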